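(* There exists an analytic self-map $\phi\colon\mathbb{D}\to\mathbb{D}$ satisfying $\int_{\mathbb{T}}\log(1-|\phi^\ast|)\,dm>-\infty$ such that, if $w$ is any outer function with $|w^\ast|^2=1-|\phi^\ast|$ $m$-a.e. on $\mathbb{T}$, then the weighted composition operator $M_wC_\phi\colon f\mapsto w\,(f\circ\phi)$ is Hilbert–Schmidt on $H^2$, but $M_wC_\phi\notin S_p(H^2)$ for every $p<2$.
   Context: $\mathbb{D}$ is the open unit disk, $\mathbb{T}=\partial\mathbb{D}$, $m$ the normalized Lebesgue measure on $\mathbb{T}$, $H^2$ the Hardy space. For a bounded analytic function $f$ on $\mathbb{D}$, $f^\ast(\xi)=\lim_{r\to1^-}f(r\xi)$ is its radial limit, defined $m$-a.e. $S_p(H^2)$, $p>0$, is the Schatten class of compact operators $T$ on $H^2$ with $\sum_n s_n(T)^p<\infty$ ($s_n$ the singular numbers). *)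

theory Defs
  imports "HOL-Complex_Analysis.Complex_Analysis"
begin

definition taylor_coeff :: "(complex \<Rightarrow> complex) \<Rightarrow> nat \<Rightarrow> complex" where
  "taylor_coeff f n = (deriv ^^ n) f 0 / of_nat (fact n)"

definition H2 :: "(complex \<Rightarrow> complex) set" where
  "H2 = {f. f holomorphic_on ball 0 1 \<and> summable (\<lambda>n. (cmod (taylor_coeff f n))\<^sup>2)}"

definition h2norm :: "(complex \<Rightarrow> complex) \<Rightarrow> real" where
  "h2norm f = sqrt (\<Sum>n. (cmod (taylor_coeff f n))\<^sup>2)"

definition radial_lim :: "(complex \<Rightarrow> complex) \<Rightarrow> complex \<Rightarrow> complex" where
  "radial_lim f \<xi> = Lim (at_left (1::real)) (\<lambda>r. f (complex_of_real r * \<xi>))"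

(* outer function: w = c * exp(Herglotz integral of an integrable real function u = log|w^*|),
   m = dt/(2 pi) on [0,2 pi] *)
definition outer :: "(complex \<Rightarrow> complex) \<Rightarrow> bool" where
  "outer w \<longleftrightarrow> (\<exists>c u. cmod c = 1 \<and> set_integrable lborel {0..2*pi} (u :: real \<Rightarrow> real) \<and>
     (\<forall>z\<in>ball 0 1. w z = c * exp ((1 / (2 * pi)) *
        (LINT t:{0..2*pi}|lborel. (cis t + z) / (cis t - z) * complex_of_real (u t)))))"

(* linear operators on H^2 (acting on functions; only values on the disk matter) *)
definition linear_on_H2 :: "((complex \<Rightarrow> complex) \<Rightarrow> (complex \<Rightarrow> complex)) \<Rightarrow> bool" where
  "linear_on_H2 T \<longleftrightarrow> (\<forall>f\<in>H2. \<forall>g\<in>H2. \<forall>a b. \<forall>z\<in>ball 0 1.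
      T (\<lambda>x. a * f x + b * g x) z = a * T f z + b * T g z)"

definition bounded_on_H2 :: "((complex \<Rightarrow> complex) \<Rightarrow> (complex \<Rightarrow> complex)) \<Rightarrow> bool" where
  "bounded_on_H2 T \<longleftrightarrow> linear_on_H2 T \<and> (\<forall>f\<in>H2. T f \<in> H2) \<and>
      (\<exists>K. \<forall>f\<in>H2. h2norm (T f) \<le> K * h2norm f)"

definition opnorm_H2 :: "((complex \<Rightarrow> complex) \<Rightarrow> (complex \<Rightarrow> complex)) \<Rightarrow> real" where
  "opnorm_H2 T = Sup {h2norm (T f) | f. f \<in> H2 \<and> h2norm f \<le> 1}"

definition rank_le_H2 :: "((complex \<Rightarrow> complex) \<Rightarrow> (complex \<Rightarrow> complex)) \<Rightarrow> nat \<Rightarrow> bool" where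
  "rank_le_H2 R n \<longleftrightarrow> (\<exists>g :: nat \<Rightarrow> complex \<Rightarrow> complex. \<forall>f\<in>H2. \<exists>c :: nat \<Rightarrow> complex.
      \<forall>z\<in>ball 0 1. R f z = (\<Sum>i<n. c i * g i z))"

(* n-th singular number s_n(T) (n = 0,1,...), as the n-th approximation number
   inf { ||T - R|| : rank R <= n }, which equals the n-th singular number on Hilbert space *)
definition sing_num :: "((complex \<Rightarrow> complex) \<Rightarrow> (complex \<Rightarrow> complex)) \<Rightarrow> nat \<Rightarrow> real" where
  "sing_num T n = Inf {opnorm_H2 (\<lambda>f z. T f z - R f z) | R. bounded_on_H2 R \<and> rank_le_H2 R n}"

definition Schatten :: "real \<Rightarrow> ((complex \<Rightarrow> complex) \<Rightarrow> (complex \<Rightarrow> complex)) \<Rightarrow> bool" where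
  "Schatten p T \<longleftrightarrow> bounded_on_H2 T \<and> summable (\<lambda>n. sing_num T n powr p)"

definition hilbert_schmidt :: "((complex \<Rightarrow> complex) \<Rightarrow> (complex \<Rightarrow> complex)) \<Rightarrow> bool" where
  "hilbert_schmidt T \<longleftrightarrow> Schatten 2 T"

end

theory Submission
  imports Defs
begin

text \<open>
  Whenever \<open>\<bar>\<phi>\<^sup>*\<bar> < 1\<close> almost everywhere, the columns of \<open>T = M\<^sub>w C\<^sub>\<phi>\<close> satisfy
  \<open>\<Sum>n. \<parallel>w \<phi>\<^sup>n\<parallel>\<^sup>2 = \<integral> (1 - \<bar>\<phi>\<^sup>*\<bar>) / (1 - \<bar>\<phi>\<^sup>*\<bar>\<^sup>2) dm \<le> 1\<close>, so \<open>T\<close> is Hilbert--Schmidt.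
  For the lower bounds let \<open>\<phi> = exp \<circ> E\<close> in the half-plane coordinate
  \<open>\<zeta> = (1 + z) / (1 - z)\<close>, where \<open>E \<zeta> = - 20 \<zeta> - (\<Sum>j. d\<^sub>j (\<pi> / 2 + i Ln (\<zeta> - i j)))\<close> up to imaginary
  constants. On the boundary segment between \<open>i k\<close> and \<open>i (k + 1)\<close> the modulus of \<open>\<phi>\<^sup>*\<close> is the constant
  \<open>exp (- \<epsilon>\<^sub>k)\<close> with \<open>\<epsilon>\<^sub>k = \<pi> (\<Sum>j>k. d\<^sub>j)\<close>, chosen as \<open>s exp (- \<surd>(k + 1))\<close>, while the linear
  term makes \<open>\<phi>\<^sup>*\<close> wind around the full circle. The segment has harmonic measure of order
  \<open>k\<^sup>-\<^sup>2\<close>, hence \<open>\<parallel>T f\<parallel>\<^sup>2\<close> is at least a constant times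
  \<open>\<epsilon>\<^sub>k / k\<^sup>2 \<parallel>f\<parallel>\<^sup>2\<close> for all polynomials \<open>f\<close> of degree at most \<open>1 / \<epsilon>\<^sub>k\<close>. This bounds
  \<open>1 / \<epsilon>\<^sub>k\<close> many singular numbers from below, and \<open>(1 / \<epsilon>\<^sub>k) (\<epsilon>\<^sub>k / k\<^sup>2)\<^bsup>p/2\<^esup>\<close> is unbounded
  for \<open>p < 2\<close>.
\<close>

section \<open>Square-summable sequences and Hilbert--Schmidt matrices\<close>

text \<open>Two demands meet in the profile \<open>exp (- sqrt k)\<close>. Level \<open>k\<close>
  occupies an arc of measure of order 1/k^2, so the logarithm of 1 minus the boundary modulus is
  integrable because the sum of sqrt(k)/k^2 converges; with \<open>k\<close> in place of its root
  the sum would diverge. On the other side, the number of available dimensions must outgrow every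
  power of \<open>k\<close>, since working on that arc alone costs a factor of order k^-p in the
  p-th powers. The formula for E is dictated by boundary values: the harmonic function \<pi>/2 -
  arg(\<zeta> - i j) is 0 on the imaginary axis above i j and \<pi> below it, so sums of such
  functions produce a prescribed decreasing step profile. The factor exp(-20 \<zeta>) has boundary
  modulus 1. It leaves the profile alone and reduces the estimate on a segment to Parseval on a full
  circle. Of \<open>w\<close> only the boundary modulus is prescribed. It enters through |w|^2 in
  boundary integrals and through |w| \<le> 1 on the disc, and the latter has to be extracted from
  the Herglotz representation.\<close>

definition l2 :: "(nat \<Rightarrow> complex) set" where
  "l2 = {a. summable (\<lambda>k. (cmod (a k))\<^sup>2)}"

definition l2ip :: "(nat \<Rightarrow> complex) \<Rightarrow> (nat \<Rightarrow> complex) \<Rightarrow> complex" where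
  "l2ip a b = (\<Sum>k. a k * cnj (b k))"

definition l2sq :: "(nat \<Rightarrow> complex) \<Rightarrow> real" where
  "l2sq a = (\<Sum>k. (cmod (a k))\<^sup>2)"

lemma l2_summable_prod:
  assumes "a \<in> l2" "b \<in> l2"
  shows "summable (\<lambda>k. norm (a k * b k))"
proof (rule summable_comparison_test')
  show "summable (\<lambda>k. (cmod (a k))\<^sup>2 + (cmod (b k))\<^sup>2)"
    using assms by (auto simp: l2_def intro: summable_add)
  fix k
  have "0 \<le> (cmod (a k) - cmod (b k))\<^sup>2" by simp
  then have "2 * (cmod (a k) * cmod (b k)) \<le> (cmod (a k))\<^sup>2 + (cmod (b k))\<^sup>2"
    by (simp add: power2_eq_square algebra_simps)
  moreover have "0 \<le> cmod (a k) * cmod (b k)" by simp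
  ultimately have "cmod (a k) * cmod (b k) \<le> (cmod (a k))\<^sup>2 + (cmod (b k))\<^sup>2" by linarith
  then show "norm (norm (a k * b k)) \<le> (cmod (a k))\<^sup>2 + (cmod (b k))\<^sup>2"
    by (simp add: norm_mult)
qed

lemma l2_cnj: "a \<in> l2 \<Longrightarrow> (\<lambda>k. cnj (a k)) \<in> l2"
  by (simp add: l2_def)

lemma l2_summable_ip:
  assumes "a \<in> l2" "b \<in> l2"
  shows "summable (\<lambda>k. a k * cnj (b k))"
  using l2_summable_prod[OF assms(1) l2_cnj[OF assms(2)]] by (rule summable_norm_cancel)

lemma norm_add_sq_le: "(norm (x + y))\<^sup>2 \<le> 2 * (norm x)\<^sup>2 + 2 * (norm (y::'a::real_normed_vector))\<^sup>2"
proof -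
  have "(norm (x + y))\<^sup>2 \<le> (norm x + norm y)\<^sup>2"
    by (intro power_mono norm_triangle_ineq) simp
  also have "\<dots> \<le> 2 * (norm x)\<^sup>2 + 2 * (norm y)\<^sup>2"
    using sum_squares_bound[of "norm x" "norm y"] by (simp add: power2_sum)
  finally show ?thesis .
qed

lemma l2_add:
  assumes "a \<in> l2" "b \<in> l2"
  shows "(\<lambda>k. a k + b k) \<in> l2" and "l2sq (\<lambda>k. a k + b k) \<le> 2 * l2sq a + 2 * l2sq b"
proof -
  have s: "summable (\<lambda>k. 2 * (cmod (a k))\<^sup>2 + 2 * (cmod (b k))\<^sup>2)"
    using assms by (auto simp: l2_def intro!: summable_add summable_mult)
  show 1: "(\<lambda>k. a k + b k) \<in> l2"
    unfolding l2_def mem_Collect_eq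
    by (rule summable_comparison_test'[OF s]) (use norm_add_sq_le in auto)
  have "l2sq (\<lambda>k. a k + b k) \<le> (\<Sum>k. 2 * (cmod (a k))\<^sup>2 + 2 * (cmod (b k))\<^sup>2)"
    unfolding l2sq_def using 1 s by (intro suminf_le norm_add_sq_le) (auto simp: l2_def)
  also have "\<dots> = 2 * l2sq a + 2 * l2sq b"
    unfolding l2sq_def using assms
    by (subst suminf_add[symmetric]) (auto simp: l2_def suminf_mult intro!: summable_mult)
  finally show "l2sq (\<lambda>k. a k + b k) \<le> 2 * l2sq a + 2 * l2sq b" .
qed

lemma l2_scale:
  assumes "a \<in> l2"
  shows "(\<lambda>k. c * a k) \<in> l2" and "l2sq (\<lambda>k. c * a k) = (cmod c)\<^sup>2 * l2sq a"
  using assms by (auto simp: l2_def l2sq_def norm_mult power_mult_distrib suminf_mult intro: summable_mult)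

lemma l2_diff_scale:
  assumes "a \<in> l2" "b \<in> l2"
  shows "(\<lambda>k. a k - c * b k) \<in> l2"
  using l2_add(1)[OF assms(1) l2_scale(1)[OF assms(2), of "-c"]] by simp

lemma l2_zero: "(\<lambda>k. 0) \<in> l2" "l2sq (\<lambda>k. 0) = 0" "l2ip (\<lambda>k. 0) b = 0"
  by (auto simp: l2_def l2sq_def l2ip_def)

lemma l2sq_nonneg: "a \<in> l2 \<Longrightarrow> 0 \<le> l2sq a"
  unfolding l2sq_def l2_def by (auto intro: suminf_nonneg)

lemma l2ip_diff_scale:
  assumes "a \<in> l2" "b \<in> l2" "v \<in> l2"
  shows "l2ip (\<lambda>k. a k - c * b k) v = l2ip a v - c * l2ip b v"
proof -
  have "(\<lambda>k. a k * cnj (v k) - c * (b k * cnj (v k))) sums (l2ip a v - c * l2ip b v)"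
    unfolding l2ip_def using assms
    by (intro sums_diff sums_mult summable_sums l2_summable_ip)
  then show ?thesis unfolding l2ip_def by (simp add: sums_iff algebra_simps)
qed

lemma l2ip_scale:
  assumes "a \<in> l2" "v \<in> l2"
  shows "l2ip (\<lambda>k. c * a k) v = c * l2ip a v"
  using l2_summable_ip[OF assms] unfolding l2ip_def by (simp add: suminf_mult mult.assoc)

lemma l2ip_cnj:
  assumes "a \<in> l2" "b \<in> l2"
  shows "l2ip b a = cnj (l2ip a b)"
proof -
  have "(\<lambda>k. cnj (a k * cnj (b k))) sums cnj (l2ip a b)"
    unfolding l2ip_def sums_cnj using assms by (intro summable_sums l2_summable_ip)
  then show ?thesis unfolding l2ip_def by (simp add: sums_iff mult.commute)
qed

lemma l2ip_self:
  assumes "a \<in> l2"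
  shows "l2ip a a = of_real (l2sq a)"
proof -
  have "(\<lambda>k. complex_of_real ((cmod (a k))\<^sup>2)) sums of_real (l2sq a)"
    unfolding l2sq_def sums_of_real_iff using assms by (intro summable_sums) (simp add: l2_def)
  then show ?thesis unfolding l2ip_def by (simp add: sums_iff complex_norm_square[symmetric] del: of_real_power)
qed

lemma l2sq_diff_scale:
  assumes a: "a \<in> l2" and v: "v \<in> l2"
  shows "l2sq (\<lambda>k. a k - c * v k) = l2sq a - 2 * Re (cnj c * l2ip a v) + (cmod c)\<^sup>2 * l2sq v"
proof -
  let ?d = "\<lambda>k. a k - c * v k"
  have d: "?d \<in> l2" by (rule l2_diff_scale[OF a v])
  have "complex_of_real (l2sq ?d) = l2ip ?d ?d" by (simp add: l2ip_self d)
  also have "\<dots> = l2ip a ?d - c * l2ip v ?d" by (rule l2ip_diff_scale[OF a v d])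
  also have "l2ip a ?d = cnj (l2ip a a - c * l2ip v a)"
    using l2ip_cnj[OF d a] l2ip_diff_scale[OF a v a] by simp
  also have "l2ip v ?d = cnj (l2ip a v - c * l2ip v v)"
    using l2ip_cnj[OF d v] l2ip_diff_scale[OF a v v] by simp
  also have "l2ip v a = cnj (l2ip a v)" by (rule l2ip_cnj[OF a v])
  finally have "Re (complex_of_real (l2sq ?d)) = Re (cnj (l2ip a a - c * cnj (l2ip a v)) - c * cnj (l2ip a v - c * l2ip v v))"
    by simp
  also have "\<dots> = l2sq a - 2 * Re (cnj c * l2ip a v) + (cmod c)\<^sup>2 * l2sq v"
    unfolding cmod_power2 by (simp add: l2ip_self a v algebra_simps power2_eq_square)
  finally show ?thesis by simp
qed

lemma l2ip_Cauchy_Schwarz: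
  assumes a: "a \<in> l2" and v: "v \<in> l2"
  shows "(cmod (l2ip a v))\<^sup>2 \<le> l2sq a * l2sq v"
proof (cases "l2sq v = 0")
  case True
  have "v k = 0" for k
  proof -
    have "\<forall>k. (cmod (v k))\<^sup>2 = 0"
      using True v suminf_eq_zero_iff[of "\<lambda>k. (cmod (v k))\<^sup>2"] unfolding l2sq_def l2_def by simp
    then show ?thesis by simp
  qed
  then have "v = (\<lambda>k. 0)" by auto
  then show ?thesis using l2sq_nonneg by (simp add: l2ip_def l2_zero)
next
  case False
  then have pos: "l2sq v > 0" using l2sq_nonneg[OF v] by simp
  let ?c = "l2ip a v / of_real (l2sq v)"
  have "0 \<le> l2sq (\<lambda>k. a k - ?c * v k)" by (intro l2sq_nonneg l2_diff_scale a v)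
  also have "\<dots> = l2sq a - 2 * Re (cnj ?c * l2ip a v) + (cmod ?c)\<^sup>2 * l2sq v"
    by (rule l2sq_diff_scale[OF a v])
  also have "cnj ?c * l2ip a v = of_real ((cmod (l2ip a v))\<^sup>2 / l2sq v)"
    by (simp add: complex_norm_square mult.commute del: of_real_power)
  also have "(cmod ?c)\<^sup>2 * l2sq v = (cmod (l2ip a v))\<^sup>2 / l2sq v"
    using pos by (simp add: norm_divide power_divide power2_eq_square)
  finally show ?thesis using pos by (simp add: field_simps)
qed

section \<open>Residuals after orthogonal projection and Bessel's inequality\<close>

text \<open>What remains of \<open>x\<close> after removing its components along the first
  \<open>n\<close> vectors. The coefficients are taken from \<open>x\<close> and not from the
  current residual, so that the removed part is visibly a sum of \<open>n\<close> terms; for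
  orthogonal systems both choices agree.\<close>

fun l2res :: "(nat \<Rightarrow> nat \<Rightarrow> complex) \<Rightarrow> (nat \<Rightarrow> complex) \<Rightarrow> nat \<Rightarrow> nat \<Rightarrow> complex" where
  "l2res v x 0 = x"
| "l2res v x (Suc n) = (\<lambda>k. l2res v x n k - l2ip x (v n) * v n k)"

definition l2ons :: "(nat \<Rightarrow> nat \<Rightarrow> complex) \<Rightarrow> bool" where
  "l2ons v \<longleftrightarrow> (\<forall>n. v n \<in> l2 \<and> l2sq (v n) \<in> {0, 1} \<and> (\<forall>i<n. l2ip (v n) (v i) = 0))"

text \<open>One joint induction, because the norm identity for the next residual uses the inner
  products of the present one. By Cauchy-Schwarz a zero vector of the system has inner product 0
  with \<open>x\<close>, so its step changes nothing and is consistent with the case of norm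
  one.\<close>

lemma l2res_props:
  assumes v: "l2ons v" and x: "x \<in> l2"
  shows "l2res v x n \<in> l2"
    and "\<And>j. n \<le> j \<Longrightarrow> l2ip (l2res v x n) (v j) = l2ip x (v j)"
    and "\<And>j. j < n \<Longrightarrow> l2ip (l2res v x n) (v j) = 0"
    and "l2sq (l2res v x n) = l2sq x - (\<Sum>i<n. (cmod (l2ip x (v i)))\<^sup>2)"
proof -
  have vl: "v i \<in> l2" for i using v by (simp add: l2ons_def)
  have orth: "l2ip (v i) (v j) = 0" if "i \<noteq> j" for i j
  proof (cases "j < i")
    case True then show ?thesis using v by (simp add: l2ons_def)
  next
    case False
    then have "l2ip (v j) (v i) = 0" using v that by (simp add: l2ons_def)
    then show ?thesis using l2ip_cnj[OF vl vl, of j i] by simp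
  qed
  have zero: "l2ip x (v i) = 0" if "l2sq (v i) = 0" for i
    using l2ip_Cauchy_Schwarz[OF x vl, of i] that by simp
  have "l2res v x n \<in> l2 \<and> (\<forall>j\<ge>n. l2ip (l2res v x n) (v j) = l2ip x (v j)) \<and>
     (\<forall>j<n. l2ip (l2res v x n) (v j) = 0) \<and>
     l2sq (l2res v x n) = l2sq x - (\<Sum>i<n. (cmod (l2ip x (v i)))\<^sup>2)"
  proof (induction n)
    case 0 then show ?case using x by simp
  next
    case (Suc n)
    let ?c = "l2ip x (v n)"
    have r: "l2res v x n \<in> l2" using Suc by simp
    have ip: "l2ip (l2res v x (Suc n)) (v j) = l2ip (l2res v x n) (v j) - ?c * l2ip (v n) (v j)" for j
      using l2ip_diff_scale[OF r vl vl, of _ n j] by simp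
    have 1: "l2ip (l2res v x (Suc n)) (v n) = 0"
    proof (cases "l2sq (v n) = 0")
      case True then show ?thesis using zero[OF True] Suc ip[of n] by simp
    next
      case False
      then have "l2sq (v n) = 1" using v by (auto simp: l2ons_def)
      then show ?thesis using Suc ip[of n] by (simp add: l2ip_self vl)
    qed
    have 2: "(cmod ?c)\<^sup>2 * l2sq (v n) = (cmod ?c)\<^sup>2"
      using zero[of n] v by (auto simp: l2ons_def)
    have 3: "Re (cnj ?c * ?c) = (cmod ?c)\<^sup>2"
      unfolding cmod_power2 by (simp add: power2_eq_square)
    have 4: "l2sq (l2res v x (Suc n)) = l2sq (l2res v x n) - (cmod ?c)\<^sup>2"
      using l2sq_diff_scale[OF r vl, of ?c n] Suc 2 3 by simp
    show ?case
      using l2_diff_scale[OF r vl] ip 1 4 Suc by (auto simp: orth less_Suc_eq)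
  qed
  then show "l2res v x n \<in> l2"
    and "\<And>j. n \<le> j \<Longrightarrow> l2ip (l2res v x n) (v j) = l2ip x (v j)"
    and "\<And>j. j < n \<Longrightarrow> l2ip (l2res v x n) (v j) = 0"
    and "l2sq (l2res v x n) = l2sq x - (\<Sum>i<n. (cmod (l2ip x (v i)))\<^sup>2)" by auto
qed

lemma l2_Bessel:
  assumes v: "l2ons v" and x: "x \<in> l2"
  shows "(\<Sum>i<n. (cmod (l2ip x (v i)))\<^sup>2) \<le> l2sq x"
  using l2res_props(1,4)[OF assms, of n] l2sq_nonneg[of "l2res v x n"] by linarith

section \<open>Matrices with finite Frobenius norm\<close>

text \<open>The first index is the output coordinate. Formulated by rows because
  \<open>mat_app\<close> pairs rows with the argument; the sum of the \<open>l2sq (M m)\<close> is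
  the squared Frobenius norm.\<close>

definition hs_matrix :: "(nat \<Rightarrow> nat \<Rightarrow> complex) \<Rightarrow> bool" where
  "hs_matrix M \<longleftrightarrow> (\<forall>m. M m \<in> l2) \<and> summable (\<lambda>m. l2sq (M m))"

definition mat_app :: "(nat \<Rightarrow> nat \<Rightarrow> complex) \<Rightarrow> (nat \<Rightarrow> complex) \<Rightarrow> nat \<Rightarrow> complex" where
  "mat_app M x m = (\<Sum>k. M m k * x k)"

lemma mat_app_eq_ip: "mat_app M x m = l2ip (M m) (\<lambda>k. cnj (x k))"
  by (simp add: mat_app_def l2ip_def)

lemma l2sq_cnj [simp]: "l2sq (\<lambda>k. cnj (x k)) = l2sq x"
  by (simp add: l2sq_def)

lemma mat_app_row_le:
  assumes "hs_matrix M" "x \<in> l2"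
  shows "(cmod (mat_app M x m))\<^sup>2 \<le> l2sq (M m) * l2sq x"
  using l2ip_Cauchy_Schwarz[of "M m" "\<lambda>k. cnj (x k)"] assms
  by (simp add: mat_app_eq_ip hs_matrix_def l2_cnj)

lemma mat_app_l2:
  assumes M: "hs_matrix M" and x: "x \<in> l2"
  shows "mat_app M x \<in> l2" and "l2sq (mat_app M x) \<le> (\<Sum>m. l2sq (M m)) * l2sq x"
proof -
  have s: "summable (\<lambda>m. l2sq (M m) * l2sq x)"
    using M by (auto simp: hs_matrix_def intro: summable_mult2)
  show 1: "mat_app M x \<in> l2"
    unfolding l2_def mem_Collect_eq
    by (rule summable_comparison_test'[OF s]) (use mat_app_row_le[OF assms] in auto)
  have "l2sq (mat_app M x) \<le> (\<Sum>m. l2sq (M m) * l2sq x)"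
    unfolding l2sq_def[of "mat_app M x"] using 1 s
    by (intro suminf_le mat_app_row_le assms) (auto simp: l2_def)
  then show "l2sq (mat_app M x) \<le> (\<Sum>m. l2sq (M m)) * l2sq x"
    using M by (simp add: hs_matrix_def suminf_mult2)
qed

lemma mat_app_diff_scale:
  assumes M: "hs_matrix M" and x: "x \<in> l2" and y: "y \<in> l2"
  shows "mat_app M (\<lambda>k. x k - c * y k) m = mat_app M x m - c * mat_app M y m"
proof -
  have Mm: "M m \<in> l2" using M by (simp add: hs_matrix_def)
  have "(\<lambda>k. M m k * x k - c * (M m k * y k)) sums (mat_app M x m - c * mat_app M y m)"
    unfolding mat_app_def
    by (intro sums_diff sums_mult summable_sums summable_norm_cancel[OF l2_summable_prod[OF Mm x]]
        summable_norm_cancel[OF l2_summable_prod[OF Mm y]])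
  then show ?thesis unfolding mat_app_def by (simp add: sums_iff algebra_simps)
qed

lemma mat_app_scale:
  assumes M: "hs_matrix M" and x: "x \<in> l2"
  shows "mat_app M (\<lambda>k. c * x k) m = c * mat_app M x m"
  using mat_app_diff_scale[OF M l2_zero(1) x, of "-c"] by (simp add: mat_app_def)

lemma mat_app_l2res:
  assumes M: "hs_matrix M" and v: "l2ons v" and x: "x \<in> l2"
  shows "mat_app M (l2res v x n) m = mat_app M x m - (\<Sum>i<n. l2ip x (v i) * mat_app M (v i) m)"
proof (induction n)
  case (Suc n)
  have "v n \<in> l2" using v by (simp add: l2ons_def)
  then show ?case using mat_app_diff_scale[OF M l2res_props(1)[OF v x]] Suc by simp
qed simp

text \<open>Replaces the singular value decomposition: each \<open>v n\<close> maximises, up to the factor \<open>4\<close>,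
  the quadratic form \<open>l2sq (mat_app M x)\<close> over the unit ball of the orthogonal complement of its
  predecessors.\<close>

lemma hs_matrix_greedy_system:
  assumes M: "hs_matrix M"
  obtains v where "l2ons v" "summable (\<lambda>n. l2sq (mat_app M (v n)))"
    "\<And>n x. x \<in> l2 \<Longrightarrow> l2sq x \<le> 1 \<Longrightarrow> (\<forall>i<n. l2ip x (v i) = 0) \<Longrightarrow>
       l2sq (mat_app M x) \<le> 4 * l2sq (mat_app M (v n))"
proof -
  let ?Q = "\<lambda>x. l2sq (mat_app M x)"
  let ?B = "\<Sum>m. l2sq (M m)"
  have B0: "0 \<le> ?B" using M by (auto simp: hs_matrix_def intro!: suminf_nonneg l2sq_nonneg)
  define P where "P f n r \<longleftrightarrow> r \<in> l2 \<and> l2sq r \<in> {0,1} \<and> (\<forall>i<n. l2ip r (f i) = 0) \<and>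
    (\<forall>x\<in>l2. l2sq x \<le> 1 \<longrightarrow> (\<forall>i<n. l2ip x (f i) = 0) \<longrightarrow> ?Q x \<le> 4 * ?Q r)"
    for f :: "nat \<Rightarrow> nat \<Rightarrow> complex" and n r
  have "\<exists>f. \<forall>n. P f n (f n)"
  \<comment> \<open>\<open>P f n\<close> inspects \<open>f\<close> only below \<open>n\<close>, so
    vector \<open>n\<close> may be chosen in terms of all its predecessors.\<close>
  proof (rule dependent_wellorder_choice)
    fix r and f g :: "nat \<Rightarrow> nat \<Rightarrow> complex" and n :: nat
    assume "\<And>y. y < n \<Longrightarrow> f y = g y"
    then show "P f n r = P g n r" unfolding P_def by auto
  next
    fix n :: nat and f :: "nat \<Rightarrow> nat \<Rightarrow> complex"
    assume prev: "\<And>y. y < n \<Longrightarrow> P f y (f y)"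
    have fl: "f i \<in> l2" if "i < n" for i using prev[OF that] by (simp add: P_def)
    define X where "X = {x \<in> l2. l2sq x \<le> 1 \<and> (\<forall>i<n. l2ip x (f i) = 0)}"
    define s where "s = Sup (?Q ` X)"
    have X0: "(\<lambda>k. 0) \<in> X" by (simp add: X_def l2_zero)
    have bdd: "bdd_above (?Q ` X)"
    proof (rule bdd_aboveI2)
      fix x assume "x \<in> X"
      then have "x \<in> l2" "l2sq x \<le> 1" by (auto simp: X_def)
      then have "?Q x \<le> ?B * l2sq x" using mat_app_l2(2)[OF M] by blast
      also have "\<dots> \<le> ?B * 1" by (intro mult_left_mono B0 \<open>l2sq x \<le> 1\<close>)
      finally show "?Q x \<le> ?B" by simp
    qed
    have le_s: "?Q x \<le> s" if "x \<in> X" for x unfolding s_def using that bdd by (intro cSup_upper) auto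
    show "\<exists>r. P f n r"
    proof (cases "s = 0")
      case True
      have "P f n (\<lambda>k. 0)" unfolding P_def
        using le_s True l2sq_nonneg[OF mat_app_l2(1)[OF M l2_zero(1)]]
        by (force simp: X_def l2_zero)
      then show ?thesis by blast
    next
      case False
      have "s \<ge> 0" using le_s[OF X0] l2sq_nonneg[OF mat_app_l2(1)[OF M l2_zero(1)]] by linarith
      \<comment> \<open>The supremum is not claimed to be attained. A near-maximiser in the unit
        ball suffices, and normalising it can only increase the quadratic form.\<close>
      then have "s / 4 < s" using False by simp
      then have "\<exists>y\<in>?Q ` X. s / 4 < y"
        unfolding s_def using X0 bdd by (subst less_cSup_iff[symmetric]) auto
      then obtain y where y: "y \<in> X" "s / 4 < ?Q y" by blast
      have yl: "y \<in> l2" "l2sq y \<le> 1" "\<forall>i<n. l2ip y (f i) = 0" using y by (auto simp: X_def)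
      have "l2sq y \<noteq> 0"
      proof
        assume "l2sq y = 0"
        then have "?Q y \<le> 0" using mat_app_l2(2)[OF M yl(1)] by simp
        then show False using y(2) \<open>s \<ge> 0\<close> by simp
      qed
      then have ypos: "l2sq y > 0" using l2sq_nonneg[OF yl(1)] by simp
      define c where "c = complex_of_real (1 / sqrt (l2sq y))"
      define r where "r = (\<lambda>k. c * y k)"
      have c2: "(cmod c)\<^sup>2 = 1 / l2sq y" using ypos by (simp add: c_def norm_divide power_divide)
      have rl: "r \<in> l2" "l2sq r = 1"
        using l2_scale[OF yl(1), of c] c2 ypos by (simp_all add: r_def)
      have "mat_app M r = (\<lambda>m. c * mat_app M y m)"
        unfolding r_def using mat_app_scale[OF M yl(1)] by auto
      then have "?Q r = ?Q y / l2sq y"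
        using l2_scale(2)[OF mat_app_l2(1)[OF M yl(1)], of c] c2 by simp
      also have "\<dots> \<ge> ?Q y / 1"
        using ypos yl(2) l2sq_nonneg[OF mat_app_l2(1)[OF M yl(1)]] by (intro divide_left_mono) auto
      finally have "?Q y \<le> ?Q r" by simp
      then have "s \<le> 4 * ?Q r" using y(2) by linarith
      moreover have "l2ip r (f i) = 0" if "i < n" for i
        unfolding r_def using l2ip_scale[OF yl(1) fl[OF that]] yl(3) that by simp
      ultimately have "P f n r" unfolding P_def using rl le_s by (force simp: X_def)
      then show ?thesis by blast
    qed
  qed
  then obtain v where v: "\<And>n. P v n (v n)" by blast
  have ons: "l2ons v" using v unfolding l2ons_def P_def by blast
  have vl: "v n \<in> l2" for n using v by (simp add: P_def)
  have Ql: "mat_app M (v n) \<in> l2" for n by (rule mat_app_l2(1)[OF M vl])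
  have "summable (\<lambda>n. ?Q (v n))"
  proof (rule summableI_nonneg_bounded)
    show "0 \<le> ?Q (v n)" for n by (rule l2sq_nonneg[OF Ql])
    fix N
    \<comment> \<open>With the summations exchanged, row \<open>m\<close> contributes the squared
      coefficients of its conjugate along the \<open>v n\<close>; Bessel bounds them by the squared
      norm of the row.\<close>
    have "(\<Sum>n<N. ?Q (v n)) = (\<Sum>m. \<Sum>n<N. (cmod (mat_app M (v n) m))\<^sup>2)"
      unfolding l2sq_def using Ql by (subst suminf_sum) (auto simp: l2_def)
    also have "\<dots> \<le> ?B"
    proof (rule suminf_le)
      fix m
      have Mm: "(\<lambda>k. cnj (M m k)) \<in> l2" using M by (intro l2_cnj) (simp add: hs_matrix_def)
      have "mat_app M (v n) m = cnj (l2ip (\<lambda>k. cnj (M m k)) (v n))" for n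
        using l2ip_cnj[OF Mm vl[of n]] by (simp add: mat_app_def l2ip_def mult.commute)
      then show "(\<Sum>n<N. (cmod (mat_app M (v n) m))\<^sup>2) \<le> l2sq (M m)"
        using l2_Bessel[OF ons Mm, of N] by simp
    next
      show "summable (\<lambda>m. \<Sum>n<N. (cmod (mat_app M (v n) m))\<^sup>2)"
        using Ql by (intro summable_sum) (auto simp: l2_def)
      show "summable (\<lambda>m. l2sq (M m))" using M by (simp add: hs_matrix_def)
    qed
    finally show "(\<Sum>n<N. ?Q (v n)) \<le> ?B" .
  qed
  then show ?thesis using that[OF ons] v unfolding P_def by blast
qed

section \<open>Taylor coefficients and boundary means\<close>

lemma taylor_coeff_sums:
  assumes "f holomorphic_on ball 0 1" "cmod z < 1"
  shows "(\<lambda>n. taylor_coeff f n * z ^ n) sums f z"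
  using holomorphic_power_series[OF assms(1), of z] assms(2) by (simp add: taylor_coeff_def)

text \<open>The device by which Taylor coefficients are identified throughout: it is enough to
  exhibit a convergent power series.\<close>

lemma taylor_coeff_unique:
  assumes s: "\<And>z. cmod z < 1 \<Longrightarrow> (\<lambda>n. a n * z ^ n) sums f z"
  shows "f holomorphic_on ball 0 1" and "taylor_coeff f = a"
proof -
  show "f holomorphic_on ball 0 1"
    by (rule power_series_holomorphic[where a = a]) (use s in auto)
  have "f has_fps_expansion Abs_fps a"
  proof (rule has_fps_expansionI)
    show "\<forall>\<^sub>F u in nhds 0. (\<lambda>n. fps_nth (Abs_fps a) n * u ^ n) sums f u"
      using s by (auto simp: eventually_nhds_metric intro!: exI[of _ 1])
  qed
  from fps_nth_fps_expansion[OF this] show "taylor_coeff f = a"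
    by (auto simp: taylor_coeff_def fun_eq_iff)
qed

lemma taylor_coeff_cong:
  assumes "\<And>z. cmod z < 1 \<Longrightarrow> f z = g z" "g holomorphic_on ball 0 1"
  shows "taylor_coeff f = taylor_coeff g"
  by (rule taylor_coeff_unique(2)) (use assms taylor_coeff_sums in auto)

lemma taylor_coeff_lincomb:
  assumes "f holomorphic_on ball 0 1" "g holomorphic_on ball 0 1"
  shows "taylor_coeff (\<lambda>z. a * f z + b * g z) = (\<lambda>n. a * taylor_coeff f n + b * taylor_coeff g n)"
proof (rule taylor_coeff_unique(2))
  fix z :: complex assume z: "cmod z < 1"
  have "(\<lambda>n. a * (taylor_coeff f n * z ^ n) + b * (taylor_coeff g n * z ^ n)) sums (a * f z + b * g z)"
    by (intro sums_add sums_mult taylor_coeff_sums assms z)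
  then show "(\<lambda>n. (a * taylor_coeff f n + b * taylor_coeff g n) * z ^ n) sums (a * f z + b * g z)"
    by (simp add: algebra_simps)
qed

lemma taylor_coeff_diff:
  assumes "f holomorphic_on ball 0 1" "g holomorphic_on ball 0 1"
  shows "taylor_coeff (\<lambda>z. f z - g z) = (\<lambda>n. taylor_coeff f n - taylor_coeff g n)"
  using taylor_coeff_lincomb[OF assms, of 1 "-1"] by simp

lemma H2_iff_l2: "f \<in> H2 \<longleftrightarrow> f holomorphic_on ball 0 1 \<and> taylor_coeff f \<in> l2"
  by (simp add: H2_def l2_def)

lemma h2norm_eq_l2sq: "h2norm f = sqrt (l2sq (taylor_coeff f))"
  by (simp add: h2norm_def l2sq_def)

lemma h2norm_nonneg: "f \<in> H2 \<Longrightarrow> 0 \<le> h2norm f"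
  by (simp add: h2norm_eq_l2sq H2_iff_l2 l2sq_nonneg)

lemma h2norm_sq: "f \<in> H2 \<Longrightarrow> (h2norm f)\<^sup>2 = l2sq (taylor_coeff f)"
  by (simp add: h2norm_eq_l2sq H2_iff_l2 l2sq_nonneg)

lemma l2_power_series:
  assumes a: "a \<in> l2"
  shows "(\<lambda>z. \<Sum>n. a n * z ^ n) \<in> H2" and "taylor_coeff (\<lambda>z. \<Sum>n. a n * z ^ n) = a"
proof -
  have "(\<lambda>n. a n * z ^ n) sums (\<Sum>n. a n * z ^ n)" if z: "cmod z < 1" for z
  proof -
    have "(cmod z)\<^sup>2 < 1" using z by (simp add: power_less_one_iff)
    then have "(\<lambda>n. z ^ n) \<in> l2"
      unfolding l2_def by (simp add: norm_power power_mult[symmetric] mult.commute[of _ 2])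
        (simp add: power_mult summable_geometric)
    then show ?thesis
      using l2_summable_prod[OF a] by (intro summable_sums) (rule summable_norm_cancel, auto)
  qed
  then have "(\<lambda>z. \<Sum>n. a n * z ^ n) holomorphic_on ball 0 1"
    and t: "taylor_coeff (\<lambda>z. \<Sum>n. a n * z ^ n) = a"
    using taylor_coeff_unique[of a "\<lambda>z. \<Sum>n. a n * z ^ n"] by auto
  then show "(\<lambda>z. \<Sum>n. a n * z ^ n) \<in> H2" "taylor_coeff (\<lambda>z. \<Sum>n. a n * z ^ n) = a"
    using a by (auto simp: H2_iff_l2)
qed

section \<open>The circle as a measure space, and Parseval's identity\<close>

text \<open>Total mass is \<open>2 * pi\<close>, so every mean carries a division by
  \<open>2 * pi\<close>. As a finite measure it makes bounded measurable functions
  integrable.\<close>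

definition circ :: "real measure" where
  "circ = restrict_space lborel {0..2*pi}"

lemma space_circ [simp]: "space circ = {0..2*pi}"
  by (simp add: circ_def space_restrict_space)

lemma finite_measure_circ: "finite_measure circ"
  by (rule finite_measureI) (simp add: circ_def emeasure_restrict_space space_restrict_space)

lemma measure_circ: "measure circ (space circ) = 2 * pi"
  by (simp add: circ_def measure_restrict_space space_restrict_space)

lemma AE_circ_iff: "(AE t in circ. P t) \<longleftrightarrow> (AE t in lborel. t \<in> {0..2*pi} \<longrightarrow> P t)"
  unfolding circ_def by (subst AE_restrict_space_iff) auto

lemma integrable_circ_iff:
  fixes f :: "real \<Rightarrow> 'a::{banach, second_countable_topology}"
  shows "integrable circ f \<longleftrightarrow> set_integrable lborel {0..2*pi} f"
  unfolding circ_def set_integrable_def by (subst integrable_restrict_space) auto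

lemma integral_circ_eq:
  fixes f :: "real \<Rightarrow> 'a::{banach, second_countable_topology}"
  shows "integral\<^sup>L circ f = (LINT t:{0..2*pi}|lborel. f t)"
  unfolding circ_def set_lebesgue_integral_def by (subst integral_restrict_space) auto

lemma circ_measurable: "f \<in> borel_measurable borel \<Longrightarrow> f \<in> borel_measurable circ"
  unfolding circ_def by (intro measurable_restrict_space1) simp

lemma circ_measurable_cont: "continuous_on UNIV f \<Longrightarrow> f \<in> borel_measurable circ"
  by (intro circ_measurable borel_measurable_continuous_onI)

lemma circ_integrable_bounded:
  fixes f :: "real \<Rightarrow> 'a::{banach, second_countable_topology}"
  assumes "f \<in> borel_measurable circ" "AE t in circ. norm (f t) \<le> B"
  shows "integrable circ f"
  using assms finite_measure.integrable_const_bound[OF finite_measure_circ] by blast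

lemma integral_circ_continuous:
  fixes f :: "real \<Rightarrow> 'a::euclidean_space"
  assumes "continuous_on {0..2*pi} f"
  shows "integral\<^sup>L circ f = integral {0..2*pi} f"
  unfolding integral_circ_eq
  by (rule set_borel_integral_eq_integral(2)) (rule borel_integrable_atLeastAtMost'[OF assms])

lemma has_integral_cis_int:
  fixes k :: int
  shows "((\<lambda>t. cis (of_int k * t)) has_integral (if k = 0 then 2 * pi else 0)) {0..2*pi}"
proof (cases "k = 0")
  case True
  then show ?thesis using has_integral_const_real[of "1::complex" 0 "2*pi"] by (simp add: scaleR_conv_of_real)
next
  case False
  have "((\<lambda>t. cis (of_int k * t)) has_integral
     (cis (of_int k * (2*pi)) / (\<i> * of_int k) - cis (of_int k * 0) / (\<i> * of_int k))) {0..2*pi}"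
  proof (rule fundamental_theorem_of_calculus)
    fix t :: real
    have 1: "((\<lambda>z. exp (\<i> * of_int k * z) / (\<i> * of_int k)) has_field_derivative
       exp (\<i> * of_int k * of_real t)) (at (of_real t))"
      using False by (auto intro!: derivative_eq_intros simp: field_simps)
    have "((\<lambda>t. exp (\<i> * of_int k * of_real t) / (\<i> * of_int k)) has_vector_derivative
       exp (\<i> * of_int k * of_real t)) (at t within {0..2*pi})"
      by (rule has_vector_derivative_real_field[OF 1])
    then show "((\<lambda>t. cis (of_int k * t) / (\<i> * of_int k)) has_vector_derivative cis (of_int k * t)) (at t within {0..2*pi})"
      by (simp add: cis_conv_exp mult.assoc)
  qed simp
  moreover have "cis (of_int k * (2*pi)) = 1"
    using cis_multiple_2pi[of "of_int k"] by (simp add: mult.commute mult.left_commute)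
  ultimately show ?thesis using False by simp
qed

lemma integral_cis_int:
  "(LINT t|circ. cis (of_int k * t)) = (if k = 0 then 2 * pi else 0)"
  using integral_circ_continuous[of "\<lambda>t. cis (of_int k * t)"] has_integral_cis_int[of k]
  by (simp add: integral_unique continuous_intros)

lemma trig_poly_Parseval:
  fixes a :: "nat \<Rightarrow> complex"
  shows "(LINT t|circ. (cmod (\<Sum>n<N. a n * cis (real n * t)))\<^sup>2) = 2 * pi * (\<Sum>n<N. (cmod (a n))\<^sup>2)"
proof -
  have eq: "complex_of_real ((cmod (\<Sum>n<N. a n * cis (real n * t)))\<^sup>2) =
     (\<Sum>n<N. \<Sum>m<N. a n * cnj (a m) * cis (of_int (int n - int m) * t))" for t
    unfolding complex_norm_square
    by (simp add: sum_product cis_cnj) (intro sum.cong refl, simp add: cis_mult algebra_simps)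
  have int: "integrable circ (\<lambda>t. a n * cnj (a m) * cis (of_int (int n - int m) * t))" for n m
    by (rule circ_integrable_bounded[where B = "cmod (a n * cnj (a m))"])
       (auto intro!: circ_measurable_cont continuous_intros simp: norm_mult)
  have "complex_of_real (LINT t|circ. (cmod (\<Sum>n<N. a n * cis (real n * t)))\<^sup>2) =
     (LINT t|circ. complex_of_real ((cmod (\<Sum>n<N. a n * cis (real n * t)))\<^sup>2))"
    by (rule integral_complex_of_real[symmetric])
  also have "\<dots> = (\<Sum>n<N. \<Sum>m<N. (LINT t|circ. a n * cnj (a m) * cis (of_int (int n - int m) * t)))"
    unfolding eq using int by (subst Bochner_Integration.integral_sum, (auto)[1], subst Bochner_Integration.integral_sum, auto)
  also have "\<dots> = (\<Sum>n<N. \<Sum>m<N. a n * cnj (a m) * (if n = m then 2 * pi else 0))"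
    by (intro sum.cong refl) (simp add: integral_cis_int del: of_int_diff)
  also have "\<dots> = (\<Sum>n<N. 2 * pi * complex_of_real ((cmod (a n))\<^sup>2))"
    unfolding complex_norm_square by (intro sum.cong refl) (simp add: if_distrib sum.delta cong: if_cong)
  also have "\<dots> = complex_of_real (2 * pi * (\<Sum>n<N. (cmod (a n))\<^sup>2))"
    by (simp add: sum_distrib_left)
  finally show ?thesis unfolding of_real_eq_iff .
qed

lemma circle_continuous:
  assumes "f holomorphic_on ball 0 1" "0 \<le> r" "r < 1"
  shows "continuous_on UNIV (\<lambda>t. f (complex_of_real r * cis t))"
  by (rule continuous_on_compose2[OF holomorphic_on_imp_continuous_on[OF assms(1)]])
     (use assms in \<open>auto intro!: continuous_intros simp: norm_mult\<close>)

text \<open>Inside the disc the Taylor series converges absolutely, so its partial sums are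
  trigonometric polynomials bounded by one constant. Their Parseval identity passes to the limit by
  dominated convergence.\<close>

lemma circle_Parseval:
  assumes f: "f holomorphic_on ball 0 1" and r: "0 \<le> r" "r < 1"
  shows "(\<lambda>n. (cmod (taylor_coeff f n))\<^sup>2 * (r\<^sup>2) ^ n) sums
    ((LINT t|circ. (cmod (f (complex_of_real r * cis t)))\<^sup>2) / (2 * pi))"
proof -
  define a where "a n = taylor_coeff f n * of_real r ^ n" for n
  define S where "S N t = (\<Sum>n<N. a n * cis (real n * t))" for N t
  have trm: "taylor_coeff f n * (of_real r * cis t) ^ n = a n * cis (real n * t)" for n t
    by (simp add: a_def power_mult_distrib Complex.DeMoivre)
  have lim: "(\<lambda>N. S N t) \<longlonglongrightarrow> f (of_real r * cis t)" for t
    using taylor_coeff_sums[OF f, of "of_real r * cis t"] r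
    unfolding sums_def trm S_def by (simp add: norm_mult)
  have "summable (\<lambda>n. norm (taylor_coeff f n * of_real r ^ n))"
    \<comment> \<open>The midpoint of \<open>r\<close> and 1 is a point of convergence strictly
      outside the circle of radius \<open>r\<close>.\<close>
    by (rule powser_insidea[OF sums_summable[OF taylor_coeff_sums[OF f]], of "of_real ((1 + r) / 2)"])
       (use r in \<open>auto simp del: of_real_add of_real_divide simp: norm_of_real\<close>)
  then have sa: "summable (\<lambda>n. norm (a n))" by (simp add: a_def)
  define K where "K = (\<Sum>n. norm (a n))"
  have bound: "cmod (S N t) \<le> K" for N t
  proof -
    have "cmod (S N t) \<le> (\<Sum>n<N. norm (a n))"
      unfolding S_def by (rule order_trans[OF norm_sum]) (simp add: norm_mult)
    also have "\<dots> \<le> K" unfolding K_def by (intro sum_le_suminf sa) auto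
    finally show ?thesis .
  qed
  have "(\<lambda>N. LINT t|circ. (cmod (S N t))\<^sup>2) \<longlonglongrightarrow> (LINT t|circ. (cmod (f (of_real r * cis t)))\<^sup>2)"
  proof (rule integral_dominated_convergence[where w = "\<lambda>_. K\<^sup>2"])
    show "(\<lambda>t. (cmod (f (of_real r * cis t)))\<^sup>2) \<in> borel_measurable circ"
      by (intro circ_measurable_cont continuous_intros circle_continuous f r)
    show "(\<lambda>t. (cmod (S N t))\<^sup>2) \<in> borel_measurable circ" for N
      unfolding S_def by (intro circ_measurable_cont continuous_intros)
    show "integrable circ (\<lambda>_. K\<^sup>2)" by (rule circ_integrable_bounded[where B = "K\<^sup>2"]) auto
    show "AE t in circ. (\<lambda>N. (cmod (S N t))\<^sup>2) \<longlonglongrightarrow> (cmod (f (of_real r * cis t)))\<^sup>2"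
      by (intro AE_I2 tendsto_intros lim)
    show "AE t in circ. norm ((cmod (S N t))\<^sup>2) \<le> K\<^sup>2" for N
      by (intro AE_I2) (simp add: power_mono bound)
  qed
  moreover have "(LINT t|circ. (cmod (S N t))\<^sup>2) = 2 * pi * (\<Sum>n<N. (cmod (a n))\<^sup>2)" for N
    unfolding S_def by (rule trig_poly_Parseval)
  ultimately have "(\<lambda>N. (2 * pi * (\<Sum>n<N. (cmod (a n))\<^sup>2)) / (2 * pi)) \<longlonglongrightarrow>
      (LINT t|circ. (cmod (f (of_real r * cis t)))\<^sup>2) / (2 * pi)"
    by (intro tendsto_intros) auto
  moreover have "(cmod (a n))\<^sup>2 = (cmod (taylor_coeff f n))\<^sup>2 * (r\<^sup>2) ^ n" for n
    using r by (simp add: a_def norm_mult norm_power power_mult_distrib power_mult[symmetric] mult.commute)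
  ultimately show ?thesis by (simp add: sums_def)
qed

section \<open>Passage from interior circles to the boundary\<close>

text \<open>A fixed sequence of radii: dominated convergence and the measurability of limits are
  applied to sequences, not to the filter \<open>at_left 1\<close>.\<close>

definition rad :: "nat \<Rightarrow> real" where
  "rad k = 1 - 1 / (real k + 2)"

lemma rad_bounds: "0 \<le> rad k" "rad k < 1"
  by (auto simp: rad_def field_simps)

lemma rad_tendsto: "filterlim rad (at_left 1) sequentially"
proof -
  have "rad \<longlonglongrightarrow> 1"
  proof -
    have "(\<lambda>k. 1 - inverse (real (k + 2))) \<longlonglongrightarrow> 1 - 0"
      by (intro tendsto_diff tendsto_const LIMSEQ_ignore_initial_segment[OF lim_inverse_n])
    then show ?thesis unfolding rad_def[abs_def] by (simp add: inverse_eq_divide add.commute)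
  qed
  then show ?thesis
    by (auto simp: filterlim_at intro!: always_eventually rad_bounds) (use rad_bounds(2) in \<open>simp add: less_imp_neq\<close>)
qed

text \<open>A finite part of the Parseval sum is continuous in the radius, so its limit is bounded
  by \<open>L\<close> before the number of terms grows. The bounds may depend on \<open>k\<close>,
  since in the maximum principle for outer functions they only converge to the desired
  value.\<close>

lemma H2_of_bounded_means:
  assumes f: "f holomorphic_on ball 0 1"
    and le: "\<And>k. (LINT t|circ. (cmod (f (of_real (rad k) * cis t)))\<^sup>2) / (2 * pi) \<le> C k"
    and C: "C \<longlonglongrightarrow> L"
  shows "f \<in> H2" and "l2sq (taylor_coeff f) \<le> L"
proof -
  have part: "(\<Sum>n<N. (cmod (taylor_coeff f n))\<^sup>2) \<le> L" for N
  proof (rule LIMSEQ_le[OF _ C])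
    have r1: "rad \<longlonglongrightarrow> 1" using rad_tendsto by (simp add: filterlim_at)
    have "(\<lambda>k. \<Sum>n<N. (cmod (taylor_coeff f n))\<^sup>2 * ((rad k)\<^sup>2) ^ n) \<longlonglongrightarrow>
       (\<Sum>n<N. (cmod (taylor_coeff f n))\<^sup>2 * (1\<^sup>2) ^ n)"
      by (intro tendsto_intros r1)
    then show "(\<lambda>k. \<Sum>n<N. (cmod (taylor_coeff f n))\<^sup>2 * ((rad k)\<^sup>2) ^ n) \<longlonglongrightarrow>
       (\<Sum>n<N. (cmod (taylor_coeff f n))\<^sup>2)" by simp
    have "(\<Sum>n<N. (cmod (taylor_coeff f n))\<^sup>2 * ((rad k)\<^sup>2) ^ n) \<le> C k" for k
    proof -
      note S = circle_Parseval[OF f rad_bounds, of k]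
      have "(\<Sum>n<N. (cmod (taylor_coeff f n))\<^sup>2 * ((rad k)\<^sup>2) ^ n) \<le> (\<Sum>n. (cmod (taylor_coeff f n))\<^sup>2 * ((rad k)\<^sup>2) ^ n)"
        by (rule sum_le_suminf[OF sums_summable[OF S]]) auto
      then show ?thesis using le[of k] sums_unique[OF S] by linarith
    qed
    then show "\<exists>K. \<forall>k\<ge>K. (\<Sum>n<N. (cmod (taylor_coeff f n))\<^sup>2 * ((rad k)\<^sup>2) ^ n) \<le> C k" by blast
  qed
  have s: "summable (\<lambda>n. (cmod (taylor_coeff f n))\<^sup>2)"
    by (rule summableI_nonneg_bounded[OF _ part]) auto
  then show "f \<in> H2" using f by (simp add: H2_def)
  show "l2sq (taylor_coeff f) \<le> L"
    unfolding l2sq_def by (rule suminf_le_const[OF s part])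
qed

lemma H2_mean_le:
  assumes f: "f \<in> H2"
  shows "(LINT t|circ. (cmod (f (of_real (rad k) * cis t)))\<^sup>2) / (2 * pi) \<le> l2sq (taylor_coeff f)"
proof -
  have h: "f holomorphic_on ball 0 1" and s: "summable (\<lambda>n. (cmod (taylor_coeff f n))\<^sup>2)"
    using f by (auto simp: H2_def)
  have "(rad k)\<^sup>2 ^ n \<le> 1" for n
    using rad_bounds[of k] by (intro power_le_one) (auto simp: power_le_one)
  then show ?thesis
    using circle_Parseval[OF h rad_bounds, of k] s unfolding l2sq_def sums_iff
    by (elim conjE) (drule sym, auto intro!: suminf_le mult_right_le_one_le)
qed

text \<open>Dominated convergence identifies the limit of the means. It bounds the norm from above
  by the preceding lemmas, and from below because no interior mean exceeds the norm.\<close>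

lemma H2_bounded_boundary:
  assumes f: "f holomorphic_on ball 0 1" and B: "\<And>z. cmod z < 1 \<Longrightarrow> cmod (f z) \<le> B"
    and g: "g \<in> borel_measurable circ"
    and lim: "AE t in circ. (\<lambda>k. (cmod (f (of_real (rad k) * cis t)))\<^sup>2) \<longlonglongrightarrow> g t"
  shows "f \<in> H2" and "l2sq (taylor_coeff f) = (LINT t|circ. g t) / (2 * pi)"
proof -
  have *: "(\<lambda>k. (LINT t|circ. (cmod (f (of_real (rad k) * cis t)))\<^sup>2)) \<longlonglongrightarrow> (LINT t|circ. g t)"
  proof (rule integral_dominated_convergence[where w = "\<lambda>_. B\<^sup>2"])
    show "(\<lambda>t. (cmod (f (of_real (rad k) * cis t)))\<^sup>2) \<in> borel_measurable circ" for k
      by (intro circ_measurable_cont continuous_intros circle_continuous f rad_bounds)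
    show "integrable circ (\<lambda>_. B\<^sup>2)" by (rule circ_integrable_bounded[where B = "B\<^sup>2"]) auto
    show "AE t in circ. norm ((cmod (f (of_real (rad k) * cis t)))\<^sup>2) \<le> B\<^sup>2" for k
      using rad_bounds[of k] by (intro AE_I2) (auto intro!: power_mono B simp: norm_mult)
  qed (use g lim in auto)
  then have *: "(\<lambda>k. (LINT t|circ. (cmod (f (of_real (rad k) * cis t)))\<^sup>2) / (2 * pi)) \<longlonglongrightarrow> (LINT t|circ. g t) / (2 * pi)"
    by (intro tendsto_intros) auto
  note 1 = H2_of_bounded_means[OF f order_refl *]
  show "f \<in> H2" by (rule 1(1))
  have "(LINT t|circ. g t) / (2 * pi) \<le> l2sq (taylor_coeff f)"
    by (rule LIMSEQ_le_const2[OF *]) (use H2_mean_le[OF 1(1)] in blast)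
  then show "l2sq (taylor_coeff f) = (LINT t|circ. g t) / (2 * pi)" using 1(2) by simp
qed

text \<open>The matrix of the operator in the monomial basis: column \<open>n\<close> holds the
  coefficients of \<open>w * \<phi> ^ n\<close>. Expanding \<open>f\<close> is legitimate near 0,
  because \<phi> maps the closed disc of radius 1/2 into some \<open>cball 0 s\<close> with
  \<open>s < 1\<close>, where the series of \<open>f\<close> converges uniformly; uniform limits
  then commute with the derivatives at 0.\<close>

lemma taylor_coeff_weighted_composition:
  assumes w: "w holomorphic_on ball 0 1" and p: "\<phi> holomorphic_on ball 0 1" "\<phi> ` ball 0 1 \<subseteq> ball 0 1"
    and f: "f holomorphic_on ball 0 1"
  shows "(\<lambda>n. taylor_coeff (\<lambda>z. w z * \<phi> z ^ n) m * taylor_coeff f n) sums taylor_coeff (\<lambda>z. w z * f (\<phi> z)) m"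
proof -
  let ?A = "ball (0::complex) (1/2)"
  have sub: "?A \<subseteq> ball 0 1" and csub: "cball (0::complex) (1/2) \<subseteq> ball 0 1" by auto
  have "compact (\<phi> ` cball 0 (1/2))"
    by (intro compact_continuous_image holomorphic_on_imp_continuous_on holomorphic_on_subset[OF p(1) csub]) auto
  then have "compact (norm ` \<phi> ` cball 0 (1/2))" by (rule compact_continuous_image[rotated]) (intro continuous_intros)
  then obtain s where s: "s \<in> norm ` \<phi> ` cball 0 (1/2)" "\<forall>t\<in>norm ` \<phi> ` cball 0 (1/2). t \<le> s"
    using compact_attains_sup[of "norm ` \<phi> ` cball 0 (1/2)"] by auto
  have s1: "s < 1" using s(1) p(2) csub by fastforce
  have rng: "\<phi> \<in> ?A \<rightarrow> cball 0 s" using s(2) by auto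
  have bw: "bounded (w ` ?A)"
  proof (rule bounded_subset[of "w ` cball 0 (1/2)"])
    show "bounded (w ` cball 0 (1/2))"
      by (intro compact_imp_bounded compact_continuous_image holomorphic_on_imp_continuous_on holomorphic_on_subset[OF w csub]) auto
  qed auto
  have "conv_radius (taylor_coeff f) \<ge> 1"
  proof (rule conv_radius_geI_ex')
    fix r :: real assume "0 < r" "ereal r < 1"
    then show "summable (\<lambda>n. taylor_coeff f n * of_real r ^ n)"
      using taylor_coeff_sums[OF f, of "of_real r"] by (auto simp: sums_iff one_ereal_def)
  qed
  then have "ereal s < conv_radius (taylor_coeff f)" using s1 by (meson ereal_less(3) less_le_trans)
  from powser_uniform_limit[OF this, of 0]
  have "uniform_limit (cball 0 s) (\<lambda>n x. \<Sum>i<n. taylor_coeff f i * x ^ i) (\<lambda>x. \<Sum>i. taylor_coeff f i * x ^ i) sequentially"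
    by simp
  from uniform_limit_compose'[OF this rng]
  have "uniform_limit ?A (\<lambda>n x. \<Sum>i<n. taylor_coeff f i * \<phi> x ^ i) (\<lambda>x. \<Sum>i. taylor_coeff f i * \<phi> x ^ i) sequentially" .
  moreover have "(\<Sum>i. taylor_coeff f i * \<phi> x ^ i) = f (\<phi> x)" if "x \<in> ?A" for x
  proof -
    have "\<phi> x \<in> ball 0 1" using p(2) that sub by blast
    then show ?thesis using taylor_coeff_sums[OF f, of "\<phi> x"] by (simp add: sums_iff)
  qed
  ultimately have ul: "uniform_limit ?A (\<lambda>n x. \<Sum>i<n. taylor_coeff f i * \<phi> x ^ i) (\<lambda>x. f (\<phi> x)) sequentially"
    by (subst (asm) uniform_limit_cong') auto
  have bf: "bounded ((\<lambda>x. f (\<phi> x)) ` ?A)"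
  proof (rule bounded_subset[of "f ` cball 0 s"])
    show "bounded (f ` cball 0 s)"
      by (intro compact_imp_bounded compact_continuous_image holomorphic_on_imp_continuous_on holomorphic_on_subset[OF f]) (use s1 in auto)
  qed (use rng in auto)
  have ul2: "uniform_limit ?A (\<lambda>n x. w x * (\<Sum>i<n. taylor_coeff f i * \<phi> x ^ i)) (\<lambda>x. w x * f (\<phi> x)) sequentially"
    by (rule uniform_lim_mult[OF uniform_limit_const ul bw bf])
  have hol: "(\<lambda>x. w x * \<phi> x ^ i) holomorphic_on ball 0 1" for i
    by (intro holomorphic_intros w p)
  have ev: "\<forall>\<^sub>F n in sequentially. (\<lambda>x. w x * (\<Sum>i<n. taylor_coeff f i * \<phi> x ^ i)) holomorphic_on ?A"
    by (intro always_eventually allI holomorphic_intros holomorphic_on_subset[OF w sub] holomorphic_on_subset[OF p(1) sub])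
  have lim: "(\<lambda>n. (deriv ^^ m) (\<lambda>x. w x * (\<Sum>i<n. taylor_coeff f i * \<phi> x ^ i)) 0 / fact m) \<longlonglongrightarrow>
     (deriv ^^ m) (\<lambda>x. w x * f (\<phi> x)) 0 / fact m"
    by (intro tendsto_divide tendsto_const higher_deriv_complex_uniform_limit[OF ul2 ev]) auto
  have "taylor_coeff (\<lambda>x. w x * (\<Sum>i<n. taylor_coeff f i * \<phi> x ^ i)) =
      (\<lambda>m. \<Sum>i<n. taylor_coeff (\<lambda>z. w z * \<phi> z ^ i) m * taylor_coeff f i)" for n
  proof (induction n)
    case 0
    show ?case by (rule taylor_coeff_unique(2)) auto
  next
    case (Suc n)
    have "taylor_coeff (\<lambda>x. 1 * (w x * (\<Sum>i<n. taylor_coeff f i * \<phi> x ^ i)) + taylor_coeff f n * (w x * \<phi> x ^ n)) =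
       (\<lambda>m. 1 * taylor_coeff (\<lambda>x. w x * (\<Sum>i<n. taylor_coeff f i * \<phi> x ^ i)) m + taylor_coeff f n * taylor_coeff (\<lambda>x. w x * \<phi> x ^ n) m)"
      by (intro taylor_coeff_lincomb hol) (intro holomorphic_intros w p)
    then show ?case by (simp add: Suc algebra_simps)
  qed
  with lim show ?thesis unfolding sums_def taylor_coeff_def[of "\<lambda>z. w z * f (\<phi> z)"]
    by (simp add: taylor_coeff_def[of "\<lambda>x. w x * (\<Sum>i<_. _ i x)"] fun_eq_iff)
qed

section \<open>Operators on the Hardy space\<close>

lemma taylor_coeff_sum:
  assumes "\<And>i. i < n \<Longrightarrow> g i holomorphic_on ball 0 1"
  shows "(\<lambda>z. \<Sum>i<n. c i * g i z) holomorphic_on ball 0 1"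
    and "taylor_coeff (\<lambda>z. \<Sum>i<n. c i * g i z) = (\<lambda>m. \<Sum>i<n. c i * taylor_coeff (g i) m)"
proof -
  show hol: "(\<lambda>z. \<Sum>i<n. c i * g i z) holomorphic_on ball 0 1"
    using assms by (intro holomorphic_intros) auto
  show "taylor_coeff (\<lambda>z. \<Sum>i<n. c i * g i z) = (\<lambda>m. \<Sum>i<n. c i * taylor_coeff (g i) m)"
  proof (rule taylor_coeff_unique(2))
    fix z :: complex assume z: "cmod z < 1"
    have "(\<lambda>m. \<Sum>i<n. c i * (taylor_coeff (g i) m * z ^ m)) sums (\<Sum>i<n. c i * g i z)"
      using assms z by (intro sums_sum sums_mult taylor_coeff_sums) auto
    then show "(\<lambda>m. (\<Sum>i<n. c i * taylor_coeff (g i) m) * z ^ m) sums (\<Sum>i<n. c i * g i z)"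
      by (simp add: sum_distrib_right mult.assoc)
  qed
qed

lemma H2_poly:
  shows "(\<lambda>z. \<Sum>j<n. b j * z ^ j) \<in> H2"
    and "l2sq (taylor_coeff (\<lambda>z. \<Sum>j<n. b j * z ^ j)) = (\<Sum>j<n. (cmod (b j))\<^sup>2)"
proof -
  let ?a = "\<lambda>j. if j < n then b j else 0"
  have s: "(\<lambda>j. ?a j * z ^ j) sums (\<Sum>j<n. b j * z ^ j)" for z
  proof -
    have "(\<lambda>j. ?a j * z ^ j) sums (\<Sum>j<n. ?a j * z ^ j)" by (rule sums_finite) auto
    then show ?thesis by simp
  qed
  note t = taylor_coeff_unique[of ?a "\<lambda>z. \<Sum>j<n. b j * z ^ j", OF s]
  have "(\<lambda>j. (cmod (?a j))\<^sup>2) sums (\<Sum>j<n. (cmod (?a j))\<^sup>2)" by (rule sums_finite) auto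
  then have q: "(\<lambda>j. (cmod (?a j))\<^sup>2) sums (\<Sum>j<n. (cmod (b j))\<^sup>2)" by simp
  show "(\<lambda>z. \<Sum>j<n. b j * z ^ j) \<in> H2"
    using t q by (simp add: H2_def sums_iff)
  show "l2sq (taylor_coeff (\<lambda>z. \<Sum>j<n. b j * z ^ j)) = (\<Sum>j<n. (cmod (b j))\<^sup>2)"
    using t(2) q by (simp add: l2sq_def sums_iff)
qed

lemma H2_lincomb:
  assumes "f \<in> H2" "g \<in> H2"
  shows "(\<lambda>z. a * f z + b * g z) \<in> H2"
proof -
  have "(\<lambda>z. a * f z + b * g z) holomorphic_on ball 0 1"
    using assms by (intro holomorphic_intros) (auto simp: H2_def)
  then show ?thesis
    using assms by (simp add: H2_iff_l2 taylor_coeff_lincomb l2_add(1) l2_scale(1))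
qed

lemma H2_zero: "(\<lambda>z. 0) \<in> H2" "h2norm (\<lambda>z. 0) = 0"
  using H2_poly[of "\<lambda>_. 0" 0] by (auto simp: h2norm_eq_l2sq)

lemma H2_diff:
  assumes "f \<in> H2" "g \<in> H2"
  shows "(\<lambda>z. f z - g z) \<in> H2"
    and "(h2norm (\<lambda>z. f z - g z))\<^sup>2 \<le> 2 * (h2norm f)\<^sup>2 + 2 * (h2norm g)\<^sup>2"
proof -
  show d: "(\<lambda>z. f z - g z) \<in> H2" using H2_lincomb[OF assms, of 1 "-1"] by simp
  have l: "taylor_coeff f \<in> l2" "(\<lambda>k. - 1 * taylor_coeff g k) \<in> l2"
    using assms l2_scale(1)[of "taylor_coeff g" "-1"] by (auto simp: H2_iff_l2)
  have "taylor_coeff (\<lambda>z. f z - g z) = (\<lambda>k. taylor_coeff f k + - 1 * taylor_coeff g k)"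
    using assms by (simp add: taylor_coeff_diff H2_iff_l2)
  then show "(h2norm (\<lambda>z. f z - g z))\<^sup>2 \<le> 2 * (h2norm f)\<^sup>2 + 2 * (h2norm g)\<^sup>2"
    using l2_add(2)[OF l] l2_scale(2)[of "taylor_coeff g" "-1"] assms
    by (simp add: h2norm_sq d H2_iff_l2)
qed

lemma bounded_on_H2_diff:
  assumes T: "bounded_on_H2 T" and R: "bounded_on_H2 R"
  shows "bounded_on_H2 (\<lambda>f z. T f z - R f z)"
proof -
  obtain K where K: "\<And>f. f \<in> H2 \<Longrightarrow> h2norm (T f) \<le> K * h2norm f"
    using T by (auto simp: bounded_on_H2_def)
  obtain L where L: "\<And>f. f \<in> H2 \<Longrightarrow> h2norm (R f) \<le> L * h2norm f"
    using R by (auto simp: bounded_on_H2_def)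
  have TH: "T f \<in> H2" and RH: "R f \<in> H2" if "f \<in> H2" for f
    using T R that by (auto simp: bounded_on_H2_def)
  have "h2norm (\<lambda>z. T f z - R f z) \<le> sqrt (2 * K\<^sup>2 + 2 * L\<^sup>2) * h2norm f" if f: "f \<in> H2" for f
  proof -
    have "(h2norm (\<lambda>z. T f z - R f z))\<^sup>2 \<le> 2 * (h2norm (T f))\<^sup>2 + 2 * (h2norm (R f))\<^sup>2"
      by (rule H2_diff(2)[OF TH[OF f] RH[OF f]])
    also have "\<dots> \<le> 2 * (K * h2norm f)\<^sup>2 + 2 * (L * h2norm f)\<^sup>2"
      using K[OF f] L[OF f] h2norm_nonneg TH[OF f] RH[OF f]
      by (intro add_mono mult_left_mono power_mono) auto
    also have "\<dots> = (2 * K\<^sup>2 + 2 * L\<^sup>2) * (h2norm f)\<^sup>2"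
      by (simp add: power_mult_distrib algebra_simps)
    also have "\<dots> = (sqrt (2 * K\<^sup>2 + 2 * L\<^sup>2) * h2norm f)\<^sup>2"
      by (simp add: power_mult_distrib)
    finally show ?thesis
      by (rule power2_le_imp_le) (use h2norm_nonneg[OF f] in auto)
  qed
  moreover have "linear_on_H2 (\<lambda>f z. T f z - R f z)"
    using T R unfolding bounded_on_H2_def linear_on_H2_def by (simp add: algebra_simps)
  ultimately show ?thesis
    unfolding bounded_on_H2_def using H2_diff(1) TH RH by blast
qed

section \<open>Operator norms and approximation numbers\<close>

lemma opnorm_H2_upper:
  assumes T: "bounded_on_H2 T" and f: "f \<in> H2" "h2norm f \<le> 1"
  shows "h2norm (T f) \<le> opnorm_H2 T"
proof -
  obtain K where K: "\<And>f. f \<in> H2 \<Longrightarrow> h2norm (T f) \<le> K * h2norm f"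
    using T by (auto simp: bounded_on_H2_def)
  have "h2norm (T g) \<le> \<bar>K\<bar>" if "g \<in> H2" "h2norm g \<le> 1" for g
  proof -
    have "h2norm (T g) \<le> K * h2norm g" by (rule K[OF that(1)])
    also have "\<dots> \<le> \<bar>K\<bar> * 1" using that h2norm_nonneg by (intro mult_mono) auto
    finally show ?thesis by simp
  qed
  then have "bdd_above {h2norm (T f) | f. f \<in> H2 \<and> h2norm f \<le> 1}"
    by (intro bdd_aboveI[of _ "\<bar>K\<bar>"]) auto
  then show ?thesis unfolding opnorm_H2_def using f by (intro cSup_upper) auto
qed

lemma opnorm_H2_le:
  assumes "\<And>f. f \<in> H2 \<Longrightarrow> h2norm f \<le> 1 \<Longrightarrow> h2norm (T f) \<le> C"
  shows "opnorm_H2 T \<le> C"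
  unfolding opnorm_H2_def using assms H2_zero by (intro cSup_least) force+

lemma opnorm_H2_nonneg:
  assumes "bounded_on_H2 T"
  shows "0 \<le> opnorm_H2 T"
proof -
  have "0 \<le> h2norm (T (\<lambda>z. 0))"
    using assms H2_zero(1) by (intro h2norm_nonneg) (simp add: bounded_on_H2_def)
  also have "\<dots> \<le> opnorm_H2 T" by (rule opnorm_H2_upper[OF assms]) (use H2_zero in auto)
  finally show ?thesis .
qed

lemma sing_num_le:
  assumes T: "bounded_on_H2 T" and R: "bounded_on_H2 R" "rank_le_H2 R n"
  shows "sing_num T n \<le> opnorm_H2 (\<lambda>f z. T f z - R f z)"
  unfolding sing_num_def
proof (rule cInf_lower)
  show "bdd_below {opnorm_H2 (\<lambda>f z. T f z - R f z) |R. bounded_on_H2 R \<and> rank_le_H2 R n}"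
    using opnorm_H2_nonneg[OF bounded_on_H2_diff[OF T]] by (intro bdd_belowI[of _ 0]) auto
qed (use R in auto)

lemma sing_num_ge:
  assumes "\<And>R. bounded_on_H2 R \<Longrightarrow> rank_le_H2 R n \<Longrightarrow> C \<le> opnorm_H2 (\<lambda>f z. T f z - R f z)"
  shows "C \<le> sing_num T n"
  unfolding sing_num_def
proof (rule cInf_greatest)
  have "bounded_on_H2 (\<lambda>f z. 0)"
    unfolding bounded_on_H2_def linear_on_H2_def using H2_zero
    by (auto intro!: exI[of _ 0])
  moreover have "rank_le_H2 (\<lambda>f z. 0) n"
    unfolding rank_le_H2_def by (auto intro!: exI[of _ "\<lambda>_. 0"])
  ultimately show "{opnorm_H2 (\<lambda>f z. T f z - R f z) |R. bounded_on_H2 R \<and> rank_le_H2 R n} \<noteq> {}"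
    by blast
qed (use assms in blast)

lemma sing_num_nonneg: "bounded_on_H2 T \<Longrightarrow> 0 \<le> sing_num T n"
  by (intro sing_num_ge opnorm_H2_nonneg bounded_on_H2_diff)

lemma l2ip_lincomb:
  assumes "x \<in> l2" "y \<in> l2" "v \<in> l2"
  shows "l2ip (\<lambda>k. a * x k + b * y k) v = a * l2ip x v + b * l2ip y v"
  using l2ip_diff_scale[OF l2_scale(1)[OF assms(1)] assms(2,3), of a "-b"] l2ip_scale[OF assms(1,3), of a]
  by simp

text \<open>The map \<open>A\<close> in front of the matrix serves two uses: the identity for the
  operator itself, and a projection for its approximants of finite rank, which share the same
  matrix.\<close>

lemma hs_matrix_imp_bounded:
  assumes lin: "linear_on_H2 T" and M: "hs_matrix M"
    and hol: "\<And>f. f \<in> H2 \<Longrightarrow> T f holomorphic_on ball 0 1"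
    and tc: "\<And>f. f \<in> H2 \<Longrightarrow> taylor_coeff (T f) = mat_app M (A (taylor_coeff f))"
    and A: "\<And>x. x \<in> l2 \<Longrightarrow> A x \<in> l2" "\<And>x. x \<in> l2 \<Longrightarrow> l2sq (A x) \<le> K * l2sq x"
  shows "bounded_on_H2 T"
proof -
  define B where "B = (\<Sum>m. l2sq (M m))"
  have B0: "0 \<le> B" unfolding B_def using M by (auto simp: hs_matrix_def intro!: suminf_nonneg l2sq_nonneg)
  have H: "T f \<in> H2" if f: "f \<in> H2" for f
    using hol[OF f] tc[OF f] mat_app_l2(1)[OF M A(1)] f by (simp add: H2_iff_l2)
  moreover have "h2norm (T f) \<le> sqrt (B * K) * h2norm f" if f: "f \<in> H2" for f
  proof -
    have x: "taylor_coeff f \<in> l2" using f by (simp add: H2_iff_l2)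
    have "l2sq (taylor_coeff (T f)) \<le> B * l2sq (A (taylor_coeff f))"
      unfolding tc[OF f] B_def by (rule mat_app_l2(2)[OF M A(1)[OF x]])
    also have "\<dots> \<le> B * (K * l2sq (taylor_coeff f))" by (intro mult_left_mono A(2) x B0)
    finally have "l2sq (taylor_coeff (T f)) \<le> (B * K) * l2sq (taylor_coeff f)" by (simp add: mult.assoc)
    then show ?thesis unfolding h2norm_eq_l2sq real_sqrt_mult[symmetric] by (rule real_sqrt_le_mono)
  qed
  ultimately show ?thesis using lin unfolding bounded_on_H2_def by blast
qed

text \<open>The approximant of rank \<open>n\<close> is \<open>T\<close> after the projection onto
  the first \<open>n\<close> greedy vectors. The error is \<open>T\<close> applied to a residual
  orthogonal to them, so greediness bounds its norm by twice the norm of the image of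
  \<open>v n\<close>, and the squares of these images are summable.\<close>

lemma hs_matrix_imp_hilbert_schmidt:
  assumes lin: "linear_on_H2 T" and M: "hs_matrix M"
    and hol: "\<And>f. f \<in> H2 \<Longrightarrow> T f holomorphic_on ball 0 1"
    and tc: "\<And>f. f \<in> H2 \<Longrightarrow> taylor_coeff (T f) = mat_app M (taylor_coeff f)"
  shows "hilbert_schmidt T"
proof -
  have bT: "bounded_on_H2 T"
    by (rule hs_matrix_imp_bounded[OF lin M hol, where A = "\<lambda>x. x" and K = 1]) (auto simp: tc)
  obtain v where v: "l2ons v" "summable (\<lambda>n. l2sq (mat_app M (v n)))"
    and max: "\<And>n x. x \<in> l2 \<Longrightarrow> l2sq x \<le> 1 \<Longrightarrow> (\<forall>i<n. l2ip x (v i) = 0) \<Longrightarrow>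
       l2sq (mat_app M x) \<le> 4 * l2sq (mat_app M (v n))"
    by (rule hs_matrix_greedy_system[OF M]) blast
  have vl: "v i \<in> l2" for i using v(1) by (simp add: l2ons_def)
  define g where "g i = T (\<lambda>z. \<Sum>k. v i k * z ^ k)" for i
  have ghol: "g i holomorphic_on ball 0 1" and gtc: "taylor_coeff (g i) = mat_app M (v i)" for i
    using hol tc l2_power_series[OF vl, of i] by (auto simp: g_def)
  have main: "(sing_num T n)\<^sup>2 \<le> 4 * l2sq (mat_app M (v n))" for n
  proof -
    define R where "R f z = (\<Sum>i<n. l2ip (taylor_coeff f) (v i) * g i z)" for f z
    have Rhol: "R f holomorphic_on ball 0 1" for f
      unfolding R_def[abs_def] by (rule taylor_coeff_sum(1)[OF ghol])
    have Rtc: "taylor_coeff (R f) = (\<lambda>m. \<Sum>i<n. l2ip (taylor_coeff f) (v i) * mat_app M (v i) m)" for f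
      using taylor_coeff_sum(2)[where g = g and n = n and c = "\<lambda>i. l2ip (taylor_coeff f) (v i)", OF ghol]
      by (simp add: R_def[abs_def] gtc)
    have res: "mat_app M (l2res v (taylor_coeff f) n) = (\<lambda>m. taylor_coeff (T f) m - taylor_coeff (R f) m)"
      if "f \<in> H2" for f
      using mat_app_l2res[OF M v(1), of "taylor_coeff f" n] that tc[OF that] Rtc[of f]
      by (simp add: H2_iff_l2 fun_eq_iff)
    have "linear_on_H2 R"
      unfolding linear_on_H2_def
    proof (intro ballI allI)
      fix f h a b and z :: complex assume fh: "f \<in> H2" "h \<in> H2"
      have "l2ip (taylor_coeff (\<lambda>x. a * f x + b * h x)) (v i) =
        a * l2ip (taylor_coeff f) (v i) + b * l2ip (taylor_coeff h) (v i)" for i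
        using fh by (simp add: taylor_coeff_lincomb l2ip_lincomb H2_iff_l2 vl)
      then show "R (\<lambda>x. a * f x + b * h x) z = a * R f z + b * R h z"
        by (simp add: R_def algebra_simps sum.distrib sum_distrib_left)
    qed
    then have bR: "bounded_on_H2 R"
    \<comment> \<open>The projection is written as \<open>x\<close> minus its residual. Since the
      residual is no longer than \<open>x\<close>, the inequality for the square of a sum gives the
      constant 2 + 2 = 4.\<close>
    proof (rule hs_matrix_imp_bounded[OF _ M Rhol, where A = "\<lambda>x k. x k - 1 * l2res v x n k" and K = 4])
      fix f assume f: "f \<in> H2"
      have x: "taylor_coeff f \<in> l2" using f by (simp add: H2_iff_l2)
      show "taylor_coeff (R f) = mat_app M (\<lambda>k. taylor_coeff f k - 1 * l2res v (taylor_coeff f) n k)"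
        using mat_app_diff_scale[OF M x l2res_props(1)[OF v(1) x], of 1 n] res[OF f] tc[OF f]
        by (simp add: fun_eq_iff)
    next
      fix x assume x: "x \<in> l2"
      have r: "l2res v x n \<in> l2" "l2sq (l2res v x n) \<le> l2sq x"
        using l2res_props(1,4)[OF v(1) x, of n] by (auto simp: sum_nonneg)
      show "(\<lambda>k. x k - 1 * l2res v x n k) \<in> l2" by (rule l2_diff_scale[OF x r(1)])
      have "l2sq (\<lambda>k. x k + - 1 * l2res v x n k) \<le> 2 * l2sq x + 2 * l2sq (\<lambda>k. - 1 * l2res v x n k)"
        by (rule l2_add(2)[OF x l2_scale(1)[OF r(1)]])
      then show "l2sq (\<lambda>k. x k - 1 * l2res v x n k) \<le> 4 * l2sq x"
        using r l2_scale(2)[OF r(1), of "-1"] by simp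
    qed
    have "rank_le_H2 R n"
      unfolding rank_le_H2_def R_def
      by (rule exI[of _ g], intro ballI) (auto intro: exI[of _ "\<lambda>i. l2ip (taylor_coeff _) (v i)"])
    then have "sing_num T n \<le> opnorm_H2 (\<lambda>f z. T f z - R f z)"
      by (rule sing_num_le[OF bT bR])
    also have "\<dots> \<le> sqrt (4 * l2sq (mat_app M (v n)))"
    proof (rule opnorm_H2_le)
      fix f assume f: "f \<in> H2" "h2norm f \<le> 1"
      have x: "taylor_coeff f \<in> l2" using f by (simp add: H2_iff_l2)
      have x1: "l2sq (taylor_coeff f) \<le> 1" using f by (simp add: h2norm_eq_l2sq)
      have "l2sq (l2res v (taylor_coeff f) n) \<le> 1"
        using l2res_props(4)[OF v(1) x, of n] x1
          sum_nonneg[of "{..<n}" "\<lambda>i. (cmod (l2ip (taylor_coeff f) (v i)))\<^sup>2"] by simp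
      then have "l2sq (mat_app M (l2res v (taylor_coeff f) n)) \<le> 4 * l2sq (mat_app M (v n))"
        using l2res_props(1,3)[OF v(1) x] by (intro max) auto
      then show "h2norm (\<lambda>z. T f z - R f z) \<le> sqrt (4 * l2sq (mat_app M (v n)))"
        unfolding h2norm_eq_l2sq using res[OF f(1)] taylor_coeff_diff[OF hol[OF f(1)] Rhol]
        by (intro real_sqrt_le_mono) simp
    qed
    finally have "(sing_num T n)\<^sup>2 \<le> (sqrt (4 * l2sq (mat_app M (v n))))\<^sup>2"
      by (intro power_mono sing_num_nonneg bT)
    then show ?thesis using l2sq_nonneg[OF mat_app_l2(1)[OF M vl]] by simp
  qed
  have "summable (\<lambda>n. (sing_num T n)\<^sup>2)"
    by (rule summable_comparison_test'[OF summable_mult[OF v(2), of 4]]) (use main in simp)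
  then show ?thesis
    unfolding hilbert_schmidt_def Schatten_def using bT sing_num_nonneg[OF bT] by simp
qed

section \<open>Lower bounds for approximation numbers by counting dimensions\<close>

text \<open>Gaussian elimination: equation \<open>i0\<close> with pivot \<open>p\<close> is solved
  for the unknown \<open>p\<close> and substituted into the others, which leaves one equation and
  one unknown fewer.\<close>

lemma homogeneous_system_solution:
  fixes A :: "'j \<Rightarrow> 'i \<Rightarrow> 'a::field"
  assumes "finite I" "finite J" "card I < card J"
  shows "\<exists>b. (\<exists>j\<in>J. b j \<noteq> 0) \<and> (\<forall>i\<in>I. (\<Sum>j\<in>J. b j * A j i) = 0)"
  using assms
proof (induction I arbitrary: J A rule: finite_induct)
  case empty
  then have "J \<noteq> {}" by auto
  then show ?case by (intro exI[of _ "\<lambda>_. 1"]) auto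
next
  case (insert i0 I)
  show ?case
  proof (cases "\<forall>j\<in>J. A j i0 = 0")
    case True
    have "card I < card J" using insert by simp
    from insert.IH[OF insert.prems(1) this, of A] show ?thesis using True by auto
  next
    case False
    then obtain p where p: "p \<in> J" "A p i0 \<noteq> 0" by blast
    define J' where "J' = J - {p}"
    have J: "J = insert p J'" "p \<notin> J'" "finite J'" using p insert.prems by (auto simp: J'_def)
    have "card I < card J'" using insert J by simp
    from insert.IH[OF J(3) this, of "\<lambda>j i. A j i - A j i0 / A p i0 * A p i"]
    obtain b where b: "\<exists>j\<in>J'. b j \<noteq> 0"
      "\<forall>i\<in>I. (\<Sum>j\<in>J'. b j * (A j i - A j i0 / A p i0 * A p i)) = 0" by blast
    define b' where "b' = b(p := - (\<Sum>j\<in>J'. b j * A j i0) / A p i0)"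
    have sum': "(\<Sum>j\<in>J. b' j * A j i) = (\<Sum>j\<in>J'. b j * A j i) - (\<Sum>j\<in>J'. b j * A j i0) / A p i0 * A p i" for i
    proof -
      have "(\<Sum>j\<in>J'. b' j * A j i) = (\<Sum>j\<in>J'. b j * A j i)"
        using J(2) by (intro sum.cong refl) (auto simp: b'_def)
      then show ?thesis using J by (simp add: b'_def)
    qed
    have "(\<Sum>j\<in>J. b' j * A j i) = 0" if "i \<in> insert i0 I" for i
    proof (cases "i = i0")
      case True then show ?thesis using sum'[of i0] p by simp
    next
      case False
      then have "(\<Sum>j\<in>J'. b j * (A j i - A j i0 / A p i0 * A p i)) = 0" using b that by blast
      moreover have "(\<Sum>j\<in>J'. b j * (A j i - A j i0 / A p i0 * A p i)) =
          (\<Sum>j\<in>J'. b j * A j i) - (\<Sum>j\<in>J'. b j * A j i0) / A p i0 * A p i"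
        by (simp add: right_diff_distrib sum_subtractf sum_distrib_right sum_divide_distrib mult.assoc)
      ultimately show ?thesis using sum' by simp
    qed
    moreover have "\<exists>j\<in>J. b' j \<noteq> 0" using b(1) J by (auto simp: b'_def)
    ultimately show ?thesis by blast
  qed
qed

lemma H2_monomial: "(\<lambda>x. x ^ n) \<in> H2"
proof -
  have "(\<Sum>j<Suc n. (if j = n then 1 else 0) * x ^ j) = (x::complex) ^ n" for x
    by (simp add: if_distribR cong: if_cong)
  then show ?thesis using H2_poly(1)[of "\<lambda>j. if j = n then 1 else 0" "Suc n"] by simp
qed

lemma linear_on_H2_poly:
  assumes R: "linear_on_H2 R" and z: "cmod z < 1"
  shows "R (\<lambda>x. \<Sum>j<n. b j * x ^ j) z = (\<Sum>j<n. b j * R (\<lambda>x. x ^ j) z)"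
proof -
  have lin: "R (\<lambda>x. a * f x + b * g x) z = a * R f z + b * R g z" if "f \<in> H2" "g \<in> H2" for f g a b
    using R z that by (simp add: linear_on_H2_def)
  show ?thesis
  proof (induction n)
    case 0
    show ?case using lin[OF H2_zero(1) H2_zero(1), of 0 0] by simp
  next
    case (Suc n)
    show ?case using lin[OF H2_poly(1)[of b n] H2_monomial[of n], of 1 "b n"] by (simp add: Suc)
  qed
qed

text \<open>The \<open>n + 1\<close> monomials up to degree \<open>n\<close> have images in the span
  of \<open>n\<close> functions, so some nonzero polynomial of degree at most \<open>n\<close> is
  annihilated by \<open>R\<close>. On it \<open>T - R\<close> coincides with \<open>T\<close>, which
  is bounded below there. The spanning functions may be arbitrary; only their coefficient vectors
  enter.\<close>

lemma sing_num_lower_bound: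
  assumes T: "bounded_on_H2 T" and c: "0 \<le> c"
    and ge: "\<And>b. c * (\<Sum>j<Suc n. (cmod (b j))\<^sup>2) \<le> (h2norm (T (\<lambda>z. \<Sum>j<Suc n. b j * z ^ j)))\<^sup>2"
  shows "sqrt c \<le> sing_num T n"
proof (rule sing_num_ge)
  fix R assume R: "bounded_on_H2 R" "rank_le_H2 R n"
  then obtain g where g: "\<forall>f\<in>H2. \<exists>c. \<forall>z\<in>ball 0 1. R f z = (\<Sum>i<n. c i * g i z)"
    unfolding rank_le_H2_def by blast
  have "\<forall>j. \<exists>c. \<forall>z\<in>ball 0 1. R (\<lambda>x. x ^ j) z = (\<Sum>i<n. c i * g i z)" using g H2_monomial by blast
  then obtain A where A: "\<And>j z. cmod z < 1 \<Longrightarrow> R (\<lambda>x. x ^ j) z = (\<Sum>i<n. A j i * g i z)"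
    unfolding mem_ball_0 Ball_def by (auto dest!: choice)
  obtain b0 where b0: "\<exists>j\<in>{..<Suc n}. b0 j \<noteq> 0" "\<forall>i\<in>{..<n}. (\<Sum>j<Suc n. b0 j * A j i) = 0"
    using homogeneous_system_solution[of "{..<n}" "{..<Suc n}" A] by auto
  define S where "S = (\<Sum>j<Suc n. (cmod (b0 j))\<^sup>2)"
  have Spos: "S > 0"
  proof -
    obtain j where "j < Suc n" "b0 j \<noteq> 0" using b0(1) by auto
    then show ?thesis unfolding S_def by (intro sum_pos2[of _ j]) auto
  qed
  define b where "b j = b0 j / of_real (sqrt S)" for j
  have bS: "(\<Sum>j<Suc n. (cmod (b j))\<^sup>2) = 1"
  proof -
    have "(cmod (b j))\<^sup>2 = (cmod (b0 j))\<^sup>2 / S" for j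
      using Spos by (simp add: b_def norm_divide power_divide)
    then have "(\<Sum>j<Suc n. (cmod (b j))\<^sup>2) = S / S"
      unfolding S_def by (simp only: sum_divide_distrib)
    then show ?thesis using Spos by simp
  qed
  define f where "f = (\<lambda>z. \<Sum>j<Suc n. b j * z ^ j)"
  have f: "f \<in> H2" "h2norm f \<le> 1"
    using H2_poly[of b "Suc n"] bS unfolding f_def h2norm_eq_l2sq by auto
  have "R f z = 0" if z: "cmod z < 1" for z
  proof -
    have "R f z = (\<Sum>j<Suc n. b j * R (\<lambda>x. x ^ j) z)"
      unfolding f_def using R(1) z by (intro linear_on_H2_poly) (auto simp: bounded_on_H2_def)
    also have "\<dots> = (\<Sum>j<Suc n. \<Sum>i<n. b j * A j i * g i z)"
      using A[OF z] by (simp add: sum_distrib_left mult.assoc)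
    also have "\<dots> = (\<Sum>i<n. \<Sum>j<Suc n. b j * A j i * g i z)" by (rule sum.swap)
    also have "\<dots> = (\<Sum>i<n. (\<Sum>j<Suc n. b0 j * A j i) / of_real (sqrt S) * g i z)"
      by (simp add: b_def sum_distrib_right sum_divide_distrib del: sum.lessThan_Suc)
    also have "\<dots> = 0" using b0(2) by (intro sum.neutral) auto
    finally show ?thesis .
  qed
  moreover have TfH: "T f \<in> H2" using T f(1) by (simp add: bounded_on_H2_def)
  ultimately have "taylor_coeff (\<lambda>z. T f z - R f z) = taylor_coeff (T f)"
    by (intro taylor_coeff_cong) (auto simp: H2_def)
  then have "h2norm (T f) = h2norm (\<lambda>z. T f z - R f z)" by (simp add: h2norm_eq_l2sq)
  also have "\<dots> \<le> opnorm_H2 (\<lambda>f z. T f z - R f z)"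
    using opnorm_H2_upper[OF bounded_on_H2_diff[OF T R(1)] f] .
  finally have 1: "h2norm (T f) \<le> opnorm_H2 (\<lambda>f z. T f z - R f z)" .
  have "c \<le> (h2norm (T f))\<^sup>2" using ge[of b] bS unfolding f_def by simp
  then have "sqrt c \<le> h2norm (T f)"
    using h2norm_nonneg[OF TfH] by (simp add: real_le_lsqrt)
  then show "sqrt c \<le> opnorm_H2 (\<lambda>f z. T f z - R f z)" using 1 by linarith
qed

section \<open>Outer functions\<close>

definition herglotz :: "(real \<Rightarrow> real) \<Rightarrow> complex \<Rightarrow> complex" where
  "herglotz u z = (1 / (2 * pi)) * (LINT t|circ. (cis t + z) / (cis t - z) * complex_of_real (u t))"

lemma outer_iff_herglotz:
  "outer w \<longleftrightarrow> (\<exists>c u. cmod c = 1 \<and> integrable circ u \<and> (\<forall>z\<in>ball 0 1. w z = c * exp (herglotz u z)))"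
  unfolding outer_def herglotz_def integrable_circ_iff integral_circ_eq by simp

lemma cis_minus_nonzero: "cmod z < 1 \<Longrightarrow> cis t - z \<noteq> 0"
  by auto

lemma herglotz_kernel_bound:
  assumes "cmod z < 1"
  shows "cmod ((cis t + z) / (cis t - z)) \<le> 2 / (1 - cmod z)"
proof -
  have "1 - cmod z \<le> cmod (cis t - z)" using norm_triangle_ineq2[of "cis t" z] by simp
  moreover have "cmod (cis t + z) \<le> 2" using norm_triangle_ineq[of "cis t" z] assms by simp
  ultimately show ?thesis using assms by (simp add: norm_divide frac_le)
qed

lemma herglotz_integrable:
  assumes u: "integrable circ u" and z: "cmod z < 1"
  shows "integrable circ (\<lambda>t. (cis t + z) / (cis t - z) * complex_of_real (u t))"
proof (rule Bochner_Integration.integrable_bound)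
  show "integrable circ (\<lambda>t. 2 / (1 - cmod z) * u t)" using u by simp
  have "(\<lambda>t. (cis t + z) / (cis t - z)) \<in> borel_measurable circ"
    using z by (intro circ_measurable_cont continuous_intros) (auto simp: cis_minus_nonzero)
  then show "(\<lambda>t. (cis t + z) / (cis t - z) * complex_of_real (u t)) \<in> borel_measurable circ"
    using u by (intro borel_measurable_times borel_measurable_of_real) auto
  show "AE t in circ. norm ((cis t + z) / (cis t - z) * complex_of_real (u t)) \<le> norm (2 / (1 - cmod z) * u t)"
  proof (rule AE_I2)
    fix t
    have "norm ((cis t + z) / (cis t - z) * complex_of_real (u t)) \<le> 2 / (1 - cmod z) * \<bar>u t\<bar>"
      unfolding norm_mult using herglotz_kernel_bound[OF z] z by (intro mult_mono) auto
    also have "\<dots> = norm (2 / (1 - cmod z) * u t)" using z by (simp add: abs_mult)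
    finally show "norm ((cis t + z) / (cis t - z) * complex_of_real (u t)) \<le> norm (2 / (1 - cmod z) * u t)" .
  qed
qed

text \<open>Comes from the expansion of the kernel as 1 plus twice the sum of the positive powers of
  \<open>z * cis (- t)\<close>; hence the exceptional factor for \<open>n = 0\<close>.\<close>

definition herglotz_coeff :: "(real \<Rightarrow> real) \<Rightarrow> nat \<Rightarrow> complex" where
  "herglotz_coeff u n = (if n = 0 then 1 else 2) / (2 * pi) * (LINT t|circ. cis (- real n * t) * complex_of_real (u t))"

text \<open>The kernel expansion is integrated term by term, dominated by a geometric series times
  the integral of \<open>\<bar>u\<bar>\<close>. Holomorphy of the Herglotz integral is then read off
  the power series.\<close>

lemma herglotz_sums:
  assumes u: "integrable circ u" and z: "cmod z < 1"
  shows "(\<lambda>n. herglotz_coeff u n * z ^ n) sums herglotz u z"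
proof -
  define f where "f n t = (if n = 0 then 1 else 2) * z ^ n * (cis (- real n * t) * complex_of_real (u t))" for n t
  have fn: "norm (f n t) \<le> 2 * cmod z ^ n * \<bar>u t\<bar>" for n t
    by (simp add: f_def norm_mult norm_power mult_right_mono)
  have cint: "integrable circ (\<lambda>t. cis (- real n * t) * complex_of_real (u t))" for n
    by (rule Bochner_Integration.integrable_bound[OF u])
       (use u in \<open>auto simp: norm_mult intro!: borel_measurable_times circ_measurable_cont[of "\<lambda>t. cis (- (real n * t))"] continuous_intros\<close>)
  have int: "integrable circ (f n)" for n unfolding f_def by (intro integrable_mult_right cint)
  have geo: "summable (\<lambda>n. 2 * cmod z ^ n * K)" for K
    using z by (intro summable_mult2 summable_mult summable_geometric) auto
  have sm: "summable (\<lambda>n. norm (f n t))" for t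
    by (rule summable_comparison_test'[OF geo[of "\<bar>u t\<bar>"]]) (use fn in auto)
  have "summable (\<lambda>n. LINT t|circ. norm (f n t))"
  proof (rule summable_comparison_test'[OF geo[of "LINT t|circ. \<bar>u t\<bar>"]])
    fix n :: nat
    have "(LINT t|circ. norm (f n t)) \<le> (LINT t|circ. 2 * cmod z ^ n * \<bar>u t\<bar>)"
      using int u fn by (intro integral_mono) auto
    then show "norm (LINT t|circ. norm (f n t)) \<le> 2 * cmod z ^ n * (LINT t|circ. \<bar>u t\<bar>)"
      by (simp add: integral_nonneg_AE)
  qed
  then have "(\<lambda>n. LINT t|circ. f n t) sums (LINT t|circ. (\<Sum>n. f n t))"
    using int sm by (intro sums_integral) auto
  moreover have "(\<Sum>n. f n t) = (cis t + z) / (cis t - z) * complex_of_real (u t)" for t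
  proof -
    define q where "q = z * cis (- t)"
    have q: "cmod q < 1" using z by (simp add: q_def norm_mult)
    have "(\<lambda>n. 2 * q ^ n - (if n = 0 then 1 else 0)) sums (2 * (1 / (1 - q)) - 1)"
      using sums_single[of 0 "\<lambda>_. 1::complex"] geometric_sums[OF q]
      by (intro sums_diff sums_mult) (auto simp: if_distrib cong: if_cong)
    moreover have "2 * (1 / (1 - q)) - 1 = (cis t + z) / (cis t - z)"
    proof -
      have "1 - q \<noteq> 0" using q by auto
      have "q * cis t = z" by (simp add: q_def cis_mult mult.assoc)
      then have e: "cis t + z = (1 + q) * cis t" "cis t - z = (1 - q) * cis t" by (auto simp: algebra_simps)
      show ?thesis unfolding e using \<open>1 - q \<noteq> 0\<close> by (simp add: field_simps)
    qed
    ultimately have "(\<lambda>n. (2 * q ^ n - (if n = 0 then 1 else 0)) * complex_of_real (u t)) sums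
       ((cis t + z) / (cis t - z) * complex_of_real (u t))" by (intro sums_mult2) simp
    moreover have "(2 * q ^ n - (if n = 0 then 1 else 0)) * complex_of_real (u t) = f n t" for n
      by (simp add: f_def q_def power_mult_distrib Complex.DeMoivre)
    ultimately show ?thesis by (simp add: sums_iff)
  qed
  ultimately have "(\<lambda>n. LINT t|circ. f n t) sums (LINT t|circ. (cis t + z) / (cis t - z) * complex_of_real (u t))"
    by simp
  then have "(\<lambda>n. (1 / (2 * pi)) * (LINT t|circ. f n t)) sums herglotz u z"
    unfolding herglotz_def by (rule sums_mult)
  moreover have "(1 / (2 * pi)) * (LINT t|circ. f n t) = herglotz_coeff u n * z ^ n" for n
    unfolding f_def herglotz_coeff_def by simp
  ultimately show ?thesis by simp
qed

lemma herglotz_holomorphic: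
  assumes "integrable circ u"
  shows "herglotz u holomorphic_on ball 0 1"
  by (rule taylor_coeff_unique(1)[OF herglotz_sums[OF assms]])

lemma herglotz_const:
  assumes z: "cmod z < 1"
  shows "herglotz (\<lambda>_. c) z = of_real c"
proof -
  have "herglotz_coeff (\<lambda>_. c) n = (if n = 0 then of_real c else 0)" for n
    using integral_cis_int[of "- int n"] by (simp add: herglotz_coeff_def)
  moreover have "(\<lambda>n. herglotz_coeff (\<lambda>_. c) n * z ^ n) sums herglotz (\<lambda>_. c) z"
    by (intro herglotz_sums z circ_integrable_bounded[where B = "\<bar>c\<bar>"]) auto
  moreover have "(\<lambda>n. (if n = 0 then of_real c else 0) * z ^ n) sums of_real c"
  proof -
    have "(\<lambda>n. (if n = 0 then of_real c else 0) * z ^ n) = (\<lambda>n. if n = 0 then of_real c else 0)" by auto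
    then show ?thesis using sums_single[of 0 "\<lambda>n. complex_of_real c"] by simp
  qed
  ultimately show ?thesis by (simp add: sums_iff)
qed

section \<open>Poisson integrals and truncation\<close>

lemma Re_herglotz:
  assumes u: "integrable circ u" and z: "cmod z < 1"
  shows "integrable circ (\<lambda>t. Re ((cis t + z) / (cis t - z)) * u t)"
    and "Re (herglotz u z) = (1 / (2 * pi)) * (LINT t|circ. Re ((cis t + z) / (cis t - z)) * u t)"
proof -
  note i = herglotz_integrable[OF u z]
  have eq: "Re ((cis t + z) / (cis t - z) * complex_of_real (u t)) = Re ((cis t + z) / (cis t - z)) * u t" for t
    by (simp only: times_complex.sel Re_complex_of_real Im_complex_of_real mult_zero_right diff_zero)
  show "integrable circ (\<lambda>t. Re ((cis t + z) / (cis t - z)) * u t)"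
    using integrable_Re[OF i] unfolding eq .
  have "Re (herglotz u z) = (1 / (2 * pi)) * Re (LINT t|circ. (cis t + z) / (cis t - z) * complex_of_real (u t))"
    unfolding herglotz_def by simp
  also have "Re (LINT t|circ. (cis t + z) / (cis t - z) * complex_of_real (u t)) =
      (LINT t|circ. Re ((cis t + z) / (cis t - z)) * u t)"
    unfolding integral_Re[OF i, symmetric] eq ..
  finally show "Re (herglotz u z) = (1 / (2 * pi)) * (LINT t|circ. Re ((cis t + z) / (cis t - z)) * u t)" .
qed

lemma Re_herglotz_kernel_nonneg:
  assumes z: "cmod z < 1"
  shows "0 \<le> Re ((cis t + z) / (cis t - z))"
proof -
  have "Re ((cis t + z) * cnj (cis t - z)) = (cmod (cis t))\<^sup>2 - (cmod z)\<^sup>2"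
    unfolding cmod_power2 by (simp add: algebra_simps power2_eq_square)
  also have "\<dots> \<ge> 0" using z by (simp add: power_le_one)
  finally show ?thesis by (simp only: Re_complex_div_ge_0)
qed

lemma Re_herglotz_mono:
  assumes "integrable circ u" "integrable circ v" "\<And>t. u t \<le> v t" and z: "cmod z < 1"
  shows "Re (herglotz u z) \<le> Re (herglotz v z)"
  unfolding Re_herglotz(2)[OF assms(1) z] Re_herglotz(2)[OF assms(2) z]
  by (intro mult_left_mono integral_mono Re_herglotz(1) assms Re_herglotz_kernel_nonneg) auto

lemma integrable_min_const:
  assumes "integrable circ u"
  shows "integrable circ (\<lambda>t. min (u t) (c::real))"
  by (intro integrable_min assms circ_integrable_bounded[where B = "\<bar>c\<bar>"]) auto

text \<open>Cutting from above at a nonnegative level never increases the absolute value, so the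
  full integrand dominates.\<close>

lemma Re_herglotz_truncation:
  assumes u: "integrable circ u" and z: "cmod z < 1"
  shows "(\<lambda>k. Re (herglotz (\<lambda>t. min (u t) (real k)) z)) \<longlonglongrightarrow> Re (herglotz u z)"
proof -
  let ?P = "\<lambda>t. Re ((cis t + z) / (cis t - z))"
  have "(\<lambda>k. LINT t|circ. ?P t * min (u t) (real k)) \<longlonglongrightarrow> (LINT t|circ. ?P t * u t)"
  proof (rule integral_dominated_convergence[where w = "\<lambda>t. \<bar>?P t * u t\<bar>"])
    show "(\<lambda>t. ?P t * u t) \<in> borel_measurable circ" using Re_herglotz(1)[OF u z] by auto
    show "(\<lambda>t. ?P t * min (u t) (real k)) \<in> borel_measurable circ" for k
      using Re_herglotz(1)[OF integrable_min_const[OF u] z] by auto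
    show "integrable circ (\<lambda>t. \<bar>?P t * u t\<bar>)" using Re_herglotz(1)[OF u z] by auto
    show "AE t in circ. norm (?P t * min (u t) (real k)) \<le> \<bar>?P t * u t\<bar>" for k
      by (intro AE_I2) (auto simp: abs_mult intro!: mult_left_mono)
    show "AE t in circ. (\<lambda>k. ?P t * min (u t) (real k)) \<longlonglongrightarrow> ?P t * u t"
    proof (rule AE_I2)
      fix t
      obtain N where N: "u t \<le> real N" using real_arch_simple by blast
      have "\<forall>\<^sub>F k in sequentially. ?P t * min (u t) (real k) = ?P t * u t"
        using eventually_ge_at_top[of N] by eventually_elim (use N in \<open>simp add: min_def\<close>)
      then show "(\<lambda>k. ?P t * min (u t) (real k)) \<longlonglongrightarrow> ?P t * u t"
        by (rule tendsto_eventually)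
    qed
  qed
  then show ?thesis
    unfolding Re_herglotz(2)[OF u z] Re_herglotz(2)[OF integrable_min_const[OF u] z]
    by (intro tendsto_intros)
qed

text \<open>A crude form of the evaluation bound. Its purpose is a bound depending only on the norm
  and the point, uniform over all powers of one function.\<close>

lemma holomorphic_pointwise_le_l2sq:
  assumes f: "f \<in> H2" and z: "cmod z < 1"
  shows "cmod (f z) \<le> l2sq (taylor_coeff f) + 1 / (1 - (cmod z)\<^sup>2)"
proof -
  have h: "f holomorphic_on ball 0 1" and s: "summable (\<lambda>n. (cmod (taylor_coeff f n))\<^sup>2)"
    using f by (auto simp: H2_def)
  have z2: "(cmod z)\<^sup>2 < 1" using z by (simp add: power_less_one_iff)
  have "cmod (taylor_coeff f n * z ^ n) \<le> (cmod (taylor_coeff f n))\<^sup>2 + ((cmod z)\<^sup>2) ^ n" for n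
  proof -
    let ?a = "cmod (taylor_coeff f n)" and ?b = "cmod z ^ n"
    have "2 * (?a * ?b) \<le> ?a\<^sup>2 + ?b\<^sup>2" using sum_squares_bound[of ?a ?b] by (simp add: mult.assoc)
    moreover have "0 \<le> ?a * ?b" by simp
    moreover have "?b\<^sup>2 = ((cmod z)\<^sup>2) ^ n" by (simp add: power_mult[symmetric] mult.commute)
    ultimately have "?a * ?b \<le> ?a\<^sup>2 + ((cmod z)\<^sup>2) ^ n" by linarith
    then show ?thesis by (simp add: norm_mult norm_power)
  qed
  note le = this
  have sm: "(\<lambda>n. (cmod (taylor_coeff f n))\<^sup>2 + ((cmod z)\<^sup>2) ^ n) sums (l2sq (taylor_coeff f) + 1 / (1 - (cmod z)\<^sup>2))"
    unfolding l2sq_def using s z2 by (intro sums_add summable_sums geometric_sums) auto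
  have "norm (\<Sum>n. taylor_coeff f n * z ^ n) \<le> l2sq (taylor_coeff f) + 1 / (1 - (cmod z)\<^sup>2)"
    using norm_suminf_le[OF le sums_summable[OF sm]] sums_unique[OF sm] by simp
  then show ?thesis using taylor_coeff_sums[OF h z] by (simp add: sums_iff)
qed

text \<open>Maximum principle for outer functions. For the truncation \<open>min u M\<close> of the exponent the
  function is bounded, so its powers have \<open>H2\<close>-norm at most \<open>1\<close> and hence are bounded at each
  point independently of the power.\<close>

lemma outer_bounded_by_1:
  assumes w: "outer w"
    and lim: "AE t in circ. \<exists>l. cmod l \<le> 1 \<and> (\<lambda>k. w (of_real (rad k) * cis t)) \<longlonglongrightarrow> l"
    and z: "cmod z < 1"
  shows "cmod (w z) \<le> 1"
proof -
  obtain c u where c: "cmod c = 1" and u: "integrable circ u"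
    and weq: "\<And>z. cmod z < 1 \<Longrightarrow> w z = c * exp (herglotz u z)"
    using w unfolding outer_iff_herglotz by auto
  have wn: "cmod (w z) = exp (Re (herglotz u z))" if "cmod z < 1" for z
    using weq[OF that] c by (simp add: norm_mult)
  have rz: "cmod (of_real (rad k) * cis t) < 1" for k t using rad_bounds[of k] by (simp add: norm_mult)
  have trunc: "Re (herglotz (\<lambda>t. min (u t) (real M)) z) \<le> 0" for M
  proof -
    define v where "v t = min (u t) (real M)" for t
    have v: "integrable circ v" unfolding v_def by (rule integrable_min_const[OF u])
    define g where "g z = exp (herglotz v z)" for z
    have gn: "cmod (g z) = exp (Re (herglotz v z))" for z by (simp add: g_def)
    have g_le_w: "cmod (g z) \<le> cmod (w z)" if "cmod z < 1" for z
      unfolding gn wn[OF that] using Re_herglotz_mono[OF v u _ that] by (simp add: v_def)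
    have g_le_M: "cmod (g z) \<le> exp (real M)" if "cmod z < 1" for z
    proof -
      have "integrable circ (\<lambda>_. real M)" by (rule circ_integrable_bounded[where B = "real M"]) auto
      then have "Re (herglotz v z) \<le> Re (herglotz (\<lambda>_. real M) z)"
        by (intro Re_herglotz_mono v that) (auto simp: v_def)
      then show ?thesis unfolding gn using herglotz_const[OF that, of "real M"] by simp
    qed
    have ghol: "g holomorphic_on ball 0 1"
      unfolding g_def[abs_def] by (intro holomorphic_intros herglotz_holomorphic v)
    have pow: "cmod (g z) ^ n \<le> 1 + 1 / (1 - (cmod z)\<^sup>2)" for n
    proof -
      define F where "F z = g z ^ n" for z
      have Fhol: "F holomorphic_on ball 0 1" unfolding F_def[abs_def] by (intro holomorphic_intros ghol)
      \<comment> \<open>Radial limits of \<open>g\<close> are not known, only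
        \<open>cmod (g z) \<le> cmod (w z)\<close>. The maximum with 1 is squeezed between 1 and the
        corresponding maximum for \<open>w\<close>, which tends to 1; so \<open>G\<close> majorises
        the squared modulus of \<open>F\<close> and its means converge to 1.\<close>
      define G where "G k t = (max 1 (cmod (g (of_real (rad k) * cis t)))) ^ (2 * n)" for k t
      have Gm: "G k \<in> borel_measurable circ" for k
        unfolding G_def[abs_def] by (intro circ_measurable_cont continuous_intros circle_continuous ghol rad_bounds)
      have Gb: "norm (G k t) \<le> exp (real M) ^ (2 * n)" for k t
        unfolding G_def using g_le_M[OF rz] by (auto intro!: power_mono)
      have "(\<lambda>k. LINT t|circ. G k t) \<longlonglongrightarrow> (LINT t|circ. 1)"
      proof (rule integral_dominated_convergence[where w = "\<lambda>_. exp (real M) ^ (2 * n)"])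
        show "integrable circ (\<lambda>_. exp (real M) ^ (2 * n))"
          by (rule circ_integrable_bounded[where B = "exp (real M) ^ (2 * n)"]) auto
        show "AE t in circ. (\<lambda>k. G k t) \<longlonglongrightarrow> 1"
          using lim
        proof eventually_elim
          case (elim t)
          then obtain l where l: "cmod l \<le> 1" "(\<lambda>k. w (of_real (rad k) * cis t)) \<longlonglongrightarrow> l" by blast
          have "(\<lambda>k. max 1 (cmod (g (of_real (rad k) * cis t)))) \<longlonglongrightarrow> 1"
          proof (rule tendsto_sandwich[OF _ _ tendsto_const])
            show "(\<lambda>k. max 1 (cmod (w (of_real (rad k) * cis t)))) \<longlonglongrightarrow> 1"
              using tendsto_max[OF tendsto_const[of 1] tendsto_norm[OF l(2)]] l(1) by (simp add: max_def split: if_splits)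
            show "\<forall>\<^sub>F k in sequentially. max 1 (cmod (g (of_real (rad k) * cis t))) \<le> max 1 (cmod (w (of_real (rad k) * cis t)))"
              using g_le_w[OF rz] by (intro always_eventually allI max.mono) auto
          qed auto
          from tendsto_power[OF this, of "2 * n"] show ?case unfolding G_def by simp
        qed
      qed (use Gm Gb in auto)
      then have "(\<lambda>k. (LINT t|circ. G k t) / (2 * pi)) \<longlonglongrightarrow> (LINT t|circ. 1) / (2 * pi)"
        by (intro tendsto_intros) auto
      then have GC: "(\<lambda>k. (LINT t|circ. G k t) / (2 * pi)) \<longlonglongrightarrow> 1" using measure_circ by simp
      have le: "(LINT t|circ. (cmod (F (of_real (rad k) * cis t)))\<^sup>2) / (2 * pi) \<le> (LINT t|circ. G k t) / (2 * pi)" for k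
      proof (intro divide_right_mono integral_mono)
        have FG: "(cmod (F (of_real (rad k) * cis t)))\<^sup>2 \<le> G k t" for t
        proof -
          have "(cmod (F (of_real (rad k) * cis t)))\<^sup>2 = cmod (g (of_real (rad k) * cis t)) ^ (2 * n)"
            by (simp add: F_def norm_power power_mult[symmetric] mult.commute)
          also have "\<dots> \<le> G k t" unfolding G_def by (intro power_mono) auto
          finally show ?thesis .
        qed
        show "(cmod (F (of_real (rad k) * cis t)))\<^sup>2 \<le> G k t" for t by (rule FG)
        show "integrable circ (G k)" by (rule circ_integrable_bounded[OF Gm]) (use Gb in blast)
        show "integrable circ (\<lambda>t. (cmod (F (of_real (rad k) * cis t)))\<^sup>2)"
        proof (rule circ_integrable_bounded[where B = "exp (real M) ^ (2 * n)"])
          show "(\<lambda>t. (cmod (F (of_real (rad k) * cis t)))\<^sup>2) \<in> borel_measurable circ"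
            by (intro circ_measurable_cont continuous_intros circle_continuous Fhol rad_bounds)
          show "AE t in circ. norm ((cmod (F (of_real (rad k) * cis t)))\<^sup>2) \<le> exp (real M) ^ (2 * n)"
          proof (rule AE_I2)
            fix t
            have "G k t \<le> exp (real M) ^ (2 * n)" using Gb[of k t] by (simp add: abs_le_iff)
            then show "norm ((cmod (F (of_real (rad k) * cis t)))\<^sup>2) \<le> exp (real M) ^ (2 * n)"
              using FG[of t] by simp
          qed
        qed
      qed auto
      note H = H2_of_bounded_means[OF Fhol le GC]
      show ?thesis using holomorphic_pointwise_le_l2sq[OF H(1) z] H(2) by (simp add: F_def norm_power)
    qed
    have "cmod (g z) \<le> 1"
    proof (rule ccontr)
      assume "\<not> cmod (g z) \<le> 1"
      then obtain n where "1 + 1 / (1 - (cmod z)\<^sup>2) < cmod (g z) ^ n"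
        using real_arch_pow[of "cmod (g z)"] by auto
      then show False using pow[of n] by simp
    qed
    then show ?thesis unfolding gn v_def[abs_def] by simp
  qed
  have "Re (herglotz u z) \<le> 0"
    by (rule LIMSEQ_le_const2[OF Re_herglotz_truncation[OF u z]]) (use trunc in blast)
  then show ?thesis using wn[OF z] by simp
qed

lemma outer_holomorphic:
  assumes "outer w"
  shows "w holomorphic_on ball 0 1"
proof -
  obtain c u where u: "integrable circ u"
    and weq: "\<And>z. z \<in> ball 0 1 \<Longrightarrow> w z = c * exp (herglotz u z)"
    using assms unfolding outer_iff_herglotz by auto
  have "(\<lambda>z. c * exp (herglotz u z)) holomorphic_on ball 0 1"
    by (intro holomorphic_intros herglotz_holomorphic u)
  then show ?thesis by (rule holomorphic_transform) (use weq in auto)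
qed

section \<open>The self-map\<close>

text \<open>Telescoping differences: the tail from \<open>m\<close> on, multiplied by the boundary
  jump \<open>pi\<close> of the argument, is exactly \<open>s * exp (- sqrt m)\<close>.\<close>

definition jump :: "real \<Rightarrow> nat \<Rightarrow> real" where
  "jump s j = s * (exp (- sqrt (real j)) - exp (- sqrt (real (Suc j)))) / pi"

text \<open>The logarithm is subtracted so that the series converges at \<open>\<zeta> = 1\<close> by summability of
  the jumps alone; it changes only the argument of the self-map by a constant.\<close>

definition phase_term :: "real \<Rightarrow> nat \<Rightarrow> complex \<Rightarrow> complex" where
  "phase_term s j \<zeta> = of_real (jump s j) *
     (of_real (pi / 2) + \<i> * (Ln (\<zeta> - \<i> * of_nat j) - of_real (ln (cmod (1 - \<i> * of_nat j)))))"

text \<open>The constant 20 is chosen against the jump sum, whose derivative along the axis is at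
  most 2 on the middle half of each segment: the speed of rotation is at least 18, and over length
  1/2 it yields an angle of 9, more than \<open>2 * pi\<close>.\<close>

definition phase :: "real \<Rightarrow> complex \<Rightarrow> complex" where
  "phase s \<zeta> = - 20 * \<zeta> - (\<Sum>j. phase_term s j \<zeta>)"

text \<open>The Moebius map carries the disc to the right half-plane and \<open>cis t\<close> to the
  point \<open>\<i> * cot (t / 2)\<close>, so \<open>cot (t / 2)\<close> is the boundary coordinate
  in all that follows.\<close>

definition spiral :: "real \<Rightarrow> complex \<Rightarrow> complex" where
  "spiral s z = exp (phase s ((1 + z) / (1 - z)))"

lemma jump_nonneg: "0 \<le> s \<Longrightarrow> 0 \<le> jump s j"
  by (simp add: jump_def)

lemma jump_tail_sums: "(\<lambda>i. jump s (i + m)) sums (s * exp (- sqrt (real m)) / pi)"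
proof -
  define e where "e i = s / pi * exp (- sqrt (real (i + m)))" for i
  have "filterlim (\<lambda>i. sqrt (real (i + m))) at_top sequentially"
    by (rule filterlim_compose[OF sqrt_at_top])
       (rule filterlim_compose[OF filterlim_real_sequentially filterlim_add_const_nat_at_top])
  then have "(\<lambda>i. exp (- sqrt (real (i + m)))) \<longlonglongrightarrow> 0"
    by (intro filterlim_compose[OF exp_at_bot]) (simp add: filterlim_uminus_at_bot)
  then have "e \<longlonglongrightarrow> s / pi * 0" unfolding e_def by (intro tendsto_intros)
  then have "(\<lambda>i. e i - e (Suc i)) sums (e 0 - s / pi * 0)" by (rule telescope_sums')
  then show ?thesis by (simp add: e_def jump_def algebra_simps diff_divide_distrib)
qed

lemma jump_sums: "jump s sums (s / pi)"
  using jump_tail_sums[of s 0] by simp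

lemma jump_summable: "summable (jump s)"
  using jump_sums by (rule sums_summable)

text \<open>Common to the half-plane and the boundary. A uniform distance \<open>\<delta>\<close>
  from the branch points bounds the differentiated terms by \<open>jump s j / \<delta>\<close>, so
  the Weierstrass test applies; convergence at one point \<open>p\<close> then propagates to all of
  \<open>S\<close>.\<close>

lemma phase_deriv_on:
  assumes s: "0 \<le> s" and S: "convex S" "open S" and \<delta>: "0 < \<delta>"
    and far: "\<And>\<zeta> j. \<zeta> \<in> S \<Longrightarrow> \<zeta> - \<i> * of_nat j \<notin> \<real>\<^sub>\<le>\<^sub>0 \<and> \<delta> \<le> cmod (\<zeta> - \<i> * of_nat j)"
    and p: "p \<in> S" "summable (\<lambda>j. phase_term s j p)" and \<zeta>: "\<zeta> \<in> S"
  shows "summable (\<lambda>j. phase_term s j \<zeta>)"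
    and "(phase s has_field_derivative (- 20 - (\<Sum>j. of_real (jump s j) * (\<i> / (\<zeta> - \<i> * of_nat j))))) (at \<zeta>)"
proof -
  let ?f' = "\<lambda>j \<zeta>. of_real (jump s j) * (\<i> / (\<zeta> - \<i> * of_nat j))"
  have d: "(phase_term s j has_field_derivative ?f' j \<zeta>) (at \<zeta> within S)" if "\<zeta> \<in> S" for j \<zeta>
  proof -
    have "((\<lambda>\<zeta>. Ln (\<zeta> - \<i> * of_nat j)) has_field_derivative inverse (\<zeta> - \<i> * of_nat j)) (at \<zeta>)"
      using far[OF that, of j] by (auto intro!: derivative_eq_intros)
    then have "(phase_term s j has_field_derivative
        of_real (jump s j) * (0 + \<i> * (inverse (\<zeta> - \<i> * of_nat j) - 0))) (at \<zeta>)"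
      unfolding phase_term_def[abs_def]
      by (intro DERIV_cmult DERIV_add DERIV_diff DERIV_const)
    then show ?thesis by (simp add: divide_inverse has_field_derivative_at_within)
  qed
  have u: "uniformly_convergent_on S (\<lambda>n \<zeta>. \<Sum>j<n. ?f' j \<zeta>)"
  proof (rule Weierstrass_m_test')
    fix j \<zeta> assume "\<zeta> \<in> S"
    then have "\<delta> \<le> cmod (\<zeta> - \<i> * of_nat j)" using far by blast
    then show "norm (?f' j \<zeta>) \<le> jump s j * (1 / \<delta>)"
      using jump_nonneg[OF s, of j] \<delta> by (auto simp: norm_mult norm_divide intro!: mult_left_mono frac_le)
  next
    show "summable (\<lambda>j. jump s j * (1 / \<delta>))" by (intro summable_mult2 jump_summable)
  qed
  have i: "\<zeta> \<in> interior S" using S(2) \<zeta> by (simp add: interior_open)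
  note A = has_field_derivative_series'[OF S(1) d u p i]
  show "summable (\<lambda>j. phase_term s j \<zeta>)" by (rule A(1))
  show "(phase s has_field_derivative (- 20 - (\<Sum>j. ?f' j \<zeta>))) (at \<zeta>)"
    unfolding phase_def[abs_def] by (rule DERIV_diff[OF _ A(2)]) (auto intro!: derivative_eq_intros)
qed

lemma phase_halfplane:
  assumes s: "0 \<le> s" and \<zeta>: "0 < Re \<zeta>"
  shows "summable (\<lambda>j. phase_term s j \<zeta>)" and "phase s field_differentiable (at \<zeta>)"
proof -
  \<comment> \<open>Small enough that the half-plane contains both \<zeta> and the base point 1,
    where convergence is checked directly.\<close>
  define \<eta> where "\<eta> = min 1 (Re \<zeta>) / 2"
  let ?S = "{x. Re x > \<eta>}"
  have \<eta>: "0 < \<eta>" "\<eta> < 1" "\<eta> < Re \<zeta>" using \<zeta> by (auto simp: \<eta>_def min_def)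
  have far: "x - \<i> * of_nat j \<notin> \<real>\<^sub>\<le>\<^sub>0 \<and> \<eta> \<le> cmod (x - \<i> * of_nat j)" if "x \<in> ?S" for x and j :: nat
    using that \<eta> abs_Re_le_cmod[of "x - \<i> * of_nat j"] by (auto simp: complex_nonpos_Reals_iff)
  have "summable (\<lambda>j. phase_term s j 1)"
  proof (rule summable_comparison_test'[OF summable_mult2[OF jump_summable, of s pi]])
    fix j :: nat
    have "1 - \<i> * of_nat j \<noteq> 0" by (auto simp: complex_eq_iff)
    then have "Ln (1 - \<i> * of_nat j) - of_real (ln (cmod (1 - \<i> * of_nat j))) = \<i> * of_real (Im (Ln (1 - \<i> * of_nat j)))"
      by (simp add: complex_eq_iff)
    then have "phase_term s j 1 = of_real (jump s j * (pi / 2 - Im (Ln (1 - \<i> * of_nat j))))"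
      unfolding phase_term_def by (simp only: mult.assoc[symmetric]) (simp add: algebra_simps)
    then have "norm (phase_term s j 1) = jump s j * \<bar>pi / 2 - Im (Ln (1 - \<i> * of_nat j))\<bar>"
      using jump_nonneg[OF s, of j] by (simp add: abs_mult del: of_real_mult of_real_diff)
    moreover have "\<bar>Im (Ln (1 - \<i> * of_nat j))\<bar> < pi / 2"
      using \<open>1 - \<i> * of_nat j \<noteq> 0\<close> by (subst Re_Ln_pos_lt) auto
    ultimately show "norm (phase_term s j 1) \<le> jump s j * pi"
      using jump_nonneg[OF s, of j] by (auto intro!: mult_left_mono)
  qed
  note A = phase_deriv_on[OF s convex_halfspace_Re_gt open_halfspace_Re_gt \<eta>(1) far, where p = 1 and \<zeta> = \<zeta>]
  show "summable (\<lambda>j. phase_term s j \<zeta>)" using A(1) \<eta> \<open>summable (\<lambda>j. phase_term s j 1)\<close> by simp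
  show "phase s field_differentiable (at \<zeta>)"
    using A(2) \<eta> \<open>summable (\<lambda>j. phase_term s j 1)\<close> unfolding field_differentiable_def by auto
qed

lemma Re_phase_term:
  assumes "\<zeta> - \<i> * of_nat j \<noteq> 0"
  shows "Re (phase_term s j \<zeta>) = jump s j * (pi / 2 - Im (Ln (\<zeta> - \<i> * of_nat j)))"
  by (simp add: phase_term_def)

text \<open>Right of the imaginary axis every argument is below \<pi>/2, so the subtracted terms
  have nonnegative real part; strictness comes from the linear term.\<close>

lemma Re_phase_neg:
  assumes s: "0 \<le> s" and \<zeta>: "0 < Re \<zeta>"
  shows "Re (phase s \<zeta>) < 0"
proof -
  note sm = phase_halfplane(1)[OF s \<zeta>]
  have "0 \<le> Re (phase_term s j \<zeta>)" for j
  proof -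
    have nz: "\<zeta> - \<i> * of_nat j \<noteq> 0" using \<zeta> by (auto simp: complex_eq_iff)
    moreover have "\<bar>Im (Ln (\<zeta> - \<i> * of_nat j))\<bar> < pi / 2"
      using nz \<zeta> by (subst Re_Ln_pos_lt) auto
    ultimately show ?thesis using jump_nonneg[OF s] by (simp add: Re_phase_term)
  qed
  then have "0 \<le> (\<Sum>j. Re (phase_term s j \<zeta>))" by (intro suminf_nonneg summable_Re sm)
  also have "\<dots> = Re (\<Sum>j. phase_term s j \<zeta>)" using sm by (simp add: Re_suminf)
  finally show ?thesis using \<zeta> by (simp add: phase_def)
qed

lemma moebius_Re_pos:
  assumes "cmod z < 1"
  shows "0 < Re ((1 + z) / (1 - z))"
proof -
  have "(cmod z)\<^sup>2 < 1" using assms by (simp add: power_less_one_iff)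
  then have "0 < Re ((1 + z) * cnj (1 - z))"
    unfolding cmod_power2 by (simp add: algebra_simps power2_eq_square)
  then show ?thesis by (simp only: Re_complex_div_gt_0)
qed

lemma spiral_holomorphic:
  assumes s: "0 \<le> s"
  shows "spiral s holomorphic_on ball 0 1"
proof -
  have 1: "(\<lambda>z. (1 + z) / (1 - z)) holomorphic_on ball 0 1"
    by (intro holomorphic_intros) auto
  have "phase s holomorphic_on {\<zeta>. 0 < Re \<zeta>}"
    using phase_halfplane(2)[OF s] by (auto simp: holomorphic_on_def intro: field_differentiable_at_within)
  from holomorphic_on_compose_gen[OF 1 this]
  have "(phase s \<circ> (\<lambda>z. (1 + z) / (1 - z))) holomorphic_on ball 0 1"
    using moebius_Re_pos by (simp add: image_subset_iff)
  then show ?thesis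
    unfolding spiral_def[abs_def] o_def by (intro holomorphic_intros)
qed

lemma spiral_self_map:
  assumes s: "0 \<le> s"
  shows "spiral s ` ball 0 1 \<subseteq> ball 0 1"
  using Re_phase_neg[OF s moebius_Re_pos] by (auto simp: spiral_def)

section \<open>The exponent on the imaginary axis\<close>

text \<open>The cuts leave the branch points horizontally to the left, so a disc around a boundary
  point away from the branch points meets none of them and the exponent extends analytically across
  the axis. Convergence is imported from a point of the disc inside the half-plane. The derivative
  is real, which reflects that the modulus is locally constant along the axis.\<close>

lemma phase_boundary:
  assumes s: "0 \<le> s" and \<delta>: "0 < \<delta>" and far: "\<And>j::nat. 2 * \<delta> \<le> \<bar>y - real j\<bar>"
  shows "summable (\<lambda>j. phase_term s j (\<i> * of_real y))"
    and "(phase s has_field_derivative of_real (- 20 - (\<Sum>j. jump s j / (y - real j)))) (at (\<i> * of_real y))"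
    and "\<bar>\<Sum>j. jump s j / (y - real j)\<bar> \<le> s / pi / (2 * \<delta>)"
proof -
  let ?S = "ball (\<i> * of_real y) \<delta>"
  have far': "\<zeta> - \<i> * of_nat j \<notin> \<real>\<^sub>\<le>\<^sub>0 \<and> \<delta> \<le> cmod (\<zeta> - \<i> * of_nat j)" if "\<zeta> \<in> ?S" for \<zeta> and j :: nat
  proof -
    have "cmod (\<i> * of_real y - \<zeta>) < \<delta>" using that by (simp add: dist_norm)
    then have "\<bar>y - Im \<zeta>\<bar> < \<delta>" using abs_Im_le_cmod[of "\<i> * of_real y - \<zeta>"] by simp
    then have "\<delta> < \<bar>Im (\<zeta> - \<i> * of_nat j)\<bar>" using far[of j] by (simp add: abs_if split: if_splits)
    then show ?thesis using abs_Im_le_cmod[of "\<zeta> - \<i> * of_nat j"] \<delta> by (auto simp: complex_nonpos_Reals_iff)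
  qed
  have "\<i> * of_real y + of_real (\<delta> / 2) \<in> ?S" using \<delta> by (simp add: dist_norm)
  moreover have "summable (\<lambda>j. phase_term s j (\<i> * of_real y + of_real (\<delta> / 2)))"
    by (rule phase_halfplane(1)[OF s]) (use \<delta> in simp)
  ultimately have A: "summable (\<lambda>j. phase_term s j (\<i> * of_real y))"
    "(phase s has_field_derivative (- 20 - (\<Sum>j. of_real (jump s j) * (\<i> / (\<i> * of_real y - \<i> * of_nat j))))) (at (\<i> * of_real y))"
    using phase_deriv_on[OF s convex_ball open_ball \<delta> far', where p = "\<i> * of_real y + of_real (\<delta> / 2)" and \<zeta> = "\<i> * of_real y"] \<delta>
    by auto
  show "summable (\<lambda>j. phase_term s j (\<i> * of_real y))" by (rule A(1))
  have b: "norm (jump s j / (y - real j)) \<le> jump s j * (1 / (2 * \<delta>))" for j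
    using far[of j] \<delta> jump_nonneg[OF s, of j] by (auto simp: abs_mult abs_div intro!: mult_left_mono frac_le)
  have sm: "summable (\<lambda>j. jump s j / (y - real j))"
    by (rule summable_comparison_test'[OF summable_mult2[OF jump_summable, of s "1 / (2 * \<delta>)"]]) (use b in auto)
  have "(\<i> / (\<i> * of_real y - \<i> * of_nat j)) = of_real (1 / (y - real j))" for j
    by (simp add: right_diff_distrib[symmetric])
  then have "(\<Sum>j. of_real (jump s j) * (\<i> / (\<i> * of_real y - \<i> * of_nat j))) = (\<Sum>j. complex_of_real (jump s j / (y - real j)))"
    by (simp add: divide_inverse)
  also have "\<dots> = of_real (\<Sum>j. jump s j / (y - real j))" by (rule suminf_of_real[OF sm, symmetric])
  finally show "(phase s has_field_derivative of_real (- 20 - (\<Sum>j. jump s j / (y - real j)))) (at (\<i> * of_real y))"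
    using A(2) by simp
  have "norm (\<Sum>j. jump s j / (y - real j)) \<le> (\<Sum>j. jump s j * (1 / (2 * \<delta>)))"
    by (intro norm_suminf_le b summable_mult2 jump_summable)
  also have "\<dots> = s / pi / (2 * \<delta>)"
    using suminf_mult2[OF jump_summable, of s "1 / (2 * \<delta>)"] sums_unique[OF jump_sums, of s] by simp
  finally show "\<bar>\<Sum>j. jump s j / (y - real j)\<bar> \<le> s / pi / (2 * \<delta>)" by simp
qed

lemma Im_Ln_i_times:
  assumes "r \<noteq> 0"
  shows "Im (Ln (\<i> * of_real r)) = (if 0 < r then pi / 2 else - pi / 2)"
proof -
  have "Ln (\<i> * of_real r) = of_real (ln \<bar>r\<bar>) + \<i> * of_real (if 0 < r then pi / 2 else - pi / 2)"
    by (rule Ln_unique) (use assms pi_gt3 in \<open>auto simp: exp_add exp_of_real cis_conv_exp[symmetric] cis_pi_half cis_minus_pi_half\<close>)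
  then show ?thesis by simp
qed

lemma Re_phase_boundary:
  assumes s: "0 \<le> s" and \<delta>: "0 < \<delta>" and far: "\<And>j::nat. 2 * \<delta> \<le> \<bar>y - real j\<bar>"
  shows "Re (phase s (\<i> * of_real y)) = - s * exp (- sqrt (real (nat \<lceil>y\<rceil>)))"
proof -
  \<comment> \<open>The first index whose branch point lies above the point. For negative
    \<open>y\<close> the function \<open>nat\<close> gives 0, so the full series counts
    there.\<close>
  define m where "m = nat \<lceil>y\<rceil>"
  have sm: "summable (\<lambda>j. phase_term s j (\<i> * of_real y))"
    using phase_boundary(1)[OF s \<delta> far] .
  have ne: "y \<noteq> real j" for j using far[of j] \<delta> by auto
  have lt: "y < real j \<longleftrightarrow> m \<le> j" for j
    using ne[of j] unfolding m_def by (auto simp: nat_le_iff ceiling_le_iff less_le)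
  have R: "Re (phase_term s j (\<i> * of_real y)) = (if m \<le> j then pi * jump s j else 0)" for j
  proof -
    have eq: "\<i> * of_real y - \<i> * of_nat j = \<i> * of_real (y - real j)" by (simp add: algebra_simps)
    have nz: "\<i> * of_real y - \<i> * of_nat j \<noteq> 0" using ne[of j] by (simp add: complex_eq_iff)
    have "Im (Ln (\<i> * of_real y - \<i> * of_nat j)) = (if 0 < y - real j then pi / 2 else - pi / 2)"
      unfolding eq by (rule Im_Ln_i_times) (use ne[of j] in simp)
    then show ?thesis
      using lt[of j] ne[of j] by (simp only: Re_phase_term[OF nz]) auto
  qed
  have "(\<lambda>j. if m \<le> j then pi * jump s j else 0) sums (s * exp (- sqrt (real m)))"
  proof -
    have "(\<lambda>i. pi * jump s (i + m)) sums (pi * (s * exp (- sqrt (real m)) / pi))"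
      by (intro sums_mult jump_tail_sums)
    then have "(\<lambda>i. (\<lambda>j. if m \<le> j then pi * jump s j else 0) (i + m)) sums (s * exp (- sqrt (real m)))" by simp
    then show ?thesis by (subst (asm) sums_iff_shift) simp
  qed
  moreover have "(\<lambda>j. Re (phase_term s j (\<i> * of_real y))) sums Re (\<Sum>j. phase_term s j (\<i> * of_real y))"
    by (intro sums_Re summable_sums sm)
  ultimately have "Re (\<Sum>j. phase_term s j (\<i> * of_real y)) = s * exp (- sqrt (real m))"
    unfolding R by (metis sums_unique2)
  then show ?thesis by (simp add: phase_def m_def)
qed

lemma Im_phase_deriv:
  assumes s: "0 \<le> s" and \<delta>: "0 < \<delta>" and far: "\<And>j::nat. 2 * \<delta> \<le> \<bar>y - real j\<bar>"
  shows "((\<lambda>x. Im (phase s (\<i> * of_real x))) has_real_derivative (- 20 - (\<Sum>j. jump s j / (y - real j)))) (at y)"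
proof -
  let ?D = "- 20 - (\<Sum>j. jump s j / (y - real j))"
  have "((\<lambda>z. phase s (\<i> * z)) has_field_derivative of_real ?D * \<i>) (at (of_real y))"
    by (rule DERIV_chain2[where f = "phase s" and g = "\<lambda>z. \<i> * z", OF phase_boundary(2)[OF s \<delta> far]]) (auto intro!: derivative_eq_intros)
  then have "((\<lambda>x. phase s (\<i> * of_real x)) has_vector_derivative of_real ?D * \<i>) (at y)"
    by (rule has_vector_derivative_real_field)
  from bounded_linear.has_vector_derivative[OF bounded_linear_Im this]
  show ?thesis by (simp add: has_real_derivative_iff_has_vector_derivative)
qed

lemma nonint_far:
  assumes "y \<notin> \<int>"
  obtains \<delta> :: real where "0 < \<delta>" "\<And>j::nat. 2 * \<delta> \<le> \<bar>y - real j\<bar>"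
proof -
  define \<delta> where "\<delta> = min (frac y) (1 - frac y) / 2"
  have f: "0 < frac y" "frac y < 1" using assms by (auto simp: frac_gt_0_iff frac_lt_1)
  have "2 * \<delta> \<le> \<bar>y - real j\<bar>" for j
  proof (cases "int j \<le> \<lfloor>y\<rfloor>")
    case True
    then have "real j \<le> of_int \<lfloor>y\<rfloor>" by linarith
    then have "frac y \<le> y - real j" by (simp add: frac_def)
    then show ?thesis by (auto simp: \<delta>_def)
  next
    case False
    then have "of_int \<lfloor>y\<rfloor> + 1 \<le> real j" by linarith
    then have "1 - frac y \<le> real j - y" by (simp add: frac_def)
    then show ?thesis by (auto simp: \<delta>_def)
  qed
  moreover have "0 < \<delta>" using f by (auto simp: \<delta>_def)
  ultimately show ?thesis using that by blast
qed

section \<open>Regular boundary points and radial limits\<close>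

text \<open>The endpoints are the two parameters of the boundary point 1, which the Moebius map
  sends to infinity; the branch points sit at integer values of \<open>cot (t / 2)\<close>.\<close>

definition exceptional :: "real set" where
  "exceptional = {0, 2 * pi} \<union> {t \<in> {0<..<2*pi}. cot (t / 2) \<in> \<int>}"

lemma cot_inj: "inj_on (\<lambda>t::real. cot (t / 2)) {0<..<2*pi}"
proof (rule inj_onI)
  fix a b :: real assume ab: "a \<in> {0<..<2*pi}" "b \<in> {0<..<2*pi}" "cot (a / 2) = cot (b / 2)"
  have p: "sin (a / 2) > 0" "sin (b / 2) > 0" using ab by (auto intro!: sin_gt_zero)
  then have "sin (b / 2) * cos (a / 2) - cos (b / 2) * sin (a / 2) = 0"
    using ab(3) by (simp add: cot_def field_simps)
  then have "sin (b / 2 - a / 2) = 0" by (simp only: sin_diff)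
  then obtain n :: int where "b / 2 - a / 2 = of_int n * pi" by (auto simp: sin_zero_iff_int2)
  then have n: "b - a = of_int n * (2 * pi)" by simp
  then have "\<bar>of_int n * (2 * pi)\<bar> < 2 * pi" using ab by auto
  then have "\<bar>of_int n\<bar> < (1::real)" by (simp add: abs_mult)
  then have "n = 0" by linarith
  then show "a = b" using n by simp
qed

lemma countable_exceptional: "countable exceptional"
proof -
  let ?A = "{t \<in> {0<..<2*pi}. cot (t / 2) \<in> \<int>}"
  have "countable ((\<lambda>t. cot (t / 2)) ` ?A)"
    by (rule countable_subset[of _ "\<int>"]) (auto simp: Ints_def)
  then have "countable ?A"
    by (rule countable_image_inj_on) (rule inj_on_subset[OF cot_inj], auto)
  then show ?thesis by (simp add: exceptional_def)
qed

lemma AE_circ_regular: "AE t in circ. t \<in> {0<..<2*pi} \<and> cot (t / 2) \<notin> \<int>"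
proof -
  have "exceptional \<in> null_sets lborel" by (rule countable_imp_null_set_lborel[OF countable_exceptional])
  then have "AE t in lborel. t \<notin> exceptional" by (rule AE_not_in)
  then show ?thesis unfolding AE_circ_iff by eventually_elim (auto simp: exceptional_def)
qed

lemma moebius_cis:
  assumes "t \<in> {0<..<2*pi}"
  shows "(1 + cis t) / (1 - cis t) = \<i> * of_real (cot (t / 2))" and "cis t \<noteq> 1"
proof -
  have p: "sin (t / 2) > 0" using assms by (auto intro!: sin_gt_zero)
  define c where "c = cis (t / 2)"
  have c: "cis t = c * c" "c * cnj c = 1" by (auto simp: c_def cis_mult cis_cnj)
  have cc: "c + cnj c = 2 * of_real (cos (t / 2))" "cnj c - c = - 2 * \<i> * of_real (sin (t / 2))"
    by (auto simp: c_def complex_eq_iff)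
  have c0: "c \<noteq> 0" by (simp add: c_def)
  have "1 + cis t = c * (c + cnj c)" "1 - cis t = c * (cnj c - c)" using c by (auto simp: algebra_simps)
  then have e: "1 + cis t = c * (2 * of_real (cos (t / 2)))" "1 - cis t = c * (- 2 * \<i> * of_real (sin (t / 2)))"
    unfolding cc by auto
  have "1 - cis t \<noteq> 0" unfolding e using c0 p by simp
  then show "cis t \<noteq> 1" by auto
  have "(1 + cis t) / (1 - cis t) = (2 * of_real (cos (t / 2))) / (- 2 * \<i> * of_real (sin (t / 2)))"
    unfolding e using c0 by (intro nonzero_mult_divide_mult_cancel_left)
  also have "\<dots> = \<i> * of_real (cot (t / 2))"
    using p by (simp add: cot_def divide_simps)
  finally show "(1 + cis t) / (1 - cis t) = \<i> * of_real (cot (t / 2))" .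
qed

text \<open>The exponent is continuous in a full neighbourhood of a regular boundary point, so the
  limit along the radius is its value there.\<close>

lemma spiral_radial_limit:
  assumes s: "0 \<le> s" and t: "t \<in> {0<..<2*pi}" "cot (t / 2) \<notin> \<int>"
  shows "((\<lambda>r. spiral s (of_real r * cis t)) \<longlongrightarrow> exp (phase s (\<i> * of_real (cot (t / 2))))) (at_left 1)"
    and "cmod (exp (phase s (\<i> * of_real (cot (t / 2))))) = exp (- s * exp (- sqrt (real (nat \<lceil>cot (t / 2)\<rceil>))))"
proof -
  obtain \<delta> where \<delta>: "0 < \<delta>" "\<And>j::nat. 2 * \<delta> \<le> \<bar>cot (t / 2) - real j\<bar>"
    using nonint_far[OF t(2)] by blast
  have "isCont (phase s) (\<i> * of_real (cot (t / 2)))"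
    using phase_boundary(2)[OF s \<delta>] by (rule DERIV_isCont)
  moreover have "((\<lambda>r. (1 + of_real r * cis t) / (1 - of_real r * cis t)) \<longlongrightarrow> \<i> * of_real (cot (t / 2))) (at_left (1::real))"
  proof -
    have "((\<lambda>r. (1 + of_real r * cis t) / (1 - of_real r * cis t)) \<longlongrightarrow> (1 + of_real 1 * cis t) / (1 - of_real 1 * cis t)) (at_left (1::real))"
      using moebius_cis(2)[OF t(1)] by (intro tendsto_intros) auto
    then show ?thesis using moebius_cis(1)[OF t(1)] by simp
  qed
  ultimately show "((\<lambda>r. spiral s (of_real r * cis t)) \<longlongrightarrow> exp (phase s (\<i> * of_real (cot (t / 2))))) (at_left 1)"
    unfolding spiral_def by (intro tendsto_exp) (rule isCont_tendsto_compose)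
  show "cmod (exp (phase s (\<i> * of_real (cot (t / 2))))) = exp (- s * exp (- sqrt (real (nat \<lceil>cot (t / 2)\<rceil>))))"
    using Re_phase_boundary[OF s \<delta>] by simp
qed

section \<open>Boundary values of the self-map\<close>

text \<open>A limit along the sequence \<open>rad\<close>, because this makes the boundary function
  measurable at once; it agrees with \<open>radial_lim\<close> at all regular points.\<close>

definition bdry :: "real \<Rightarrow> real \<Rightarrow> complex" where
  "bdry s t = lim (\<lambda>k. spiral s (of_real (rad k) * cis t))"

lemma bdry_measurable:
  assumes "0 \<le> s"
  shows "bdry s \<in> borel_measurable circ"
  unfolding bdry_def[abs_def]
  by (intro borel_measurable_lim_metric circ_measurable_cont circle_continuous spiral_holomorphic assms rad_bounds)

lemma bdry_regular:
  assumes s: "0 \<le> s" and t: "t \<in> {0<..<2*pi}" "cot (t / 2) \<notin> \<int>"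
  shows "(\<lambda>k. spiral s (of_real (rad k) * cis t)) \<longlonglongrightarrow> bdry s t"
    and "bdry s t = exp (phase s (\<i> * of_real (cot (t / 2))))"
    and "radial_lim (spiral s) (cis t) = bdry s t"
    and "cmod (bdry s t) = exp (- s * exp (- sqrt (real (nat \<lceil>cot (t / 2)\<rceil>))))"
proof -
  note L = spiral_radial_limit[OF assms]
  from filterlim_compose[OF L(1) rad_tendsto]
  have l: "(\<lambda>k. spiral s (of_real (rad k) * cis t)) \<longlonglongrightarrow> exp (phase s (\<i> * of_real (cot (t / 2))))" .
  then show b: "bdry s t = exp (phase s (\<i> * of_real (cot (t / 2))))" unfolding bdry_def by (rule limI)
  show "(\<lambda>k. spiral s (of_real (rad k) * cis t)) \<longlonglongrightarrow> bdry s t" using l b by simp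
  show "radial_lim (spiral s) (cis t) = bdry s t"
    unfolding radial_lim_def b by (rule tendsto_Lim[OF trivial_limit_at_left_real L(1)])
  show "cmod (bdry s t) = exp (- s * exp (- sqrt (real (nat \<lceil>cot (t / 2)\<rceil>))))"
    unfolding b by (rule L(2))
qed

section \<open>Integrability of the logarithm\<close>

lemma one_minus_exp_ge:
  assumes "0 \<le> x" "x \<le> (1::real)"
  shows "x / 2 \<le> 1 - exp (- x)"
proof -
  have "1 + x \<le> exp x" by (rule exp_ge_add_one_self)
  then have "exp (- x) \<le> 1 / (1 + x)" using assms by (simp add: exp_minus field_simps)
  moreover have "x / 2 \<le> 1 - 1 / (1 + x)"
  proof -
    have "x * x \<le> x * 1" using assms by (intro mult_left_mono) auto
    then show ?thesis using assms by (simp add: field_simps)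
  qed
  ultimately show ?thesis by linarith
qed

lemma integrable_circ_inverse_sqrt: "integrable circ (\<lambda>t. t powr (- 1 / 2))"
proof -
  have "(\<lambda>t. t powr (- 1 / 2)) absolutely_integrable_on {0..2*pi}"
    by (intro nonnegative_absolutely_integrable_1 integrable_on_powr_from_0) auto
  then have "integrable (completion lborel) (\<lambda>t. indicator {0..2*pi} t *\<^sub>R (t powr (- 1 / 2)))"
    by (simp add: set_integrable_def)
  then have "integrable lborel (\<lambda>t. indicator {0..2*pi} t *\<^sub>R (t powr (- 1 / 2)))"
    by (subst (asm) integrable_completion) auto
  then show ?thesis by (simp add: integrable_circ_iff set_integrable_def)
qed

lemma cot_eq_inverse_tan: "cot x = 1 / tan (x::real)"
  by (simp add: cot_def tan_def)

lemma cot_half_le: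
  assumes t: "t \<in> {0<..<2*pi}"
  shows "cot (t / 2) \<le> 2 / t"
proof (cases "t < pi")
  case True
  then have "0 < tan (t / 2)" using t by (intro tan_gt_zero) auto
  moreover have "\<bar>t / 2\<bar> \<le> \<bar>tan (t / 2)\<bar>" using True t by (intro abs_tan_ge) auto
  ultimately have "t / 2 \<le> tan (t / 2)" "0 < tan (t / 2)" using t by auto
  then show ?thesis using t by (simp add: cot_eq_inverse_tan field_simps)
next
  case False
  have "cos (t / 2) \<le> cos (pi / 2)" using False t by (intro cos_monotone_0_pi_le) auto
  moreover have "sin (t / 2) > 0" using t by (auto intro!: sin_gt_zero)
  ultimately have "cot (t / 2) \<le> 0" by (simp add: cot_def divide_nonpos_pos)
  then show ?thesis using t by (auto intro: order_trans)
qed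

text \<open>On level \<open>m\<close> the logarithm is at most \<open>ln 4 + sqrt m\<close> in
  absolute value, the constant coming from \<open>1 / 2 \<le> s\<close>. Since
  \<open>m \<le> 2 / t + 1\<close>, the singularity at \<open>t = 0\<close> is of order
  \<open>t powr (- 1 / 2)\<close>.\<close>

lemma log_one_minus_bdry_integrable:
  assumes s: "1 / 2 \<le> s" "s \<le> 1"
  shows "integrable circ (\<lambda>t. ln (1 - cmod (bdry s t)))"
proof (rule Bochner_Integration.integrable_bound)
  show "integrable circ (\<lambda>t. (ln 4 + 1) + 2 * t powr (- 1 / 2))"
  proof (rule Bochner_Integration.integrable_add)
    show "integrable circ (\<lambda>_. ln 4 + 1 :: real)"
      by (rule circ_integrable_bounded[where B = "ln 4 + 1"]) auto
    show "integrable circ (\<lambda>t. 2 * t powr (- 1 / 2))"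
      by (intro integrable_mult_right integrable_circ_inverse_sqrt)
  qed
  show "(\<lambda>t. ln (1 - cmod (bdry s t))) \<in> borel_measurable circ"
    using bdry_measurable[OF order_trans[OF _ s(1)]] by simp
  show "AE t in circ. norm (ln (1 - cmod (bdry s t))) \<le> norm ((ln 4 + 1) + 2 * t powr (- 1 / 2))"
    using AE_circ_regular
  proof eventually_elim
    case (elim t)
    then have t: "t \<in> {0<..<2*pi}" "cot (t / 2) \<notin> \<int>" by auto
    define m where "m = real (nat \<lceil>cot (t / 2)\<rceil>)"
    define e where "e = s * exp (- sqrt m)"
    have m0: "0 \<le> m" by (simp add: m_def)
    have e: "0 < e" "e \<le> 1" using s m0 by (auto simp: e_def intro!: mult_le_one)
    have c: "cmod (bdry s t) = exp (- e)" using bdry_regular(4)[OF _ t, of s] s by (simp add: e_def m_def)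
    have lo: "e / 2 \<le> 1 - exp (- e)" using e by (intro one_minus_exp_ge) auto
    then have "ln (e / 2) \<le> ln (1 - exp (- e))" using e by simp
    moreover have "ln (e / 2) = ln (s / 2) - sqrt m" using s by (simp add: e_def ln_mult ln_div)
    moreover have "- ln 4 \<le> ln (s / 2)"
    proof -
      have "ln (1 / 4) \<le> ln (s / 2)" using s by (subst ln_le_cancel_iff) auto
      then show ?thesis by (simp add: ln_div)
    qed
    moreover have "ln (1 - exp (- e)) \<le> 0" using lo e by (subst ln_le_zero_iff) (auto intro: less_le_trans[of _ "e/2"])
    ultimately have 1: "\<bar>ln (1 - exp (- e))\<bar> \<le> ln 4 + sqrt m" by linarith
    have "m \<le> 2 / t + 1"
    proof (cases "\<lceil>cot (t / 2)\<rceil> \<le> 0")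
      case True then show ?thesis using t by (simp add: m_def)
    next
      case False
      then have "m = of_int \<lceil>cot (t / 2)\<rceil>" by (simp add: m_def)
      also have "\<dots> \<le> cot (t / 2) + 1" by linarith
      finally show ?thesis using cot_half_le[OF t(1)] by linarith
    qed
    then have "sqrt m \<le> sqrt (2 / t + 1)" by simp
    also have "\<dots> \<le> sqrt (2 / t) + sqrt 1" using t by (intro sqrt_add_le_add_sqrt) auto
    also have "sqrt (2 / t) \<le> 2 * t powr (- 1 / 2)"
    proof -
      have "sqrt (2 / t) = sqrt 2 * (1 / sqrt t)" by (simp add: real_sqrt_divide)
      also have "\<dots> \<le> 2 * (1 / sqrt t)" using t sqrt2_less_2 by (intro mult_right_mono) auto
      also have "1 / sqrt t = t powr (- 1 / 2)"
        using t by (simp add: powr_minus_divide powr_half_sqrt)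
      finally show ?thesis .
    qed
    finally have "\<bar>ln (1 - exp (- e))\<bar> \<le> (ln 4 + 1) + 2 * t powr (- 1 / 2)" using 1 by simp
    moreover have "0 \<le> ln (4::real)" by simp
    ultimately show ?case unfolding c by simp
  qed
qed

text \<open>Equality almost everywhere would not transfer Borel measurability, as
  \<open>lborel\<close> is not complete. The two integrands differ only on a countable set, and that
  suffices.\<close>

lemma log_integrable_radial:
  assumes s: "1 / 2 \<le> s" "s \<le> 1"
  shows "integrable circ (\<lambda>t. ln (1 - cmod (radial_lim (spiral s) (cis t))))"
proof -
  have sub: "exceptional \<subseteq> {0..2*pi}" by (auto simp: exceptional_def)
  have "integrable circ (\<lambda>t. ln (1 - cmod (bdry s t))) \<longleftrightarrow>
      integrable circ (\<lambda>t. ln (1 - cmod (radial_lim (spiral s) (cis t))))"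
  proof (rule integrable_discrete_difference[OF countable_exceptional])
    fix x assume x: "x \<in> exceptional"
    show "emeasure circ {x} = 0"
      unfolding circ_def using x sub by (subst emeasure_restrict_space) auto
    show "{x} \<in> sets circ"
      unfolding circ_def sets_restrict_space using x sub by (auto intro!: image_eqI[of _ _ "{x}"])
  next
    fix t assume "t \<in> space circ" "t \<notin> exceptional"
    then have "t \<in> {0<..<2*pi}" "cot (t / 2) \<notin> \<int>" by (auto simp: exceptional_def less_le)
    then show "ln (1 - cmod (bdry s t)) = ln (1 - cmod (radial_lim (spiral s) (cis t)))"
      using bdry_regular(3)[of s t] s by simp
  qed
  then show ?thesis using log_one_minus_bdry_integrable[OF s] by simp
qed

section \<open>Lower bound from a single arc\<close>

lemma shifted_poly_Parseval:
  fixes b :: "nat \<Rightarrow> complex"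
  assumes r: "0 \<le> r"
  shows "integral {a..a + 2*pi} (\<lambda>x. (cmod (\<Sum>j<N. b j * (of_real r * cis x) ^ j))\<^sup>2) =
    2 * pi * (\<Sum>j<N. (cmod (b j))\<^sup>2 * (r\<^sup>2) ^ j)"
proof -
  let ?H = "\<lambda>x. (cmod (\<Sum>j<N. b j * (of_real r * cis x) ^ j))\<^sup>2"
  define c where "c j = b j * of_real r ^ j * cis (real j * a)" for j
  have cont: "continuous_on A ?H" for A by (intro continuous_intros)
  have "integral {a..a + 2*pi} ?H = integral {0..2*pi} (?H \<circ> (\<lambda>x. x + a))"
    using integral_shift[OF cont, of 0 "2*pi" a] by (simp add: add.commute)
  also have "?H \<circ> (\<lambda>x. x + a) = (\<lambda>x. (cmod (\<Sum>j<N. c j * cis (real j * x)))\<^sup>2)"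
  proof -
    have "b j * (of_real r * cis (x + a)) ^ j = c j * cis (real j * x)" for j x
      by (simp add: c_def power_mult_distrib Complex.DeMoivre cis_mult algebra_simps)
    then show ?thesis by (simp add: o_def)
  qed
  also have "integral {0..2*pi} \<dots> = (LINT x|circ. (cmod (\<Sum>j<N. c j * cis (real j * x)))\<^sup>2)"
    by (intro integral_circ_continuous[symmetric] continuous_intros)
  also have "\<dots> = 2 * pi * (\<Sum>j<N. (cmod (c j))\<^sup>2)" by (rule trig_poly_Parseval)
  also have "(\<Sum>j<N. (cmod (c j))\<^sup>2) = (\<Sum>j<N. (cmod (b j))\<^sup>2 * (r\<^sup>2) ^ j)"
    using r by (intro sum.cong refl)
      (simp add: c_def norm_mult norm_power power_mult_distrib power_mult[symmetric] mult.commute)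
  finally show ?thesis .
qed

text \<open>On the arc where \<open>cot (t / 2)\<close> runs through the middle half of \<open>[k, k + 1]\<close> the boundary
  function traverses a full circle with bounded speed.\<close>

lemma spiral_arc_lower_bound:
  fixes b :: "nat \<Rightarrow> complex" and k :: nat
  assumes s: "0 \<le> s" "s \<le> 1"
  defines "r \<equiv> exp (- s * exp (- sqrt (real (Suc k))))"
  defines "D \<equiv> 11 * (1 + (real (Suc k))\<^sup>2)"
  shows "(1 - r) / D * (\<Sum>j<N. (cmod (b j))\<^sup>2 * (r\<^sup>2) ^ j) \<le>
    (LINT t|circ. (1 - cmod (bdry s t)) * (cmod (\<Sum>j<N. b j * bdry s t ^ j))\<^sup>2) / (2 * pi)"
proof -
  \<comment> \<open>Parameters at which \<open>cot (t / 2)\<close> equals \<open>k + 3/4\<close> and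
    \<open>k + 1/4\<close>; the cotangent decreases, so \<open>A\<close> is the smaller one.\<close>
  define A where "A = 2 * arctan (1 / (real k + 3/4))"
  define B where "B = 2 * arctan (1 / (real k + 1/4))"
  have kpos: "1 / (real k + 3/4) > 0" "1 / (real k + 3/4) < 1 / (real k + 1/4)"
    by (auto simp: field_simps)
  have AB: "0 < A" "A < B" "B < pi"
    using kpos arctan_ubound[of "1 / (real k + 1/4)"] by (auto simp: A_def B_def arctan_less_iff)
  have cotA: "cot (A / 2) = real k + 3/4" and cotB: "cot (B / 2) = real k + 1/4"
    by (simp_all add: A_def B_def cot_eq_inverse_tan tan_arctan)
  have y: "real k + 1/4 \<le> cot (t / 2)" "cot (t / 2) \<le> real k + 3/4" "sin (t / 2) > 0" if "t \<in> {A..B}" for t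
  proof -
    have tt: "0 < t / 2" "t / 2 < pi / 2" using that AB by auto
    have "tan (A / 2) \<le> tan (t / 2)" using that AB by (subst tan_mono_le_eq) auto
    moreover have "tan (t / 2) \<le> tan (B / 2)" using that AB by (subst tan_mono_le_eq) auto
    ultimately have "1 / (real k + 3/4) \<le> tan (t / 2)" "tan (t / 2) \<le> 1 / (real k + 1/4)"
      by (simp_all add: A_def B_def tan_arctan)
    moreover have "tan (t / 2) > 0" using tt by (intro tan_gt_zero) auto
    ultimately show "real k + 1/4 \<le> cot (t / 2)" "cot (t / 2) \<le> real k + 3/4"
      by (auto simp: cot_eq_inverse_tan field_simps)
    show "sin (t / 2) > 0" using tt by (intro sin_gt_zero) auto
  qed
  \<comment> \<open>The middle half stays 1/4 away from all integers, that is
    \<open>2 * \<delta>\<close> with \<open>\<delta> = 1/8\<close>; this gives the bound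
    \<open>4 * s / pi \<le> 2\<close> for the jump sum \<open>q\<close>.\<close>
  have far: "2 * (1/8) \<le> \<bar>x - real j\<bar>" if "real k + 1/4 \<le> x" "x \<le> real k + 3/4" for x and j :: nat
  proof (cases "j \<le> k")
    case True then show ?thesis using that by auto
  next
    case False
    then have "real k + 1 \<le> real j" by linarith
    then show ?thesis using that by auto
  qed
  define q where "q x = (\<Sum>j. jump s j / (x - real j))" for x
  have q: "\<bar>q x\<bar> \<le> 2" if "real k + 1/4 \<le> x" "x \<le> real k + 3/4" for x
  proof -
    have "\<bar>q x\<bar> \<le> s / pi / (2 * (1/8))"
      unfolding q_def by (rule phase_boundary(3)[OF s(1)]) (use far[OF that] in auto)
    also have "\<dots> \<le> 2" using s pi_gt3 by (simp add: field_simps)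
    finally show ?thesis .
  qed
  define P where "P x = Im (phase s (\<i> * of_real x))" for x
  have dP: "(P has_real_derivative (- 20 - q x)) (at x)" if "real k + 1/4 \<le> x" "x \<le> real k + 3/4" for x
    unfolding P_def[abs_def] q_def by (rule Im_phase_deriv[OF s(1), of "1/8"]) (use far[OF that] in auto)
  define \<theta> where "\<theta> t = P (cot (t / 2))" for t
  define \<theta>' where "\<theta>' t = (- 20 - q (cot (t / 2))) * (- inverse ((sin (t / 2))\<^sup>2) * (1 / 2))" for t
  have d\<theta>: "(\<theta> has_real_derivative \<theta>' t) (at t)" if "t \<in> {A..B}" for t
  proof -
    have "((\<lambda>t. cot (t / 2)) has_real_derivative - inverse ((sin (t / 2))\<^sup>2) * (1 / 2)) (at t)"
      using y(3)[OF that] by (intro DERIV_chain2[OF DERIV_cot]) (auto intro!: derivative_eq_intros)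
    from DERIV_chain2[OF dP[OF y(1,2)[OF that]] this] show ?thesis
      unfolding \<theta>_def[abs_def] \<theta>'_def .
  qed
  \<comment> \<open>The speed is \<open>(20 + q) / 2\<close> times \<open>1 + cot^2\<close>, with
    \<open>q\<close> between -2 and 2 and the cotangent below \<open>k + 1\<close>: this is the
    origin of the 11 in \<open>D\<close>.\<close>
  have \<theta>'_bounds: "0 \<le> \<theta>' t" "\<theta>' t \<le> D" if "t \<in> {A..B}" for t
  proof -
    have "inverse ((sin (t / 2))\<^sup>2) = 1 + (cot (t / 2))\<^sup>2"
      using y(3)[OF that] sin_cos_squared_add[of "t / 2"] by (simp add: cot_def power_divide field_simps)
    then have eq: "\<theta>' t = (20 + q (cot (t / 2))) / 2 * (1 + (cot (t / 2))\<^sup>2)"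
      unfolding \<theta>'_def by (simp add: algebra_simps)
    have qq: "\<bar>q (cot (t / 2))\<bar> \<le> 2" by (rule q[OF y(1,2)[OF that]])
    show "0 \<le> \<theta>' t" unfolding eq using qq by (intro mult_nonneg_nonneg) auto
    have "(cot (t / 2))\<^sup>2 \<le> (real (Suc k))\<^sup>2" using y(1,2)[OF that] by (intro power_mono) auto
    then show "\<theta>' t \<le> D" unfolding eq D_def using qq by (intro mult_mono) auto
  qed
  \<comment> \<open>The drop of \<open>P\<close> over length 1/2 is at least 9. As the cotangent
    reverses orientation, \<open>\<theta>\<close> gains this amount from \<open>A\<close> to
    \<open>B\<close>.\<close>
  have gap: "\<theta> A + 2 * pi \<le> \<theta> B"
  proof -
    obtain z where z: "z > real k + 1/4" "z < real k + 3/4"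
      "P (real k + 3/4) - P (real k + 1/4) = (real k + 3/4 - (real k + 1/4)) * (- 20 - q z)"
      using MVT2[of "real k + 1/4" "real k + 3/4" P "\<lambda>x. - 20 - q x"] dP by auto
    have "\<bar>q z\<bar> \<le> 2" using z by (intro q) auto
    then have "P (real k + 3/4) - P (real k + 1/4) \<le> - 9" using z(3) by (simp add: abs_le_iff)
    then show ?thesis using pi_less_4 cotA cotB by (simp add: \<theta>_def)
  qed
  define H where "H x = (cmod (\<Sum>j<N. b j * (of_real r * cis x) ^ j))\<^sup>2" for x
  have Hc: "continuous_on X H" for X unfolding H_def[abs_def] by (intro continuous_intros)
  have H0: "0 \<le> H x" for x by (simp add: H_def)
  have \<theta>c: "continuous_on {A..B} \<theta>"
    using d\<theta> by (intro continuous_at_imp_continuous_on ballI) (auto intro: DERIV_isCont)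
  have "compact (\<theta> ` {A..B})" by (intro compact_continuous_image \<theta>c) auto
  then obtain c d where cd: "\<theta> ` {A..B} \<subseteq> {c..d}"
    using bounded_subset_cbox_symmetric[OF compact_imp_bounded] by (metis cbox_interval)
  have sub: "((\<lambda>t. \<theta>' t *\<^sub>R H (\<theta> t)) has_integral (integral {\<theta> A..\<theta> B} H)) {A..B}"
    using AB gap pi_gt_zero
    by (intro has_integral_substitution[OF _ _ cd Hc] has_field_derivative_at_within[OF d\<theta>]) auto
  have H\<theta>c: "continuous_on {A..B} (\<lambda>t. H (\<theta> t))"
    by (rule continuous_on_compose2[OF Hc \<theta>c]) auto
  have "2 * pi * (\<Sum>j<N. (cmod (b j))\<^sup>2 * (r\<^sup>2) ^ j) = integral {\<theta> A..\<theta> A + 2 * pi} H"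
    unfolding H_def by (rule shifted_poly_Parseval[symmetric]) (simp add: r_def)
  also have "\<dots> \<le> integral {\<theta> A..\<theta> B} H"
    using gap H0 by (intro integral_subset_le integrable_continuous_real Hc) auto
  also have "\<dots> \<le> integral {A..B} (\<lambda>t. D * H (\<theta> t))"
  proof (rule has_integral_le[OF sub integrable_integral])
    show "(\<lambda>t. D * H (\<theta> t)) integrable_on {A..B}"
      by (intro integrable_continuous_real continuous_intros H\<theta>c)
    show "\<theta>' t *\<^sub>R H (\<theta> t) \<le> D * H (\<theta> t)" if "t \<in> {A..B}" for t
      using \<theta>'_bounds[OF that] H0 by (auto intro!: mult_right_mono)
  qed
  also have "\<dots> = D * integral {A..B} (\<lambda>t. H (\<theta> t))" by simp
  finally have low: "2 * pi * (\<Sum>j<N. (cmod (b j))\<^sup>2 * (r\<^sup>2) ^ j) \<le> D * integral {A..B} (\<lambda>t. H (\<theta> t))" .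

  define h where "h t = (1 - r) * H (\<theta> t)" for t
  have hc: "continuous_on {A..B} h" unfolding h_def[abs_def] by (intro continuous_intros H\<theta>c)
  have hint: "set_integrable lborel {A..B} h" by (rule borel_integrable_atLeastAtMost'[OF hc])
  have ind: "indicator {0..2*pi} t *\<^sub>R (indicator {A..B} t *\<^sub>R h t) = indicator {A..B} t *\<^sub>R h t" for t
    using AB by (auto simp: indicator_def)
  have Jint: "integrable circ (\<lambda>t. indicator {A..B} t *\<^sub>R h t)"
    unfolding integrable_circ_iff set_integrable_def ind using hint by (simp add: set_integrable_def)
  have Jval: "(LINT t|circ. indicator {A..B} t *\<^sub>R h t) = (1 - r) * integral {A..B} (\<lambda>t. H (\<theta> t))"
  proof -
    have "(LINT t|circ. indicator {A..B} t *\<^sub>R h t) = (LINT t:{A..B}|lborel. h t)"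
      unfolding integral_circ_eq set_lebesgue_integral_def ind ..
    also have "\<dots> = integral {A..B} h" by (rule set_borel_integral_eq_integral(2)[OF hint])
    finally show ?thesis by (simp add: h_def[abs_def])
  qed
  define G where "G t = (1 - cmod (bdry s t)) * (cmod (\<Sum>j<N. b j * bdry s t ^ j))\<^sup>2" for t
  have reg: "cmod (bdry s t) \<le> 1" if "t \<in> {0<..<2*pi}" "cot (t / 2) \<notin> \<int>" for t
    using bdry_regular(4)[OF s(1) that] s by simp
  have Gm: "G \<in> borel_measurable circ"
    using bdry_measurable[OF s(1)] unfolding G_def[abs_def] by measurable
  have Gint: "integrable circ G"
  proof (rule circ_integrable_bounded[OF Gm, where B = "(\<Sum>j<N. cmod (b j))\<^sup>2"])
    show "AE t in circ. norm (G t) \<le> (\<Sum>j<N. cmod (b j))\<^sup>2"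
      using AE_circ_regular
    proof eventually_elim
      case (elim t)
      have c: "cmod (bdry s t) \<le> 1" using elim by (intro reg) auto
      have "cmod (\<Sum>j<N. b j * bdry s t ^ j) \<le> (\<Sum>j<N. cmod (b j))"
        using c by (intro sum_norm_le) (auto simp: norm_mult norm_power intro!: mult_right_le_one_le power_le_one)
      then have "(cmod (\<Sum>j<N. b j * bdry s t ^ j))\<^sup>2 \<le> (\<Sum>j<N. cmod (b j))\<^sup>2" by (intro power_mono) auto
      then have "(1 - cmod (bdry s t)) * (cmod (\<Sum>j<N. b j * bdry s t ^ j))\<^sup>2 \<le> 1 * (\<Sum>j<N. cmod (b j))\<^sup>2"
        using c by (intro mult_mono) auto
      then show ?case unfolding G_def using c by (simp add: abs_mult)
    qed
  qed
  have "(LINT t|circ. indicator {A..B} t *\<^sub>R h t) \<le> (LINT t|circ. G t)"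
  proof (rule integral_mono_AE[OF Jint Gint])
    show "AE t in circ. indicator {A..B} t *\<^sub>R h t \<le> G t"
      using AE_circ_regular
    proof eventually_elim
      case (elim t)
      then have t: "t \<in> {0<..<2*pi}" "cot (t / 2) \<notin> \<int>" by auto
      show ?case
      proof (cases "t \<in> {A..B}")
        case True
        have "\<lceil>cot (t / 2)\<rceil> = int (Suc k)"
          using y(1,2)[OF True] by (intro ceiling_unique) auto
        then have cm: "cmod (bdry s t) = r" using bdry_regular(4)[OF s(1) t] by (simp add: r_def)
        have "bdry s t = of_real (cmod (bdry s t)) * cis (\<theta> t)"
          unfolding bdry_regular(2)[OF s(1) t] \<theta>_def P_def by (subst exp_eq_polar) simp
        then have "bdry s t = of_real r * cis (\<theta> t)" using cm by simp
        then have "G t = h t" using cm unfolding G_def h_def H_def by simp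
        then show ?thesis using True by simp
      next
        case False
        have "0 \<le> G t" unfolding G_def using reg[OF t] by (intro mult_nonneg_nonneg) auto
        then show ?thesis using False by simp
      qed
    qed
  qed
  then have fin: "(1 - r) * integral {A..B} (\<lambda>t. H (\<theta> t)) \<le> (LINT t|circ. G t)" unfolding Jval .
  have D0: "D > 0" unfolding D_def by (intro mult_pos_pos add_pos_nonneg) auto
  have r1: "0 \<le> 1 - r" using s by (simp add: r_def)
  have "(1 - r) / D * (\<Sum>j<N. (cmod (b j))\<^sup>2 * (r\<^sup>2) ^ j) =
      (1 - r) * (2 * pi * (\<Sum>j<N. (cmod (b j))\<^sup>2 * (r\<^sup>2) ^ j)) / D / (2 * pi)" by simp
  also have "\<dots> \<le> (1 - r) * (D * integral {A..B} (\<lambda>t. H (\<theta> t))) / D / (2 * pi)"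
    using low r1 D0 by (intro divide_right_mono mult_left_mono) auto
  also have "\<dots> = (1 - r) * integral {A..B} (\<lambda>t. H (\<theta> t)) / (2 * pi)" using D0 by simp
  also have "\<dots> \<le> (LINT t|circ. G t) / (2 * pi)" using fin by (intro divide_right_mono) auto
  finally show ?thesis unfolding G_def .
qed

section \<open>The weighted composition operator\<close>

text \<open>Without a limit, the predicate under the description operator in \<open>Lim\<close> is
  constantly \<open>False\<close>, so \<open>radial_lim\<close> can only be
  \<open>THE l. False\<close>. Any other value is therefore a genuine limit.\<close>

lemma radial_lim_tendsto:
  assumes "radial_lim f \<xi> \<noteq> (THE l. False)"
  shows "((\<lambda>r. f (of_real r * \<xi>)) \<longlongrightarrow> radial_lim f \<xi>) (at_left 1)"
proof -
  have "\<exists>l. ((\<lambda>r. f (of_real r * \<xi>)) \<longlongrightarrow> l) (at_left 1)"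
    using assms by (rule contrapos_np) (simp add: radial_lim_def Topological_Spaces.Lim_def)
  then show ?thesis
    unfolding radial_lim_def using tendsto_Lim[OF trivial_limit_at_left_real] by blast
qed

text \<open>
  \<^const>\<open>radial_lim\<close> returns the fixed value \<open>THE l. False\<close> where the limit does not exist. If
  \<open>1 - \<bar>\<phi>\<^sup>*\<bar>\<close> avoids the squared modulus of that value, the hypothesis on \<open>\<bar>w\<^sup>*\<bar>\<^sup>2\<close> itself forces
  the radial limits of \<open>w\<close> to exist, and Fatou's theorem is not needed. The scaling parameter
  \<open>s\<close> of the self-map serves only this purpose.
\<close>

lemma scale_avoiding_value:
  fixes v :: real
  obtains s where "1 / 2 \<le> s" "s \<le> 1" "\<And>m::nat. 1 - exp (- s * exp (- sqrt (real m))) \<noteq> v"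
proof -
  \<comment> \<open>For each \<open>m\<close> at most one \<open>s\<close> produces the value
    \<open>v\<close>; countably many parameters cannot exhaust an interval.\<close>
  define C where "C = range (\<lambda>m::nat. - ln (1 - v) * exp (sqrt (real m)))"
  have "\<not> {1/2..1} \<subseteq> C"
    using uncountable_closed_interval[of "1/2" "1::real"] countable_subset[of "{1/2..1}" C] by (auto simp: C_def)
  then obtain s where s: "s \<in> {1/2..1}" "s \<notin> C" by blast
  have "1 - exp (- s * exp (- sqrt (real m))) \<noteq> v" for m
  proof
    assume "1 - exp (- s * exp (- sqrt (real m))) = v"
    then have "1 - v = exp (- s * exp (- sqrt (real m)))" by simp
    then have "ln (1 - v) = - s * exp (- sqrt (real m))" by simp
    then have "- ln (1 - v) * exp (sqrt (real m)) = s" by (simp add: exp_minus)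
    then show False using s(2) unfolding C_def by blast
  qed
  then show ?thesis using that[of s] s(1) by auto
qed

text \<open>All that later estimates use of an outer function. The limits are along
  \<open>rad\<close>, and only their moduli are prescribed.\<close>

definition boundary_weight :: "real \<Rightarrow> (complex \<Rightarrow> complex) \<Rightarrow> bool" where
  "boundary_weight s w \<longleftrightarrow> w holomorphic_on ball 0 1 \<and> (\<forall>z. cmod z < 1 \<longrightarrow> cmod (w z) \<le> 1) \<and>
     (AE t in circ. \<exists>l. (cmod l)\<^sup>2 = 1 - cmod (bdry s t) \<and> (\<lambda>k. w (of_real (rad k) * cis t)) \<longlonglongrightarrow> l)"

lemma AE_bdry_lt_1:
  assumes "0 < s"
  shows "AE t in circ. cmod (bdry s t) < 1"
  using AE_circ_regular by eventually_elim (use bdry_regular(4)[of s] assms in auto)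

text \<open>The image of a polynomial is a bounded function with known boundary modulus, so its norm
  is a boundary integral in which \<open>w\<close> survives only as
  \<open>1 - cmod (bdry s t)\<close>.\<close>

lemma weighted_poly_norm:
  fixes b :: "nat \<Rightarrow> complex"
  assumes s: "0 < s" and w: "boundary_weight s w"
  shows "(\<lambda>z. w z * (\<Sum>j<N. b j * spiral s z ^ j)) \<in> H2"
    and "l2sq (taylor_coeff (\<lambda>z. w z * (\<Sum>j<N. b j * spiral s z ^ j))) =
      (LINT t|circ. (1 - cmod (bdry s t)) * (cmod (\<Sum>j<N. b j * bdry s t ^ j))\<^sup>2) / (2 * pi)"
proof -
  let ?F = "\<lambda>z. w z * (\<Sum>j<N. b j * spiral s z ^ j)"
  have s0: "0 \<le> s" using s by simp
  have hol: "?F holomorphic_on ball 0 1"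
    using w spiral_holomorphic[OF s0] unfolding boundary_weight_def by (intro holomorphic_intros) auto
  have bd: "cmod (?F z) \<le> (\<Sum>j<N. cmod (b j))" if z: "cmod z < 1" for z
  proof -
    have "spiral s z \<in> ball 0 1" using spiral_self_map[OF s0] z by (auto simp: image_subset_iff)
    then have "cmod (spiral s z) \<le> 1" by simp
    then have "cmod (\<Sum>j<N. b j * spiral s z ^ j) \<le> (\<Sum>j<N. cmod (b j))"
      by (intro sum_norm_le) (auto simp: norm_mult norm_power intro!: mult_right_le_one_le power_le_one)
    moreover have "cmod (w z) \<le> 1" using w z by (simp add: boundary_weight_def)
    ultimately have "cmod (w z) * cmod (\<Sum>j<N. b j * spiral s z ^ j) \<le> 1 * (\<Sum>j<N. cmod (b j))"
      by (intro mult_mono) auto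
    then show ?thesis by (simp add: norm_mult)
  qed
  have meas: "(\<lambda>t. (1 - cmod (bdry s t)) * (cmod (\<Sum>j<N. b j * bdry s t ^ j))\<^sup>2) \<in> borel_measurable circ"
    using bdry_measurable[OF s0] by measurable
  have "AE t in circ. \<exists>l. (cmod l)\<^sup>2 = 1 - cmod (bdry s t) \<and> (\<lambda>k. w (of_real (rad k) * cis t)) \<longlonglongrightarrow> l"
    using w by (simp add: boundary_weight_def)
  then have lim: "AE t in circ. (\<lambda>k. (cmod (?F (of_real (rad k) * cis t)))\<^sup>2) \<longlonglongrightarrow>
      (1 - cmod (bdry s t)) * (cmod (\<Sum>j<N. b j * bdry s t ^ j))\<^sup>2"
    using AE_circ_regular
  proof eventually_elim
    case (elim t)
    then obtain l where l: "(cmod l)\<^sup>2 = 1 - cmod (bdry s t)" "(\<lambda>k. w (of_real (rad k) * cis t)) \<longlonglongrightarrow> l" by blast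
    have "(\<lambda>k. spiral s (of_real (rad k) * cis t)) \<longlonglongrightarrow> bdry s t"
      using elim by (intro bdry_regular(1)[OF s0]) auto
    then have "(\<lambda>k. (cmod (?F (of_real (rad k) * cis t)))\<^sup>2) \<longlonglongrightarrow> (cmod (l * (\<Sum>j<N. b j * bdry s t ^ j)))\<^sup>2"
      by (intro tendsto_intros l)
    then show ?case by (simp add: norm_mult power_mult_distrib l)
  qed
  show "?F \<in> H2" by (rule H2_bounded_boundary(1)[OF hol bd meas lim])
  show "l2sq (taylor_coeff ?F) =
      (LINT t|circ. (1 - cmod (bdry s t)) * (cmod (\<Sum>j<N. b j * bdry s t ^ j))\<^sup>2) / (2 * pi)"
    by (rule H2_bounded_boundary(2)[OF hol bd meas lim])
qed

lemma weighted_power_norm: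
  assumes s: "0 < s" and w: "boundary_weight s w"
  shows "(\<lambda>z. w z * spiral s z ^ n) \<in> H2"
    and "l2sq (taylor_coeff (\<lambda>z. w z * spiral s z ^ n)) =
      (LINT t|circ. (1 - cmod (bdry s t)) * ((cmod (bdry s t))\<^sup>2) ^ n) / (2 * pi)"
proof -
  have mono: "(\<Sum>j<Suc n. (if j = n then 1 else 0) * x ^ j) = (x::complex) ^ n" for x
    by (simp add: if_distribR cong: if_cong)
  have sq: "(cmod (x ^ n))\<^sup>2 = ((cmod x)\<^sup>2) ^ n" for x :: complex
    by (simp add: norm_power power_mult[symmetric] mult.commute)
  note W = weighted_poly_norm[OF assms, where N = "Suc n" and b = "\<lambda>j. if j = n then 1 else 0", unfolded mono sq]
  show "(\<lambda>z. w z * spiral s z ^ n) \<in> H2" by (rule W(1))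
  show "l2sq (taylor_coeff (\<lambda>z. w z * spiral s z ^ n)) =
      (LINT t|circ. (1 - cmod (bdry s t)) * ((cmod (bdry s t))\<^sup>2) ^ n) / (2 * pi)" by (rule W(2))
qed

lemma weighted_powers_sum_le:
  assumes s: "0 < s" and w: "boundary_weight s w"
  shows "(\<Sum>n<N. l2sq (taylor_coeff (\<lambda>z. w z * spiral s z ^ n))) \<le> 1"
proof -
  let ?g = "\<lambda>n t. (1 - cmod (bdry s t)) * ((cmod (bdry s t))\<^sup>2) ^ n"
  have meas: "?g n \<in> borel_measurable circ" for n
    using bdry_measurable[OF less_imp_le[OF s]] by measurable
  have int: "integrable circ (?g n)" for n
  proof (rule circ_integrable_bounded[OF meas, where B = 1])
    show "AE t in circ. norm (?g n t) \<le> 1"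
      using AE_bdry_lt_1[OF s]
      by eventually_elim (auto simp: abs_mult intro!: mult_le_one power_le_one)
  qed
  have "(\<Sum>n<N. l2sq (taylor_coeff (\<lambda>z. w z * spiral s z ^ n))) = (\<Sum>n<N. LINT t|circ. ?g n t) / (2 * pi)"
    using weighted_power_norm(2)[OF assms] by (simp add: sum_divide_distrib)
  also have "\<dots> = (LINT t|circ. (\<Sum>n<N. ?g n t)) / (2 * pi)"
    using int by (simp add: Bochner_Integration.integral_sum)
  also have "\<dots> \<le> (LINT t|circ. 1) / (2 * pi)"
  proof (intro divide_right_mono integral_mono_AE)
    show "integrable circ (\<lambda>t. \<Sum>n<N. ?g n t)" using int by (intro Bochner_Integration.integrable_sum) auto
    show "integrable circ (\<lambda>t. 1::real)" by (rule circ_integrable_bounded[where B = 1]) auto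
    show "AE t in circ. (\<Sum>n<N. ?g n t) \<le> 1"
      using AE_bdry_lt_1[OF s]
    proof eventually_elim
      case (elim t)
      define a where "a = cmod (bdry s t)"
      have a: "0 \<le> a" "a < 1" using elim by (auto simp: a_def)
      have "(\<Sum>n<N. (1 - a) * (a\<^sup>2) ^ n) = (1 - a) * (\<Sum>n<N. (a\<^sup>2) ^ n)" by (simp add: sum_distrib_left)
      also have "\<dots> \<le> (1 - a\<^sup>2) * (\<Sum>n<N. (a\<^sup>2) ^ n)"
        using a mult_left_le[of a a] by (intro mult_right_mono sum_nonneg) (auto simp: power2_eq_square)
      also have "\<dots> = 1 - (a\<^sup>2) ^ N" by (rule one_diff_power_eq[symmetric])
      also have "\<dots> \<le> 1" by simp
      finally show ?case by (simp add: a_def)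
    qed
  qed auto
  also have "(LINT t|circ. 1) / (2 * pi) = (1::real)" using measure_circ by simp
  finally show ?thesis .
qed

text \<open>The norm computation controls the columns, whereas \<open>hs_matrix\<close> is about
  rows. Bounding all finite rectangles of the double sum by 1 gives both the square-summability of
  each row and the summability over rows.\<close>

lemma weighted_composition_hilbert_schmidt:
  assumes s: "0 < s" and w: "boundary_weight s w"
  shows "hilbert_schmidt (\<lambda>f z. w z * f (spiral s z))"
proof -
  have s0: "0 \<le> s" using s by simp
  have wh: "w holomorphic_on ball 0 1" using w by (simp add: boundary_weight_def)
  define M where "M m n = taylor_coeff (\<lambda>z. w z * spiral s z ^ n) m" for m n
  have col: "(\<lambda>m. M m n) \<in> l2" "l2sq (\<lambda>m. M m n) = l2sq (taylor_coeff (\<lambda>z. w z * spiral s z ^ n))" for n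
    using weighted_power_norm(1)[OF assms, of n] by (auto simp: M_def H2_iff_l2)
  have part: "(\<Sum>n<N. \<Sum>m<K. (cmod (M m n))\<^sup>2) \<le> 1" for N K
  proof -
    have "(\<Sum>n<N. \<Sum>m<K. (cmod (M m n))\<^sup>2) \<le> (\<Sum>n<N. l2sq (\<lambda>m. M m n))"
      unfolding l2sq_def using col(1) by (intro sum_mono sum_le_suminf) (auto simp: l2_def)
    also have "\<dots> \<le> 1" unfolding col(2) by (rule weighted_powers_sum_le[OF assms])
    finally show ?thesis .
  qed
  have row: "M m \<in> l2" for m
  proof -
    have "(\<Sum>n<N. (cmod (M m n))\<^sup>2) \<le> 1" for N
    proof -
      have "(\<Sum>n<N. (cmod (M m n))\<^sup>2) \<le> (\<Sum>n<N. \<Sum>m<Suc m. (cmod (M m n))\<^sup>2)"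
        by (intro sum_mono member_le_sum) auto
      then show ?thesis using part[of "Suc m" N] by linarith
    qed
    then have "summable (\<lambda>n. (cmod (M m n))\<^sup>2)" by (intro summableI_nonneg_bounded[where x = 1]) auto
    then show ?thesis by (simp add: l2_def)
  qed
  have "summable (\<lambda>m. l2sq (M m))"
  proof (rule summableI_nonneg_bounded)
    show "0 \<le> l2sq (M m)" for m by (rule l2sq_nonneg[OF row])
    fix K
    have sm: "summable (\<lambda>n. (cmod (M m n))\<^sup>2)" for m using row[of m] by (simp add: l2_def)
    have "(\<Sum>m<K. l2sq (M m)) = (\<Sum>n. \<Sum>m<K. (cmod (M m n))\<^sup>2)"
      unfolding l2sq_def by (rule suminf_sum[symmetric]) (rule sm)
    also have "\<dots> \<le> 1" by (intro suminf_le_const summable_sum sm part)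
    finally show "(\<Sum>m<K. l2sq (M m)) \<le> 1" .
  qed
  then have M: "hs_matrix M" using row by (simp add: hs_matrix_def)
  show ?thesis
  proof (rule hs_matrix_imp_hilbert_schmidt[OF _ M])
    show "linear_on_H2 (\<lambda>f z. w z * f (spiral s z))" by (simp add: linear_on_H2_def algebra_simps)
    fix f assume f: "f \<in> H2"
    then have fh: "f holomorphic_on ball 0 1" by (simp add: H2_def)
    have "(f \<circ> spiral s) holomorphic_on ball 0 1"
      by (rule holomorphic_on_compose_gen[OF spiral_holomorphic[OF s0] fh spiral_self_map[OF s0]])
    then show "(\<lambda>z. w z * f (spiral s z)) holomorphic_on ball 0 1"
      using wh by (intro holomorphic_intros) (auto simp: o_def)
    show "taylor_coeff (\<lambda>z. w z * f (spiral s z)) = mat_app M (taylor_coeff f)"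
      using taylor_coeff_weighted_composition[OF wh spiral_holomorphic[OF s0] spiral_self_map[OF s0] fh]
      by (auto simp: mat_app_def M_def sums_iff)
  qed
qed

text \<open>For degrees \<open>j\<close> with \<open>j * e k \<le> 1\<close> the weight
  \<open>(r\<^sup>2) ^ j\<close> is at least \<open>exp (- 2)\<close>, so the arc estimate is
  uniform over polynomials of degree at most \<open>n\<close>. The 22 is the 11 of that estimate
  doubled, from \<open>1 - r \<ge> e k / 2\<close>.\<close>

lemma weighted_composition_sing_num_ge:
  assumes s: "0 < s" "s \<le> 1" and w: "boundary_weight s w"
  defines "e \<equiv> \<lambda>k::nat. s * exp (- sqrt (real (Suc k)))"
  assumes n: "real n * e k \<le> 1"
  shows "sqrt (e k * exp (- 2) / (22 * (1 + (real (Suc k))\<^sup>2))) \<le> sing_num (\<lambda>f z. w z * f (spiral s z)) n"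
proof (rule sing_num_lower_bound)
  let ?T = "\<lambda>f z. w z * f (spiral s z)"
  show bT: "bounded_on_H2 ?T"
    using weighted_composition_hilbert_schmidt[OF s(1) w] by (simp add: hilbert_schmidt_def Schatten_def)
  have e: "0 < e k" "e k \<le> 1" using s by (auto simp: e_def intro!: mult_le_one)
  define r where "r = exp (- e k)"
  define D where "D = 11 * (1 + (real (Suc k))\<^sup>2)"
  have D0: "D > 0" unfolding D_def by (intro mult_pos_pos add_pos_nonneg) auto
  show "0 \<le> e k * exp (- 2) / (22 * (1 + (real (Suc k))\<^sup>2))" using e by auto
  fix b :: "nat \<Rightarrow> complex"
  have rj: "exp (- 2) \<le> (r\<^sup>2) ^ j" if "j < Suc n" for j
  proof -
    have "real j * e k \<le> real n * e k" using that e by (intro mult_right_mono) auto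
    then have "real j * e k \<le> 1" using n by linarith
    moreover have "(r\<^sup>2) ^ j = exp (- 2 * (real j * e k))"
      by (simp add: r_def power_mult[symmetric] exp_of_nat_mult[symmetric] mult.assoc)
    ultimately show ?thesis by simp
  qed
  have r1: "e k / 2 \<le> 1 - r" unfolding r_def using e by (intro one_minus_exp_ge) auto
  have "e k * exp (- 2) / (22 * (1 + (real (Suc k))\<^sup>2)) * (\<Sum>j<Suc n. (cmod (b j))\<^sup>2)
      = e k / 2 / D * (\<Sum>j<Suc n. (cmod (b j))\<^sup>2 * exp (- 2))"
    unfolding D_def by (simp add: sum_distrib_right[symmetric] del: sum.lessThan_Suc)
  also have "\<dots> \<le> (1 - r) / D * (\<Sum>j<Suc n. (cmod (b j))\<^sup>2 * (r\<^sup>2) ^ j)"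
    using r1 D0 e rj by (intro mult_mono divide_right_mono sum_mono mult_left_mono) (auto intro!: sum_nonneg simp del: sum.lessThan_Suc)
  also have "\<dots> \<le> (LINT t|circ. (1 - cmod (bdry s t)) * (cmod (\<Sum>j<Suc n. b j * bdry s t ^ j))\<^sup>2) / (2 * pi)"
    using spiral_arc_lower_bound[of s k b "Suc n"] s unfolding r_def e_def D_def by (simp del: sum.lessThan_Suc)
  also have "\<dots> = l2sq (taylor_coeff (?T (\<lambda>z. \<Sum>j<Suc n. b j * z ^ j)))"
    by (rule weighted_poly_norm(2)[OF s(1) w, symmetric])
  also have "\<dots> = (h2norm (?T (\<lambda>z. \<Sum>j<Suc n. b j * z ^ j)))\<^sup>2"
    by (rule h2norm_sq[symmetric]) (rule weighted_poly_norm(1)[OF s(1) w])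
  finally show "e k * exp (- 2) / (22 * (1 + (real (Suc k))\<^sup>2)) * (\<Sum>j<Suc n. (cmod (b j))\<^sup>2)
      \<le> (h2norm (?T (\<lambda>z. \<Sum>j<Suc n. b j * z ^ j)))\<^sup>2" .
qed

text \<open>The sixth power of \<open>sqrt x\<close> is \<open>x ^ 3\<close>, one degree more than
  needed; hence the splitting of the exponent into six equal parts and \<open>exp y \<ge> y\<close>
  for each.\<close>

lemma exp_sqrt_beats_quadratic:
  fixes q C :: real
  assumes q: "0 < q"
  shows "\<exists>k::nat. C * (1 + (real (Suc k))\<^sup>2) < exp (q * sqrt (real (Suc k)))"
proof -
  obtain k :: nat where k: "2 * \<bar>C\<bar> / (q / 6) ^ 6 < real k" using reals_Archimedean2 by blast
  define x where "x = real (Suc k)"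
  have x1: "1 \<le> x" by (simp add: x_def)
  have "2 * \<bar>C\<bar> / (q / 6) ^ 6 < x" using k by (simp add: x_def)
  then have "2 * \<bar>C\<bar> < (q / 6) ^ 6 * x" using q by (simp add: field_simps)
  then have "2 * \<bar>C\<bar> * x\<^sup>2 < (q / 6) ^ 6 * x * x\<^sup>2" using x1 by (intro mult_strict_right_mono) auto
  also have "\<dots> = (q / 6 * sqrt x) ^ 6"
  proof -
    have "(sqrt x) ^ 6 = ((sqrt x)\<^sup>2) ^ 3" by (simp add: power_mult[symmetric])
    also have "\<dots> = x ^ 3" using x1 by simp
    finally have "(q / 6 * sqrt x) ^ 6 = (q / 6) ^ 6 * x ^ 3" by (simp only: power_mult_distrib)
    then show ?thesis by (simp add: power2_eq_square power3_eq_cube)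
  qed
  also have "\<dots> \<le> (exp (q / 6 * sqrt x)) ^ 6"
  proof (rule power_mono)
    show "q / 6 * sqrt x \<le> exp (q / 6 * sqrt x)"
      using exp_ge_add_one_self[of "q / 6 * sqrt x"] by linarith
    show "0 \<le> q / 6 * sqrt x" using q x1 by simp
  qed
  also have "\<dots> = exp (q * sqrt x)" by (simp add: exp_of_nat_mult[symmetric])
  finally have "2 * \<bar>C\<bar> * x\<^sup>2 < exp (q * sqrt x)" .
  moreover have "C * (1 + x\<^sup>2) \<le> \<bar>C\<bar> * (x\<^sup>2 + x\<^sup>2)"
    using x1 by (intro mult_mono) auto
  ultimately show ?thesis unfolding x_def by (intro exI[of _ k]) simp
qed

text \<open>Summing the lower bounds gives (1/e) (e/A)^(p/2) \<le> S, with \<open>A\<close>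
  quadratic in \<open>k\<close>. The surviving power e^-(1 - p/2) is exponential in
  \<open>sqrt k\<close>, so no finite \<open>S\<close> works for all \<open>k\<close>.\<close>

lemma weighted_composition_not_Schatten:
  assumes s: "0 < s" "s \<le> 1" and w: "boundary_weight s w" and p: "0 < p" "p < 2"
  shows "\<not> Schatten p (\<lambda>f z. w z * f (spiral s z))"
proof
  let ?T = "\<lambda>f z. w z * f (spiral s z)"
  assume "Schatten p ?T"
  then have sm: "summable (\<lambda>n. sing_num ?T n powr p)" by (simp add: Schatten_def)
  define S where "S = (\<Sum>n. sing_num ?T n powr p)"
  define q where "q = 1 - p / 2"
  have q: "0 < q" "q < 1" using p by (auto simp: q_def)
  have main: "exp (q * sqrt (real (Suc k))) \<le> S * (22 * exp 2) * (1 + (real (Suc k))\<^sup>2)" for k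
  proof -
    define e where "e = s * exp (- sqrt (real (Suc k)))"
    have e: "0 < e" "e \<le> exp (- sqrt (real (Suc k)))" using s by (auto simp: e_def mult_left_le_one_le)
    define A where "A = 22 * exp 2 * (1 + (real (Suc k))\<^sup>2)"
    have A1: "1 \<le> A"
    proof -
      have "1 * 1 \<le> 22 * exp 2 * (1 + (real (Suc k))\<^sup>2)"
        using one_le_exp_iff[of "2::real"] by (intro mult_mono) (auto intro: order_trans[of _ "exp 2"])
      then show ?thesis by (simp add: A_def)
    qed
    \<comment> \<open>The successor makes \<open>1 / e \<le> N\<close> true, while every index below
      \<open>N\<close> is still at most the floor of \<open>1 / e\<close> and so admissible for the
      singular number estimate.\<close>
    define N where "N = Suc (nat \<lfloor>1 / e\<rfloor>)"
    have N: "1 / e \<le> real N" using e unfolding N_def by linarith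
    have low: "(e / A) powr (p / 2) \<le> sing_num ?T n powr p" if "n < N" for n
    proof -
      have "real n \<le> of_int \<lfloor>1 / e\<rfloor>" using that e unfolding N_def by (auto simp: less_Suc_eq_le le_nat_iff)
      also have "\<dots> \<le> 1 / e" by simp
      finally have "real n * e \<le> 1" using e by (simp add: field_simps)
      from weighted_composition_sing_num_ge[OF s w, of n k, folded e_def, OF this]
      have "sqrt (e * exp (- 2) / (22 * (1 + (real (Suc k))\<^sup>2))) \<le> sing_num ?T n" .
      moreover have "e * exp (- 2) / (22 * (1 + (real (Suc k))\<^sup>2)) = e / A"
        by (simp add: A_def exp_minus field_simps)
      ultimately have "sqrt (e / A) powr p \<le> sing_num ?T n powr p"
        using p e A1 by (intro powr_mono2) auto
      moreover have "sqrt (e / A) powr p = (e / A) powr (p / 2)"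
        using e A1 by (simp add: powr_half_sqrt[symmetric] powr_powr)
      ultimately show ?thesis by simp
    qed
    have "real N * (e / A) powr (p / 2) = (\<Sum>n<N. (e / A) powr (p / 2))" by simp
    also have "\<dots> \<le> (\<Sum>n<N. sing_num ?T n powr p)" by (intro sum_mono low) auto
    also have "\<dots> \<le> S" unfolding S_def by (intro sum_le_suminf sm) auto
    finally have "real N * (e / A) powr (p / 2) \<le> S" .
    moreover have "1 / e * (e / A) powr (p / 2) \<le> real N * (e / A) powr (p / 2)"
      by (intro mult_right_mono N) auto
    ultimately have 1: "1 / e * (e / A) powr (p / 2) \<le> S" by linarith
    have "exp (q * sqrt (real (Suc k))) = exp (- sqrt (real (Suc k))) powr (- q)"
      by (simp add: powr_def)
    also have "\<dots> \<le> e powr (- q)" using e q by (intro powr_mono2') auto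
    also have "e powr (- q) = 1 / e * e powr (p / 2)"
    proof -
      have "e powr (- q) = e powr (- 1 + p / 2)" by (simp add: q_def)
      also have "\<dots> = e powr (- 1) * e powr (p / 2)" by (rule powr_add)
      finally show ?thesis using e by (simp add: powr_minus_divide)
    qed
    also have "\<dots> = 1 / e * (e / A) powr (p / 2) * A powr (p / 2)"
      using e A1 by (simp add: powr_divide)
    \<comment> \<open>Since \<open>1 \<le> A\<close> and \<open>p / 2 < 1\<close>, the power of
      \<open>A\<close> may be replaced by \<open>A\<close>; the bound becomes quadratic whatever
      \<open>p\<close> is.\<close>
    also have "\<dots> \<le> S * A powr 1"
    proof (intro mult_mono 1 powr_mono)
      have "0 \<le> 1 / e * (e / A) powr (p / 2)" using e by simp
      then show "0 \<le> S" using 1 by linarith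
    qed (use p A1 in auto)
    also have "\<dots> = S * (22 * exp 2) * (1 + (real (Suc k))\<^sup>2)" using A1 by (simp add: A_def)
    finally show ?thesis .
  qed
  then show False using exp_sqrt_beats_quadratic[OF q(1), of "S * (22 * exp 2)"] by (meson not_le)
qed

text \<open>The strict inequality for the boundary modulus is asserted alongside the integrability,
  because \<open>ln\<close> is total and its value at 0 is a convention: integrability alone would
  not exclude boundary modulus 1 on a set of positive measure.\<close>

theorem theorem4p3:
  shows "\<exists>\<phi>. \<phi> holomorphic_on ball 0 1 \<and> \<phi> ` ball 0 1 \<subseteq> ball 0 1 \<and>
    (AE t in lborel. t \<in> {0..2*pi} \<longrightarrow> cmod (radial_lim \<phi> (cis t)) < 1) \<and>
    set_integrable lborel {0..2*pi} (\<lambda>t. ln (1 - cmod (radial_lim \<phi> (cis t)))) \<and>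
    (\<forall>w. outer w \<and>
        (AE t in lborel. t \<in> {0..2*pi} \<longrightarrow>
           (cmod (radial_lim w (cis t)))\<^sup>2 = 1 - cmod (radial_lim \<phi> (cis t)))
      \<longrightarrow> hilbert_schmidt (\<lambda>f z. w z * f (\<phi> z)) \<and>
          (\<forall>p::real. 0 < p \<and> p < 2 \<longrightarrow> \<not> Schatten p (\<lambda>f z. w z * f (\<phi> z))))"
proof -
  define junk where "junk = (THE l::complex. False)"
  obtain s where s: "1 / 2 \<le> s" "s \<le> 1"
    and avoid: "\<And>m::nat. 1 - exp (- s * exp (- sqrt (real m))) \<noteq> (cmod junk)\<^sup>2"
    using scale_avoiding_value[of "(cmod junk)\<^sup>2"] by blast
  have s0: "0 < s" "0 \<le> s" using s by auto
  have weight: "boundary_weight s w"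
    if w: "outer w" and eq: "AE t in circ. (cmod (radial_lim w (cis t)))\<^sup>2 = 1 - cmod (radial_lim (spiral s) (cis t))" for w
  proof -
    have lim: "AE t in circ. \<exists>l. (cmod l)\<^sup>2 = 1 - cmod (bdry s t) \<and> (\<lambda>k. w (of_real (rad k) * cis t)) \<longlonglongrightarrow> l"
      using eq AE_circ_regular
    proof eventually_elim
      case (elim t)
      then have t: "t \<in> {0<..<2*pi}" "cot (t / 2) \<notin> \<int>" by auto
      have e: "(cmod (radial_lim w (cis t)))\<^sup>2 = 1 - cmod (bdry s t)"
        using elim bdry_regular(3)[OF s0(2) t] by simp
      then have "radial_lim w (cis t) \<noteq> junk"
        using avoid[of "nat \<lceil>cot (t / 2)\<rceil>"] bdry_regular(4)[OF s0(2) t] by auto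
      from radial_lim_tendsto[OF this[unfolded junk_def]]
      have "((\<lambda>r. w (of_real r * cis t)) \<longlongrightarrow> radial_lim w (cis t)) (at_left 1)" .
      from filterlim_compose[OF this rad_tendsto] e show ?case by blast
    qed
    have "AE t in circ. \<exists>l. cmod l \<le> 1 \<and> (\<lambda>k. w (of_real (rad k) * cis t)) \<longlonglongrightarrow> l"
      using lim
    proof eventually_elim
      case (elim t)
      then obtain l where l: "(cmod l)\<^sup>2 = 1 - cmod (bdry s t)" "(\<lambda>k. w (of_real (rad k) * cis t)) \<longlonglongrightarrow> l" by blast
      have "(cmod l)\<^sup>2 \<le> 1\<^sup>2" using l(1) by simp
      then have "cmod l \<le> 1" by (rule power2_le_imp_le) simp
      then show ?case using l(2) by blast
    qed
    then show ?thesis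
      unfolding boundary_weight_def using outer_bounded_by_1[OF w] outer_holomorphic[OF w] lim by blast
  qed
  have "AE t in circ. cmod (radial_lim (spiral s) (cis t)) < 1"
    using AE_circ_regular AE_bdry_lt_1[OF s0(1)]
    by eventually_elim (use bdry_regular(3)[OF s0(2)] in simp)
  then show ?thesis
    using spiral_holomorphic[OF s0(2)] spiral_self_map[OF s0(2)] log_integrable_radial[OF s]
      weighted_composition_hilbert_schmidt[OF s0(1) weight]
      weighted_composition_not_Schatten[OF s0(1) s(2) weight]
    by (intro exI[of _ "spiral s"]) (auto simp: AE_circ_iff integrable_circ_iff)
qed

end
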